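(* Let $\beta\in[1,2)$ be fixed. Let $\mathbf{X}=(X_t)_{t\ge0}$ be an isotropic Lévy process in $\mathbb{R}^d$ with $X_0=0$ whose (radial) Lévy–Khintchine exponent $\psi$, viewed as a function $\psi(s)$ of $s=\|x\|>0$, is regularly varying at infinity of index $\alpha\in(\beta,2]$. Let $g:\mathbb{R}^d\to\mathbb{R}$ be a bounded Borel function and $\mu$ a finite Borel measure on $\mathbb{R}^d$. Set $r(x)=\int_{\mathbb{R}^d}g(x+y)\,\mu(dy)$. Assume that the limit $$R_\beta(\theta)=\lim_{t\to0^+}t^{-\beta}\left(r(t\theta)+r(-t\theta)-2r(0)\right)$$ exists for all $\theta\in\mathbb{S}^{d-1}$ and that for some $L>0$ $$|r(x)+r(-x)-2r(0)|\le L\|x\|^\beta\quad\text{for all }x\in\mathbb{R}^d.$$ Let $H_g^\mu(t)=\int_{\mathbb{R}^d}\mathbb{E}^xg(X_t)\,\mu(dx)$, $t\ge0$. Then $$\lim_{t\to0^+}[\psi^-(1/t)]^\beta\left(H_g^\mu(t)-H_g^\mu(0)\right)=\pi^{-d/2}\,4^{\beta/2-1}\,\Gamma\left(\frac{d+\beta}{2}\right)\frac{\Gamma\left(1-\frac{\beta}{\alpha}\right)}{\Gamma\left(1-\frac{\beta}{2}\right)}\int_{\mathbb{S}^{d-1}}R_\beta(\theta)\,\sigma(d\theta).$$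
   Context: $\|\cdot\|$ and $\langle\cdot,\cdot\rangle$ are the Euclidean norm and scalar product; $\mathbb{S}^{d-1}$ is the unit sphere in $\mathbb{R}^d$ and $\sigma$ its (unnormalized) surface measure (counting measure on $\{-1,1\}$ if $d=1$). A Lévy process $\mathbf{X}$ is isotropic if the law of $X_t$ is rotationally invariant for each $t>0$. Its Lévy–Khintchine exponent, defined by $\mathbb{E}\,e^{i\langle x,X_t\rangle}=e^{-t\psi(x)}$, then has the form $$\psi(x)=\lambda\|x\|^2+\int_{\mathbb{R}^d}(1-\cos\langle x,y\rangle)\,\nu(dy)$$ with $\lambda\ge0$ and $\nu$ a rotationally invariant Lévy measure; one writes $\psi(s)$ for $\psi(x)$ with $\|x\|=s$. A function $f$ is regularly varying at infinity of index $\alpha$ if $\lim_{s\to\infty}f(\lambda s)/f(s)=\lambda^\alpha$ for every $\lambda>0$. $\psi^*(u)=\sup_{\|x\|\le u}\psi(x)$, and $\psi^-$ is the generalized inverse of $\psi^*$: $\psi^-(u)=\inf\{x\ge0:\psi^*(x)\ge u\}$. $\mathbb{E}^x$ denotes expectation for the process started at $x$, i.e. $\mathbb{E}^xg(X_t)=\mathbb{E}\,g(x+X_t)$ with $X_0=0$. *)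

theory Defs
  imports "HOL-Probability.Probability"
begin

locale levy_process = prob_space M
  for M :: "'w measure" and X :: "real \<Rightarrow> 'w \<Rightarrow> 'a::euclidean_space" +
  assumes random_variable_at: "0 \<le> t \<Longrightarrow> random_variable borel (X t)"
    and start_at_0: "AE \<omega> in M. X 0 \<omega> = 0"
    and independent_increments:
      "0 \<le> ts 0 \<Longrightarrow> (\<And>i. i < n \<Longrightarrow> ts i < ts (Suc i)) \<Longrightarrow>
        indep_vars (\<lambda>_. borel) (\<lambda>i \<omega>. X (ts (Suc i)) \<omega> - X (ts i) \<omega>) {..<n::nat}"
    and stationary_increments:
      "0 \<le> s \<Longrightarrow> 0 \<le> t \<Longrightarrow>
        distr M borel (\<lambda>\<omega>. X (s + t) \<omega> - X s \<omega>) = distr M borel (X t)"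
    and stochastically_continuous:
      "0 \<le> s \<Longrightarrow> 0 < e \<Longrightarrow>
        ((\<lambda>t. prob {\<omega> \<in> space M. e < dist (X t \<omega>) (X s \<omega>)}) \<longlongrightarrow> 0) (at s within {0..})"
    and cadlag:
      "AE \<omega> in M. (\<forall>t\<ge>0. ((\<lambda>s. X s \<omega>) \<longlongrightarrow> X t \<omega>) (at_right t)) \<and>
                  (\<forall>t>0. \<exists>l. ((\<lambda>s. X s \<omega>) \<longlongrightarrow> l) (at_left t))"

text \<open>
  Invariance is required under all of O(d), including reflections: for d = 1 it means symmetry
  of the law, and for d at least 2 it is the same as invariance under SO(d), since both groups
  act transitively on spheres.
\<close>

locale isotropic_levy_process = levy_process M X
  for M :: "'w measure" and X :: "real \<Rightarrow> 'w \<Rightarrow> 'a::euclidean_space" +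
  assumes isotropic:
    "0 < t \<Longrightarrow> orthogonal_transformation T \<Longrightarrow>
      distr M borel (\<lambda>\<omega>. T (X t \<omega>)) = distr M borel (X t)"

text \<open>
  The exponent of an isotropic process is real because the law of each X t is symmetric, so a
  real-valued function satisfying this equation is unique.
\<close>

definition levy_khintchine_exponent ::
    "'w measure \<Rightarrow> (real \<Rightarrow> 'w \<Rightarrow> 'a::euclidean_space) \<Rightarrow> ('a \<Rightarrow> real) \<Rightarrow> bool" where
  "levy_khintchine_exponent M X \<psi> \<longleftrightarrow>
    (\<forall>t\<ge>0. \<forall>x. (LINT \<omega>|M. iexp (x \<bullet> X t \<omega>)) = complex_of_real (exp (- t * \<psi> x)))"

definition regularly_varying_at_infinity :: "(real \<Rightarrow> real) \<Rightarrow> real \<Rightarrow> bool" where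
  "regularly_varying_at_infinity f \<alpha> \<longleftrightarrow>
    (\<forall>c>0. ((\<lambda>s. f (c * s) / f s) \<longlongrightarrow> c powr \<alpha>) at_top)"

definition sup_exponent :: "('a::euclidean_space \<Rightarrow> real) \<Rightarrow> real \<Rightarrow> real" where
  "sup_exponent \<psi> u = (SUP x\<in>cball 0 u. \<psi> x)"

definition inverse_exponent :: "('a::euclidean_space \<Rightarrow> real) \<Rightarrow> real \<Rightarrow> real" where
  "inverse_exponent \<psi> u = Inf {x. 0 \<le> x \<and> u \<le> sup_exponent \<psi> x}"

text \<open>
  The unnormalized surface measure of the unit sphere, as a Borel measure on the whole space:
  a set A gets d times the Lebesgue measure of the cone of all points s *R a with a in A of
  norm 1 and s in (0,1].
\<close>

definition sphere_measure :: "'a::euclidean_space measure" where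
  "sphere_measure =
    scale_measure (of_nat DIM('a)) (distr (restrict_space lborel (cball 0 1 - {0})) borel sgn)"

lemma sets_sphere_measure [simp]: "sets sphere_measure = sets borel"
  by (simp add: sphere_measure_def)

lemma emeasure_sphere_measure:
  fixes A :: "'a::euclidean_space set"
  assumes "A \<in> sets borel"
  shows "emeasure sphere_measure A =
    of_nat DIM('a) * emeasure lborel {x. x \<noteq> 0 \<and> norm x \<le> 1 \<and> x /\<^sub>R norm x \<in> A}"
proof -
  have B: "cball 0 1 - {0} \<in> sets (lborel :: 'a measure)" by simp
  have S: "(sgn :: 'a \<Rightarrow> 'a) \<in> borel_measurable (restrict_space lborel (cball 0 1 - {0}))"
    unfolding sgn_div_norm by (rule measurable_restrict_space1) simp
  have *: "sgn -` A \<inter> (cball 0 1 - {0}) = {x. x \<noteq> 0 \<and> norm x \<le> 1 \<and> x /\<^sub>R norm x \<in> A}"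
    by (auto simp: sgn_div_norm dist_norm)
  have "emeasure (restrict_space lborel (cball 0 1 - {0})) (sgn -` A \<inter> (cball 0 1 - {0})) =
      emeasure (lborel :: 'a measure) (sgn -` A \<inter> (cball 0 1 - {0}))"
    using B by (intro emeasure_restrict_space) auto
  with assms S show ?thesis
    by (simp add: sphere_measure_def emeasure_distr space_restrict_space *)
qed

lemma sphere_measure_real_eq_count:
  assumes "A \<in> sets borel"
  shows "emeasure (sphere_measure :: real measure) A = of_nat (card (A \<inter> {-1, 1}))"
proof -
  have 1: "emeasure lborel {x::real. x \<noteq> 0 \<and> norm x \<le> 1 \<and> x /\<^sub>R norm x \<in> A} =
      emeasure lborel ((if 1 \<in> A then {0<..1} else {}) \<union> (if -1 \<in> A then {-1..<0::real} else {}))"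
    by (rule arg_cong[where f = "emeasure lborel"])
       (auto simp: divide_simps abs_if split: if_splits)
  have 2: "emeasure lborel ({0<..1} \<union> {-1..<0::real}) = 2"
    by (subst plus_emeasure[symmetric]) auto
  show ?thesis
    unfolding emeasure_sphere_measure[OF assms] 1 using 2 by (auto simp: Int_insert_right)
qed

definition translation_average :: "('a::euclidean_space \<Rightarrow> real) \<Rightarrow> 'a measure \<Rightarrow> 'a \<Rightarrow> real" where
  "translation_average g \<mu> x = (LINT y|\<mu>. g (x + y))"

definition heat_functional ::
    "'w measure \<Rightarrow> (real \<Rightarrow> 'w \<Rightarrow> 'a::euclidean_space) \<Rightarrow> ('a \<Rightarrow> real) \<Rightarrow> 'a measure \<Rightarrow> real \<Rightarrow> real" where
  "heat_functional M X g \<mu> t = (LINT x|\<mu>. (LINT \<omega>|M. g (x + X t \<omega>)))"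

end

theory Submission
  imports Defs
begin

text \<open>
  Put \<open>r = translation_average g \<mu>\<close> and \<open>F x = r x + r (- x) - 2 * r 0\<close>. By Fubini and symmetry, the
  increment of the heat functional over \<open>[0, t]\<close> is half the expectation of \<open>F (X t)\<close>
  (\<open>second_difference_expectation\<close>). An isotropic law sees only the spherical means \<open>Fb\<close> of \<open>F\<close>
  (\<open>isotropic_law_polar\<close>), and the hypotheses on \<open>r\<close> say that \<open>Fb\<close> is bounded and that \<open>Fb z\<close> is asymptotic
  to \<open>z powr \<beta>\<close> times the mean \<open>Rb\<close> of \<open>R\<close> over the sphere (\<open>spherical_mean_properties\<close>). So the
  theorem is about the expectation of a radial function that looks like a power at the origin.

  Let \<open>\<phi>\<close> be the generalized inverse of the exponent at \<open>1 / t\<close>, so that \<open>t * \<psi>\<^sub>0 \<phi> = 1\<close>. Regular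
  variation makes \<open>t * \<psi>\<^sub>0 (\<phi> * u)\<close> tend to \<open>u powr \<alpha>\<close>, that is, \<open>\<phi> *\<^sub>R X t\<close> is asymptotically isotropic
  \<open>\<alpha>\<close>-stable, and the limit is \<open>Rb / 2\<close> times the moment of order \<open>\<beta>\<close> of that stable law. The variable
  \<open>X t\<close> itself may have no moment of order \<open>\<beta>\<close>, and weak convergence alone does not give convergence of
  moments. Both difficulties disappear when the power is replaced by the bounded kernel
  \<open>trunc_power\<close>, a mixture of the functions \<open>1 - exp (- (s * (norm x)\<^sup>2))\<close>. Their expectations are Gaussian
  averages of the characteristic function (\<open>radial_laplace_transform\<close>), hence explicit in terms of \<open>\<psi>\<^sub>0\<close>,
  and dominated convergence gives the limit together with its value
  (\<open>scaled_trunc_power_tendsto\<close>). The domination is a Potter-type bound for \<open>\<psi>\<^sub>0\<close>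
  (\<open>regularly_varying_bounds\<close>, \<open>inverse_exponent_scaling\<close>), valid for every positive order \<open>\<gamma> < \<alpha>\<close>; choosing
  \<open>\<beta> < \<gamma>\<close> is what uses \<open>\<beta> < \<alpha>\<close>.

  It remains to compare \<open>Fb\<close> with a multiple of the kernel. Their difference is at most \<open>\<epsilon>\<close> times the
  kernel plus a constant times \<open>1 - exp (- z\<^sup>2)\<close> (\<open>radial_profile_approx\<close>), and the expectation of the
  last term at \<open>z = norm (X t)\<close> is negligible against \<open>\<phi> powr - \<beta>\<close> (\<open>scaled_tail_tendsto_0\<close>).
\<close>

section \<open>Isotropic laws\<close>

text \<open>
  The reflection in the hyperplane orthogonal to \<open>a - b\<close>. When \<open>a = b\<close> the coefficient is a division
  by zero, hence 0, and the formula gives the identity.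
\<close>

lemma reflection_exists:
  fixes a b :: "'a::euclidean_space"
  assumes "norm a = norm b"
  obtains T where "orthogonal_transformation T" "T a = b"
proof -
  define w where "w = a - b"
  define T where "T = (\<lambda>z. z - (2 * (z \<bullet> w) / (w \<bullet> w)) *\<^sub>R w)"
  have "linear T"
    unfolding T_def
    by (rule linearI) (auto simp: algebra_simps inner_left_distrib add_divide_distrib)
  moreover have "T x \<bullet> T y = x \<bullet> y" for x y
    unfolding T_def by (cases "w = 0") (auto simp: algebra_simps inner_commute)
  ultimately have "orthogonal_transformation T"
    by (simp add: orthogonal_transformation_def)
  moreover have "T a = b"
  proof (cases "w = 0")
    case True
    then show ?thesis by (simp add: T_def w_def)
  next
    case False
    have "2 * (a \<bullet> w) = w \<bullet> w"
      using assms by (simp add: w_def norm_eq inner_diff_left inner_diff_right inner_commute)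
    with False show ?thesis by (simp add: T_def w_def)
  qed
  ultimately show thesis by (rule that)
qed

text \<open>
  Christensen's argument. For open \<open>U\<close> let \<open>I r\<close> be the product measure of the pairs of points of \<open>U\<close>
  at distance less than \<open>r\<close>. Integrating first over the second coordinate shows
  \<open>I r / h r \<longlongrightarrow> m U\<close> as \<open>r\<close> tends to 0, because a point of \<open>U\<close> has a whole small ball inside \<open>U\<close>;
  integrating first over the other coordinate shows \<open>I r / h r \<longlongrightarrow> s U\<close>. This yields both the
  uniqueness of the rotation invariant measure on the sphere and the rotation invariance of
  Lebesgue measure.
\<close>

lemma measure_eqI_uniform_on_balls:
  fixes m s :: "'a::euclidean_space measure"
  assumes sets[simp]: "sets m = sets borel" "sets s = sets borel"
    and conc: "AE x in m. x \<in> C" "AE x in s. x \<in> C"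
    and m: "\<And>x r. x \<in> C \<Longrightarrow> 0 < r \<Longrightarrow> emeasure m (ball x r) = ennreal (h r)"
    and s: "\<And>x r. x \<in> C \<Longrightarrow> 0 < r \<Longrightarrow> emeasure s (ball x r) = ennreal (h r)"
    and h: "\<And>r. 0 < r \<Longrightarrow> 0 < h r"
    and "C \<noteq> {}"
  shows "m = s"
proof -
  obtain x0 where x0: "x0 \<in> C" using \<open>C \<noteq> {}\<close> by blast
  have [simp]: "space m = UNIV" "space s = UNIV"
    using sets_eq_imp_space_eq[OF sets(1)] sets_eq_imp_space_eq[OF sets(2)] by simp_all
  have bd: "\<exists>R>0. U \<subseteq> ball x0 R" if "bounded U" for U
    using that bounded_subset_ballD by blast
  have fin: "emeasure m U < \<infinity>" "emeasure s U < \<infinity>" if "bounded U" "U \<in> sets borel" for U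
  proof -
    obtain R where R: "R > 0" "U \<subseteq> ball x0 R" using bd[OF \<open>bounded U\<close>] by blast
    show "emeasure m U < \<infinity>"
      using emeasure_mono[OF R(2), of m] m[OF x0 R(1)] by (auto simp: less_top[symmetric] top_unique)
    show "emeasure s U < \<infinity>"
      using emeasure_mono[OF R(2), of s] s[OF x0 R(1)] by (auto simp: less_top[symmetric] top_unique)
  qed
  have cov: "\<Union> (range (\<lambda>n. ball x0 (real n))) = UNIV"
    using reals_Archimedean2 by auto
  have sf: "sigma_finite_measure m" "sigma_finite_measure s"
  proof -
    show "sigma_finite_measure m"
      by (standard, rule exI[of _ "range (\<lambda>n. ball x0 (real n))"])
        (use fin(1)[of "ball x0 _"] cov in \<open>auto simp: less_top[symmetric]\<close>)
    show "sigma_finite_measure s"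
      by (standard, rule exI[of _ "range (\<lambda>n. ball x0 (real n))"])
        (use fin(2)[of "ball x0 _"] cov in \<open>auto simp: less_top[symmetric]\<close>)
  qed
  have near_meas: "(\<lambda>(x, y). indicator U x * indicator U y * indicator {z. dist (fst z) (snd z) < r} (x, y) :: ennreal)
      \<in> borel_measurable (a \<Otimes>\<^sub>M b)"
    if "U \<in> sets borel" "sets a = sets borel" "sets b = sets borel" for U r and a b :: "'a measure"
  proof -
    have [measurable]: "U \<in> sets borel" by fact
    have [measurable]: "{z. dist (fst z) (snd z) < r} \<in> sets (borel \<Otimes>\<^sub>M borel :: ('a \<times> 'a) measure)"
      unfolding borel_prod by (intro borel_open open_Collect_less continuous_intros)
    have "(\<lambda>z. indicator U (fst z) * indicator U (snd z) * indicator {z. dist (fst z) (snd z) < r} z :: ennreal)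
      \<in> borel_measurable (borel \<Otimes>\<^sub>M borel :: ('a \<times> 'a) measure)"
      by measurable
    then show ?thesis
      using measurable_cong_sets[OF sets_pair_measure_cong[OF that(2,3)] refl, of "borel :: ennreal measure"] by (simp only: split_beta' prod.collapse)
  qed
  \<comment> \<open>Stated for two measures in either order, so that it serves for both iterated integrals.\<close>
  have half: "(\<lambda>n. (\<integral>\<^sup>+x. (\<integral>\<^sup>+y. indicator U x * indicator U y * indicator {z. dist (fst z) (snd z) < r n} (x,y) \<partial>b) \<partial>a)
      / ennreal (h (r n))) \<longlonglongrightarrow> emeasure a U"
    if U: "open U" "bounded U" and r: "\<And>n. 0 < r n" "r \<longlonglongrightarrow> 0"
      and ab: "sets a = sets borel" "sets b = sets borel" and "AE x in a. x \<in> C"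
      and b: "\<And>x r. x \<in> C \<Longrightarrow> 0 < r \<Longrightarrow> emeasure b (ball x r) = ennreal (h r)"
      and fa: "emeasure a U < \<infinity>" and "sigma_finite_measure b"
    for U r and a b :: "'a measure"
  proof -
    interpret b: sigma_finite_measure b by fact
    have [measurable]: "U \<in> sets borel" using U by simp
    have spb: "space b = UNIV" using sets_eq_imp_space_eq[OF ab(2)] by simp
    define f where "f n x = (\<integral>\<^sup>+y. indicator U x * indicator U y * indicator {z. dist (fst z) (snd z) < r n} (x,y) \<partial>b)
      / ennreal (h (r n))" for n x
    have inner: "(\<lambda>x. \<integral>\<^sup>+y. indicator U x * indicator U y * indicator {z. dist (fst z) (snd z) < r n} (x,y) \<partial>b)
        \<in> borel_measurable a" for n
      using near_meas[OF \<open>U \<in> sets borel\<close> ab] by (rule b.borel_measurable_nn_integral)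
    then have fm: "f n \<in> borel_measurable a" for n
      unfolding f_def by (intro borel_measurable_divide_ennreal borel_measurable_const)
    have f_eq: "f n x = indicator U x * (emeasure b (U \<inter> ball x (r n)) / ennreal (h (r n)))" for n x
    proof -
      have "(\<integral>\<^sup>+y. indicator U x * indicator U y * indicator {z. dist (fst z) (snd z) < r n} (x,y) \<partial>b)
         = (\<integral>\<^sup>+y. indicator U x * indicator (U \<inter> ball x (r n)) y \<partial>b)"
        by (intro nn_integral_cong) (auto simp: indicator_def)
      also have "\<dots> = indicator U x * emeasure b (U \<inter> ball x (r n))"
      proof -
        have "U \<inter> ball x (r n) \<in> sets b" unfolding ab using U(1) by (intro borel_open open_Int open_ball)
        then show ?thesis by (simp only: nn_integral_cmult_indicator)
      qed
      finally show ?thesis by (simp add: f_def ennreal_times_divide)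
    qed
    have lim: "(\<lambda>n. f n x) \<longlonglongrightarrow> indicator U x" if "x \<in> C" for x
    proof (cases "x \<in> U")
      case True
      then obtain e where e: "e > 0" "ball x e \<subseteq> U" using U(1) openE by blast
      have "eventually (\<lambda>n. r n < e) sequentially"
        using r(2) e(1) by (rule order_tendstoD)
      then have "eventually (\<lambda>n. f n x = 1) sequentially"
      proof eventually_elim
        case (elim n)
        then have "U \<inter> ball x (r n) = ball x (r n)" using e(2) by auto
        then show ?case
          using b[OF that r(1)[of n]] h[OF r(1)[of n]] True
          by (simp add: f_eq divide_ennreal)
      qed
      then show ?thesis using True by (simp add: tendsto_eventually)
    qed (simp add: f_eq)
    have "(\<lambda>n. \<integral>\<^sup>+x. f n x \<partial>a) \<longlonglongrightarrow> (\<integral>\<^sup>+x. indicator U x \<partial>a)"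
    proof (rule nn_integral_dominated_convergence[where w="indicator U"])
      show "AE x in a. f n x \<le> indicator U x" for n
        using \<open>AE x in a. x \<in> C\<close>
      proof eventually_elim
        case (elim x)
        have "emeasure b (U \<inter> ball x (r n)) \<le> ennreal (h (r n))"
          using emeasure_mono[of "U \<inter> ball x (r n)" "ball x (r n)" b] b[OF elim r(1)[of n]] ab(2) by simp
        then have "emeasure b (U \<inter> ball x (r n)) / ennreal (h (r n)) \<le> ennreal (h (r n)) / ennreal (h (r n))"
          by (rule divide_right_mono_ennreal)
        also have "\<dots> = 1" using h[OF r(1)[of n]] by (simp add: divide_ennreal)
        finally show ?case by (simp add: f_eq split: split_indicator)
      qed
      show "AE x in a. (\<lambda>n. f n x) \<longlonglongrightarrow> indicator U x"
        using \<open>AE x in a. x \<in> C\<close> by eventually_elim (rule lim)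
      show "(\<integral>\<^sup>+x. indicator U x \<partial>a) < \<infinity>" using fa ab by simp
    qed (use ab fm in simp_all)
    moreover have "(\<integral>\<^sup>+x. f n x \<partial>a) = (\<integral>\<^sup>+x. (\<integral>\<^sup>+y. indicator U x * indicator U y * indicator {z. dist (fst z) (snd z) < r n} (x,y) \<partial>b) \<partial>a)
      / ennreal (h (r n))" for n
      unfolding f_def by (rule nn_integral_divide[OF inner])
    ultimately show ?thesis using ab by simp
  qed
  have eq: "emeasure m U = emeasure s U" if U: "open U" "bounded U" for U
  proof -
    define r where "r n = inverse (real (Suc n))" for n
    have r: "0 < r n" for n by (simp add: r_def)
    have r0: "r \<longlonglongrightarrow> 0" unfolding r_def by (rule LIMSEQ_inverse_real_of_nat)
    have [measurable]: "U \<in> sets borel" using U by simp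
    interpret pair_sigma_finite m s using sf by (simp add: pair_sigma_finite_def)
    have "(\<integral>\<^sup>+x. (\<integral>\<^sup>+y. indicator U x * indicator U y * indicator {z. dist (fst z) (snd z) < r n} (x,y) \<partial>s) \<partial>m) =
       (\<integral>\<^sup>+y. (\<integral>\<^sup>+x. indicator U x * indicator U y * indicator {z. dist (fst z) (snd z) < r n} (x,y) \<partial>m) \<partial>s)" for n
      using near_meas[OF \<open>U \<in> sets borel\<close> sets] by (rule Fubini'[symmetric])
    also have "\<dots>n = (\<integral>\<^sup>+x. (\<integral>\<^sup>+y. indicator U x * indicator U y * indicator {z. dist (fst z) (snd z) < r n} (x,y) \<partial>m) \<partial>s)" for n
      by (intro nn_integral_cong) (auto simp: indicator_def dist_commute)
    finally show ?thesis
      using half[OF U r r0 _ _ conc(1) s fin(1)[OF U(2)] sf(2)] half[OF U r r0 _ _ conc(2) m fin(2)[OF U(2)] sf(1)]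
      by (intro LIMSEQ_unique) simp_all
  qed
  show ?thesis
  proof (rule measure_eqI_generator_eq[where \<Omega>=UNIV and E="{U. open U \<and> bounded U}" and A="\<lambda>n. ball x0 (real n)"])
    show "Int_stable {U::'a set. open U \<and> bounded U}"
      by (auto simp: Int_stable_def intro: open_Int bounded_Int)
    have bs: "sets (borel :: 'a measure) = sigma_sets UNIV {S. open S}"
      unfolding borel_def by (rule sets_measure_of) simp
    have "sets borel = sigma_sets UNIV {U::'a set. open U \<and> bounded U}"
    proof
      have "U \<in> sigma_sets UNIV {U::'a set. open U \<and> bounded U}" if "open U" for U
      proof -
        have "U = (\<Union>n. U \<inter> ball x0 (real n))"
          using reals_Archimedean2 by auto
        also have "\<dots> \<in> sigma_sets UNIV {U::'a set. open U \<and> bounded U}"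
          using that by (intro sigma_sets.Union sigma_sets.Basic) (auto intro: open_Int bounded_Int)
        finally show ?thesis .
      qed
      then show "sets (borel::'a measure) \<subseteq> sigma_sets UNIV {U::'a set. open U \<and> bounded U}"
        unfolding bs by (intro sigma_sets_mono subsetI) simp
      show "sigma_sets UNIV {U::'a set. open U \<and> bounded U} \<subseteq> sets (borel::'a measure)"
        unfolding bs by (rule sigma_sets_mono') blast
    qed
    then show "sets m = sigma_sets UNIV {U. open U \<and> bounded U}" "sets s = sigma_sets UNIV {U. open U \<and> bounded U}"
      by simp_all
    show "(\<Union>n. ball x0 (real n)) = UNIV" using cov by simp
    show "emeasure m (ball x0 (real n)) \<noteq> \<infinity>" for n using fin(1)[of "ball x0 (real n)"] by auto
  qed (use eq in auto)
qed


lemma borel_measurable_orthogonal_transformation: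
  fixes T :: "'a::euclidean_space \<Rightarrow> 'a"
  assumes "orthogonal_transformation T"
  shows "T \<in> borel_measurable borel"
  using orthogonal_transformation_linear[OF assms]
  by (intro borel_measurable_continuous_onI linear_continuous_on linear_conv_bounded_linear[THEN iffD1])

lemma orthogonal_transformation_dist:
  assumes "orthogonal_transformation T"
  shows "dist (T x) (T y) = dist x y"
  using assms linear_diff[OF orthogonal_transformation_linear[OF assms], of x y]
  by (simp add: dist_norm) (metis orthogonal_transformation_norm)

lemma AE_scale_measure:
  assumes "AE x in m. P x"
  shows "AE x in scale_measure c m. P x"
  using assms by (auto simp: eventually_ae_filter null_sets_def space_scale_measure)

lemma invariant_measure_ball:
  fixes m :: "'a::euclidean_space measure"
  assumes sets: "sets m = sets borel"
    and inv: "\<And>T. orthogonal_transformation T \<Longrightarrow> distr m borel T = m"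
    and xy: "norm x = norm y"
  shows "emeasure m (ball x r) = emeasure m (ball y r)"
proof -
  obtain T where T: "orthogonal_transformation T" "T x = y"
    using reflection_exists[OF xy] .
  have meas: "T \<in> measurable m borel"
    using borel_measurable_orthogonal_transformation[OF T(1)] measurable_cong_sets[OF sets refl] by blast
  have "emeasure m (ball y r) = emeasure (distr m borel T) (ball y r)"
    by (simp only: inv[OF T(1)])
  also have "\<dots> = emeasure m (T -` ball y r \<inter> space m)"
    by (rule emeasure_distr[OF meas]) simp
  also have "T -` ball y r \<inter> space m = ball x r"
    using sets_eq_imp_space_eq[OF sets] T orthogonal_transformation_dist[OF T(1), of x]
    by auto
  finally show ?thesis ..
qed

text \<open>
  Finitely many balls of radius \<open>r\<close> cover the sphere, and by invariance they all have the same
  measure, so a null ball would make the whole measure zero.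
\<close>

lemma invariant_measure_ball_pos:
  fixes m :: "'a::euclidean_space measure"
  assumes sets: "sets m = sets borel" and conc: "AE x in m. x \<in> sphere 0 1"
    and inv: "\<And>T. orthogonal_transformation T \<Longrightarrow> distr m borel T = m"
    and nz: "emeasure m UNIV \<noteq> 0" and x: "x \<in> sphere 0 1" and "0 < r"
  shows "emeasure m (ball x r) \<noteq> 0"
proof
  assume 0: "emeasure m (ball x r) = 0"
  have "sphere (0::'a) 1 \<subseteq> (\<Union>y\<in>sphere 0 1. ball y r)" using \<open>0 < r\<close> by auto
  then obtain D where D: "D \<subseteq> sphere 0 1" "finite D" "sphere (0::'a) 1 \<subseteq> (\<Union>y\<in>D. ball y r)"
    using compactE_image[OF compact_sphere, of "sphere 0 1" "\<lambda>y. ball y r" 0 1] by auto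
  have "emeasure m (\<Union>y\<in>D. ball y r) \<le> (\<Sum>y\<in>D. emeasure m (ball y r))"
    by (rule emeasure_subadditive_finite[OF D(2)]) (simp add: sets image_subset_iff)
  also have "\<dots> = (\<Sum>y\<in>D. 0)"
  proof (rule sum.cong)
    fix y assume "y \<in> D"
    then have "norm x = norm y" using D(1) x by auto
    with invariant_measure_ball[OF sets inv] 0 show "emeasure m (ball y r) = 0" by metis
  qed simp
  finally have "emeasure m (\<Union>y\<in>D. ball y r) = 0" by simp
  moreover have "(\<Union>y\<in>D. ball y r) \<in> sets m"
    unfolding sets by (intro borel_open open_UN) simp
  ultimately have "(\<Union>y\<in>D. ball y r) \<in> null_sets m"
    by (simp only: null_sets_def mem_Collect_eq)
  then have "AE x in m. x \<notin> (\<Union>y\<in>D. ball y r)" by (rule AE_not_in)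
  with conc have "AE x in m. False"
  proof eventually_elim
    case (elim x)
    then show ?case using D(3) by blast
  qed
  then have "emeasure m (space m) = 0"
    by (simp only: eventually_False ae_filter_eq_bot_iff)
  moreover have "space m = UNIV" using sets_eq_imp_space_eq[OF sets] by simp
  ultimately show False using nz by simp
qed

text \<open>
  The ball measures of two invariant measures depend on the radius only, but they are two
  different functions of it. Counting pairs of close points shows that these functions are
  proportional with the total masses as factors, so after rescaling the measures agree on balls.
\<close>

lemma invariant_measure_sphere_unique:
  fixes m s :: "'a::euclidean_space measure"
  assumes fin: "finite_measure m" "finite_measure s"
    and sets: "sets m = sets borel" "sets s = sets borel"
    and conc: "AE x in m. x \<in> sphere 0 1" "AE x in s. x \<in> sphere 0 1"
    and inv: "\<And>T. orthogonal_transformation T \<Longrightarrow> distr m borel T = m"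
      "\<And>T. orthogonal_transformation T \<Longrightarrow> distr s borel T = s"
    and B: "B \<in> sets borel"
  shows "emeasure m B * emeasure s UNIV = emeasure m UNIV * emeasure s B"
proof (cases "emeasure m UNIV = 0 \<or> emeasure s UNIV = 0")
  case True
  have "emeasure m B \<le> emeasure m UNIV" "emeasure s B \<le> emeasure s UNIV"
    by (rule emeasure_mono; simp add: sets)+
  with True show ?thesis by (elim disjE) simp_all
next
  case False
  interpret m: finite_measure m by fact
  interpret s: finite_measure s by fact
  have sp: "space m = UNIV" "space s = UNIV"
    using sets[THEN sets_eq_imp_space_eq] by simp_all
  obtain e :: 'a where e: "norm e = 1" using vector_choose_size[of 1] by auto
  define M S where "M = measure m UNIV" and "S = measure s UNIV"
  have MS: "emeasure m UNIV = ennreal M" "emeasure s UNIV = ennreal S" "M > 0" "S > 0"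
    using False by (auto simp: M_def S_def m.emeasure_eq_measure s.emeasure_eq_measure zero_less_measure_iff)
  define hm hs where "hm r = measure m (ball e r)" and "hs r = measure s (ball e r)" for r
  have hm: "emeasure m (ball x r) = ennreal (hm r)" if "x \<in> sphere 0 1" for x r
    using invariant_measure_ball[OF sets(1) inv(1), of x e r, simplified] that e
    by (simp add: hm_def m.emeasure_eq_measure)
  have hs: "emeasure s (ball x r) = ennreal (hs r)" if "x \<in> sphere 0 1" for x r
    using invariant_measure_ball[OF sets(2) inv(2), of x e r] that e
    by (simp add: hs_def s.emeasure_eq_measure)
  have pos: "hm r > 0" if "r > 0" for r
    using invariant_measure_ball_pos[OF sets(1) conc(1) inv(1), of e r] that e False
    by (auto simp: hm_def m.emeasure_eq_measure zero_less_measure_iff)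
  interpret P: pair_sigma_finite m s ..
  have cross: "S * hm r = M * hs r" if "r > 0" for r
  proof -
    have D[measurable]: "{z. dist (fst z) (snd z) < r} \<in> sets (borel \<Otimes>\<^sub>M borel :: ('a \<times> 'a) measure)"
      unfolding borel_prod by (intro borel_open open_Collect_less continuous_intros)
    have "(\<integral>\<^sup>+x. (\<integral>\<^sup>+y. indicator {z. dist (fst z) (snd z) < r} (x,y) \<partial>s) \<partial>m) =
          (\<integral>\<^sup>+x. ennreal (hs r) \<partial>m)"
    proof (rule nn_integral_cong_AE)
      show "AE x in m. (\<integral>\<^sup>+y. indicator {z. dist (fst z) (snd z) < r} (x,y) \<partial>s) = ennreal (hs r)"
        using conc(1)
      proof eventually_elim
        case (elim x)
        have "(\<integral>\<^sup>+y. indicator {z. dist (fst z) (snd z) < r} (x,y) \<partial>s) = (\<integral>\<^sup>+y. indicator (ball x r) y \<partial>s)"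
          by (intro nn_integral_cong) (auto simp: indicator_def)
        then show ?case using hs[OF elim] sets by simp
      qed
    qed
    moreover have "(\<integral>\<^sup>+y. (\<integral>\<^sup>+x. indicator {z. dist (fst z) (snd z) < r} (x,y) \<partial>m) \<partial>s) =
          (\<integral>\<^sup>+x. ennreal (hm r) \<partial>s)"
    proof (rule nn_integral_cong_AE)
      show "AE y in s. (\<integral>\<^sup>+x. indicator {z. dist (fst z) (snd z) < r} (x,y) \<partial>m) = ennreal (hm r)"
        using conc(2)
      proof eventually_elim
        case (elim y)
        have "(\<integral>\<^sup>+x. indicator {z. dist (fst z) (snd z) < r} (x,y) \<partial>m) = (\<integral>\<^sup>+x. indicator (ball y r) x \<partial>m)"
          by (intro nn_integral_cong) (auto simp: indicator_def dist_commute)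
        then show ?case using hm[OF elim] sets by simp
      qed
    qed
    moreover have "(\<integral>\<^sup>+y. (\<integral>\<^sup>+x. indicator {z. dist (fst z) (snd z) < r} (x,y) \<partial>m) \<partial>s) =
        (\<integral>\<^sup>+x. (\<integral>\<^sup>+y. indicator {z. dist (fst z) (snd z) < r} (x,y) \<partial>s) \<partial>m)"
    proof (rule P.Fubini')
      have "(\<lambda>z. indicator {z. dist (fst z) (snd z) < r} z :: ennreal) \<in> borel_measurable (borel \<Otimes>\<^sub>M borel :: ('a \<times> 'a) measure)"
        by measurable
      then show "(\<lambda>(x, y). indicator {z. dist (fst z) (snd z) < r} (x, y) :: ennreal) \<in> borel_measurable (m \<Otimes>\<^sub>M s)"
        using measurable_cong_sets[OF sets_pair_measure_cong[OF sets] refl, of "borel :: ennreal measure"] by (simp only: split_beta' prod.collapse)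
    qed
    ultimately have "ennreal (hm r) * ennreal S = ennreal (hs r) * ennreal M"
      using MS sp by simp
    then show ?thesis
      using MS by (simp add: ennreal_mult'[symmetric] hm_def hs_def mult.commute)
  qed
  have "scale_measure (ennreal S) m = scale_measure (ennreal M) s"
  proof (rule measure_eqI_uniform_on_balls[where C="sphere 0 1" and h="\<lambda>r. S * hm r"])
    show "AE x in scale_measure (ennreal S) m. x \<in> sphere 0 1"
      by (rule AE_scale_measure[OF conc(1)])
    show "AE x in scale_measure (ennreal M) s. x \<in> sphere 0 1"
      by (rule AE_scale_measure[OF conc(2)])
    show "emeasure (scale_measure (ennreal S) m) (ball x r) = ennreal (S * hm r)" if "x \<in> sphere 0 1" for x r
      using hm[OF that] MS by (simp add: ennreal_mult')
    show "emeasure (scale_measure (ennreal M) s) (ball x r) = ennreal (S * hm r)" if "x \<in> sphere 0 1" "0 < r" for x r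
      using hs[OF that(1)] cross[OF that(2)] MS by (simp add: ennreal_mult')
    show "sphere (0::'a) 1 \<noteq> {}" using e by auto
  qed (use sets MS pos in auto)
  then have "emeasure (scale_measure (ennreal S) m) B = emeasure (scale_measure (ennreal M) s) B"
    by (rule arg_cong)
  then show ?thesis by (simp only: MS emeasure_scale_measure mult.commute)
qed

lemma lborel_orthogonal_transformation:
  fixes T :: "'a::euclidean_space \<Rightarrow> 'a"
  assumes T: "orthogonal_transformation T"
  shows "distr lborel borel T = lborel"
proof (rule measure_eqI_uniform_on_balls[where C=UNIV and h="\<lambda>r. unit_ball_vol DIM('a) * r ^ DIM('a)"])
  note [measurable] = borel_measurable_orthogonal_transformation[OF T]
  fix x :: 'a and r :: real assume r: "0 < r"
  obtain y where y: "T y = x" using orthogonal_transformation_surj[OF T] by (metis surjD)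
  have "T -` ball x r = ball y r"
    using y orthogonal_transformation_dist[OF T, of y] by auto
  then show "emeasure (distr lborel borel T) (ball x r) = ennreal (unit_ball_vol DIM('a) * r ^ DIM('a))"
    using emeasure_ball[of r y] r by (simp add: emeasure_distr)
  show "emeasure lborel (ball x r) = ennreal (unit_ball_vol DIM('a) * r ^ DIM('a))"
    using emeasure_ball[of r x] r by simp
qed auto

lemma sgn_measurable_borel: "(sgn :: 'a::euclidean_space \<Rightarrow> 'a) \<in> borel_measurable borel"
  unfolding sgn_div_norm by measurable

lemma sgn_orthogonal_transformation:
  assumes "orthogonal_transformation T"
  shows "sgn (T x) = T (sgn x)"
  using assms orthogonal_transformation_linear[OF assms]
  by (simp add: sgn_div_norm orthogonal_transformation_norm linear_cmul)

lemma space_sphere_measure [simp]: "space sphere_measure = UNIV"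
  using sets_eq_imp_space_eq[OF sets_sphere_measure] by simp

lemma measurable_sphere_measure [simp]: "measurable sphere_measure N = measurable borel N"
  by (rule measurable_cong_sets[OF sets_sphere_measure refl])

lemma emeasure_sphere_measure_UNIV:
  "emeasure (sphere_measure :: 'a::euclidean_space measure) UNIV = ennreal (DIM('a) * unit_ball_vol DIM('a))"
proof -
  have "emeasure lborel {x::'a. x \<noteq> 0 \<and> norm x \<le> 1} = emeasure lborel (cball (0::'a) 1 - {0})"
    by (rule arg_cong[where f="emeasure lborel"]) (auto simp: dist_norm)
  also have "\<dots> = emeasure lborel (cball (0::'a) 1)"
    by (rule emeasure_Diff_null_set) auto
  finally show ?thesis
    by (simp add: emeasure_sphere_measure emeasure_cball ennreal_mult ennreal_of_nat_eq_real_of_nat)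
qed

lemma finite_measure_sphere_measure: "finite_measure (sphere_measure :: 'a::euclidean_space measure)"
  by (rule finite_measureI) (simp add: emeasure_sphere_measure_UNIV)

lemma AE_sphere_measure: "AE x in (sphere_measure :: 'a::euclidean_space measure). x \<in> sphere 0 1"
proof (rule AE_I')
  have no_cone: "{x::'a. x \<noteq> 0 \<and> norm x \<le> 1 \<and> x /\<^sub>R norm x \<in> - sphere 0 1} = {}"
  proof -
    have "x /\<^sub>R norm x \<in> sphere 0 1" if "x \<noteq> 0" for x :: 'a
      using that norm_sgn[of x] by (simp add: sgn_div_norm)
    then show ?thesis by blast
  qed
  have meas: "- sphere (0::'a) 1 \<in> sets borel"
    by (intro borel_comp borel_closed closed_sphere)
  then have "emeasure (sphere_measure :: 'a measure) (- sphere 0 1) = of_nat DIM('a) * emeasure lborel ({} :: 'a set)"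
    by (simp only: emeasure_sphere_measure no_cone)
  with meas show "- sphere 0 1 \<in> null_sets (sphere_measure :: 'a measure)"
    by (simp only: null_sets_def mem_Collect_eq sets_sphere_measure emeasure_empty mult_zero_right)
qed auto

lemma sphere_measure_orthogonal_transformation:
  fixes T :: "'a::euclidean_space \<Rightarrow> 'a"
  assumes T: "orthogonal_transformation T"
  shows "distr sphere_measure borel T = sphere_measure"
proof (rule measure_eqI)
  note [measurable] = borel_measurable_orthogonal_transformation[OF T] sgn_measurable_borel
  fix A assume "A \<in> sets (distr sphere_measure borel T)"
  then have A[measurable]: "A \<in> sets borel" by simp
  have TA: "T -` A \<in> sets borel" using measurable_sets[OF borel_measurable_orthogonal_transformation[OF T] A] by simp
  have C: "{x. x \<noteq> 0 \<and> norm x \<le> 1 \<and> x /\<^sub>R norm x \<in> A} \<in> sets borel"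
  proof -
    have "{x\<in>space borel. x \<noteq> 0 \<and> norm x \<le> 1 \<and> x /\<^sub>R norm x \<in> A} \<in> sets borel" by measurable
    then show ?thesis by simp
  qed
  have T0: "T x = 0 \<longleftrightarrow> x = 0" for x
    by (metis T norm_eq_zero orthogonal_transformation_norm)
  have 1: "{x. x \<noteq> 0 \<and> norm x \<le> 1 \<and> x /\<^sub>R norm x \<in> T -` A} = T -` {x. x \<noteq> 0 \<and> norm x \<le> 1 \<and> x /\<^sub>R norm x \<in> A}"
    using T orthogonal_transformation_linear[OF T]
    by (auto simp: orthogonal_transformation_norm linear_cmul T0)
  have "emeasure (distr sphere_measure borel T) A = emeasure sphere_measure (T -` A)"
    by (subst emeasure_distr) (auto simp: borel_measurable_orthogonal_transformation[OF T])
  also have "\<dots> = of_nat DIM('a) * emeasure lborel (T -` {x. x \<noteq> 0 \<and> norm x \<le> 1 \<and> x /\<^sub>R norm x \<in> A})"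
    by (simp only: emeasure_sphere_measure[OF TA] 1)
  also have "emeasure lborel (T -` {x. x \<noteq> 0 \<and> norm x \<le> 1 \<and> x /\<^sub>R norm x \<in> A}) =
      emeasure (distr lborel borel T) {x. x \<noteq> 0 \<and> norm x \<le> 1 \<and> x /\<^sub>R norm x \<in> A}"
    using C by (subst emeasure_distr) auto
  finally show "emeasure (distr sphere_measure borel T) A = emeasure sphere_measure A"
    by (simp add: lborel_orthogonal_transformation[OF T] emeasure_sphere_measure)
qed simp


text \<open>
  For a fixed set \<open>A\<close> of radii, the law of the direction restricted to the event that the radius
  lies in \<open>A\<close> is an invariant measure on the sphere, hence a multiple of the surface measure.
\<close>

lemma isotropic_law_sgn:
  fixes \<rho> :: "'a::euclidean_space measure"
  assumes fin: "finite_measure \<rho>" and sets: "sets \<rho> = sets borel"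
    and inv: "\<And>T. orthogonal_transformation T \<Longrightarrow> distr \<rho> borel T = \<rho>"
    and A: "A \<in> sets borel" and B: "B \<in> sets borel"
  shows "emeasure \<rho> {x. x \<noteq> 0 \<and> norm x \<in> A \<and> sgn x \<in> B} * emeasure (sphere_measure :: 'a measure) UNIV =
    emeasure \<rho> {x. x \<noteq> 0 \<and> norm x \<in> A} * emeasure (sphere_measure :: 'a measure) B"
proof -
  interpret finite_measure \<rho> by fact
  have sp: "space \<rho> = UNIV" using sets_eq_imp_space_eq[OF sets] by simp
  have mc: "measurable \<rho> N = measurable borel N" for N by (rule measurable_cong_sets[OF sets refl])
  define D where "D = {x::'a. x \<noteq> 0 \<and> norm x \<in> A}"
  have "{x\<in>space (borel :: 'a measure). x \<noteq> 0 \<and> norm x \<in> A} \<in> sets borel"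
    using A by measurable
  then have D: "D \<in> sets borel" by (simp add: D_def)
  define m where "m = distr (density \<rho> (indicator D)) borel (sgn :: 'a \<Rightarrow> 'a)"
  have m: "emeasure m B = emeasure \<rho> (D \<inter> sgn -` B)" if B: "B \<in> sets borel" for B
  proof -
    have S: "sgn -` B \<in> sets borel"
      using measurable_sets[OF sgn_measurable_borel B] by simp
    have "emeasure m B = emeasure (density \<rho> (indicator D)) (sgn -` B)"
      unfolding m_def using B sgn_measurable_borel by (subst emeasure_distr) (auto simp: mc sp)
    also have "\<dots> = (\<integral>\<^sup>+x. indicator D x * indicator (sgn -` B) x \<partial>\<rho>)"
      using S D sets by (intro emeasure_density) (auto simp: mc)
    also have "\<dots> = (\<integral>\<^sup>+x. indicator (D \<inter> sgn -` B) x \<partial>\<rho>)"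
      by (simp add: indicator_inter_arith)
    finally show ?thesis using S D sets by simp
  qed
  have "emeasure m B * emeasure (sphere_measure :: 'a measure) UNIV = emeasure m UNIV * emeasure sphere_measure B"
  proof (rule invariant_measure_sphere_unique)
    show "finite_measure m"
      by (rule finite_measureI) (use m[of UNIV] in \<open>simp add: m_def\<close>)
    show "AE x in m. x \<in> sphere 0 1"
    proof (rule AE_I')
      have "D \<inter> sgn -` (- sphere 0 1) = {}" by (auto simp: D_def norm_sgn)
      then show "- sphere 0 1 \<in> null_sets m"
        using m[of "- sphere 0 1"] by (simp add: null_sets_def m_def)
    qed auto
    fix T :: "'a \<Rightarrow> 'a" assume T: "orthogonal_transformation T"
    note [measurable] = borel_measurable_orthogonal_transformation[OF T]
    show "distr m borel T = m"
    proof (rule measure_eqI)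
      fix C assume "C \<in> sets (distr m borel T)"
      then have C: "C \<in> sets borel" by simp
      have TC: "T -` C \<in> sets borel" using measurable_sets[OF borel_measurable_orthogonal_transformation[OF T] C] by simp
      have S: "sgn -` C \<in> sets (borel::'a measure)"
        using measurable_sets[OF sgn_measurable_borel C] by simp
      have "emeasure (distr m borel T) C = emeasure m (T -` C)"
        using C by (subst emeasure_distr) (auto simp: m_def)
      also have "\<dots> = emeasure \<rho> (D \<inter> sgn -` T -` C)" by (rule m[OF TC])
      also have "D \<inter> sgn -` T -` C = T -` (D \<inter> sgn -` C)"
      proof -
        have "T x = 0 \<longleftrightarrow> x = 0" for x
          by (metis T norm_eq_zero orthogonal_transformation_norm)
        then show ?thesis
          by (auto simp: D_def sgn_orthogonal_transformation[OF T] orthogonal_transformation_norm[OF T])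
      qed
      also have "emeasure \<rho> \<dots> = emeasure (distr \<rho> borel T) (D \<inter> sgn -` C)"
        using S D by (subst emeasure_distr) (auto simp: mc sp)
      also have "\<dots> = emeasure m C" using m[OF C] by (simp add: inv[OF T])
      finally show "emeasure (distr m borel T) C = emeasure m C" .
    qed (simp add: m_def)
  next
    show "finite_measure (sphere_measure :: 'a measure)" by (rule finite_measure_sphere_measure)
    show "AE x in (sphere_measure :: 'a measure). x \<in> sphere 0 1" by (rule AE_sphere_measure)
    show "distr sphere_measure borel T = sphere_measure" if "orthogonal_transformation T" for T :: "'a \<Rightarrow> 'a"
      by (rule sphere_measure_orthogonal_transformation[OF that])
  qed (use B in \<open>simp_all add: m_def\<close>)
  moreover have "D \<inter> sgn -` B = {x. x \<noteq> 0 \<and> norm x \<in> A \<and> sgn x \<in> B}" by (auto simp: D_def)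
  ultimately show ?thesis using m[OF B] m[of UNIV] by (simp add: D_def)
qed

text \<open>
  An isotropic law integrates a function as it integrates the spherical means of that function:
  away from the origin, norm and direction are independent and the direction is uniform. The
  origin has no direction, which is why \<open>F 0 = 0\<close> is assumed; both sides then vanish there.
\<close>

lemma isotropic_law_polar:
  fixes \<rho> :: "'a::euclidean_space measure" and F :: "'a \<Rightarrow> real"
  assumes fin: "finite_measure \<rho>" and sets: "sets \<rho> = sets borel"
    and inv: "\<And>T. orthogonal_transformation T \<Longrightarrow> distr \<rho> borel T = \<rho>"
    and F: "F \<in> borel_measurable borel" and bd: "\<And>x. \<bar>F x\<bar> \<le> K" and F0: "F 0 = 0"
  shows "(LINT x|\<rho>. F x) =
    (LINT x|\<rho>. (LINT \<theta>|sphere_measure. F (norm x *\<^sub>R \<theta>)) / (DIM('a) * unit_ball_vol DIM('a)))"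
proof -
  interpret finite_measure \<rho> by fact
  have sp: "space \<rho> = UNIV" using sets_eq_imp_space_eq[OF sets] by simp
  have mc: "measurable \<rho> N = measurable borel N" for N by (rule measurable_cong_sets[OF sets refl])
  define c where "c = DIM('a) * unit_ball_vol DIM('a)"
  have c: "c > 0" by (simp add: c_def)
  define D where "D = - {0::'a}"
  have D[measurable]: "D \<in> sets borel" "D \<in> sets \<rho>" by (auto simp: D_def sets)
  define \<rho>' where "\<rho>' = density \<rho> (\<lambda>x. ennreal (indicator D x))"
  define U where "U = density (sphere_measure :: 'a measure) (\<lambda>_. ennreal (1 / c))"
  define N where "N = distr \<rho>' borel (norm :: 'a \<Rightarrow> real)"
  note [measurable_cong] = sets
  note [measurable] = sgn_measurable_borel F
  have e: "emeasure \<rho>' C = emeasure \<rho> (D \<inter> C)" if "C \<in> sets borel" for C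
  proof -
    have "emeasure \<rho>' C = (\<integral>\<^sup>+x. ennreal (indicator D x) * indicator C x \<partial>\<rho>)"
      unfolding \<rho>'_def using that by (intro emeasure_density) (auto simp: sets)
    also have "\<dots> = (\<integral>\<^sup>+x. indicator (D \<inter> C) x \<partial>\<rho>)"
      by (intro nn_integral_cong) (auto simp: indicator_def)
    finally show ?thesis using that D by (simp add: sets)
  qed
  have [simp]: "sets \<rho>' = sets borel" "space \<rho>' = UNIV" by (simp_all add: \<rho>'_def sets sp)
  have f': "finite_measure \<rho>'" by (rule finite_measureI) (simp add: e)
  then have fN: "finite_measure N" unfolding N_def
    by (rule finite_measure.finite_measure_distr) (simp add: measurable_cong_sets[OF \<open>sets \<rho>' = sets borel\<close> refl])
  have Ue: "emeasure U B = ennreal (1 / c) * emeasure sphere_measure B" if "B \<in> sets borel" for B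
    unfolding U_def using that by (simp add: emeasure_density nn_integral_cmult)
  have fU: "finite_measure U"
    by (rule finite_measureI) (simp add: Ue U_def[THEN arg_cong[where f=space]] emeasure_sphere_measure_UNIV ennreal_mult_eq_top_iff)
  interpret N: finite_measure N by fact
  interpret U: finite_measure U by fact
  interpret P: pair_sigma_finite N U ..
  have m': "measurable \<rho>' L = measurable borel L" for L by (rule measurable_cong_sets) simp_all
  have PM: "N \<Otimes>\<^sub>M U = distr \<rho>' (borel \<Otimes>\<^sub>M borel) (\<lambda>x. (norm x, sgn x))"
  proof (rule pair_measure_eqI)
    fix A B assume "A \<in> sets N" "B \<in> sets U"
    then have AB[measurable]: "A \<in> sets borel" "B \<in> sets borel" by (simp_all add: N_def U_def)
    have "norm -` A \<in> sets (borel :: 'a measure)"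
      using measurable_sets[OF _ AB(1), of norm borel] by simp
    then have "emeasure N A = emeasure \<rho> (D \<inter> norm -` A)"
      unfolding N_def using AB by (subst emeasure_distr) (auto simp: m' e)
    also have "D \<inter> norm -` A = {x. x \<noteq> 0 \<and> norm x \<in> A}" by (auto simp: D_def)
    finally have 1: "emeasure N A = emeasure \<rho> {x. x \<noteq> 0 \<and> norm x \<in> A}" .
    have "{x \<in> space (borel :: 'a measure). norm x \<in> A \<and> sgn x \<in> B} \<in> sets borel" by measurable
    then have S: "(\<lambda>x. (norm x, sgn x)) -` (A \<times> B) \<in> sets (borel :: 'a measure)"
      by (simp add: vimage_def)
    then have "emeasure (distr \<rho>' (borel \<Otimes>\<^sub>M borel) (\<lambda>x. (norm x, sgn x))) (A \<times> B) =
        emeasure \<rho> (D \<inter> (\<lambda>x. (norm x, sgn x)) -` (A \<times> B))"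
      using AB by (subst emeasure_distr) (auto simp: m' e)
    also have "D \<inter> (\<lambda>x. (norm x, sgn x)) -` (A \<times> B) = {x. x \<noteq> 0 \<and> norm x \<in> A \<and> sgn x \<in> B}"
      by (auto simp: D_def)
    finally have 2: "emeasure (distr \<rho>' (borel \<Otimes>\<^sub>M borel) (\<lambda>x. (norm x, sgn x))) (A \<times> B) =
      emeasure \<rho> {x. x \<noteq> 0 \<and> norm x \<in> A \<and> sgn x \<in> B}" .
    have "emeasure N A * emeasure U B =
      ennreal (1 / c) * (emeasure \<rho> {x. x \<noteq> 0 \<and> norm x \<in> A} * emeasure sphere_measure B)"
      using AB by (simp add: 1 Ue mult_ac)
    also have "\<dots> = ennreal (1 / c) * (emeasure \<rho> {x. x \<noteq> 0 \<and> norm x \<in> A \<and> sgn x \<in> B} * ennreal c)"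
      using isotropic_law_sgn[OF fin sets inv AB] by (simp add: emeasure_sphere_measure_UNIV c_def)
    also have "\<dots> = emeasure \<rho> {x. x \<noteq> 0 \<and> norm x \<in> A \<and> sgn x \<in> B} * ennreal (1 / c * c)"
      using c by (subst ennreal_mult'') (auto simp: mult_ac)
    also have "1 / c * c = 1" using c by simp
    finally show "emeasure N A * emeasure U B =
      emeasure (distr \<rho>' (borel \<Otimes>\<^sub>M borel) (\<lambda>x. (norm x, sgn x))) (A \<times> B)"
      by (simp add: 2)
  qed (simp_all add: N_def U_def N.sigma_finite_measure_axioms[unfolded N_def] U.sigma_finite_measure_axioms[unfolded U_def])
  have G: "(\<lambda>z. F (fst z *\<^sub>R snd z)) \<in> borel_measurable (borel \<Otimes>\<^sub>M borel)" by measurable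
  have K: "norm (F x) \<le> K" for x using bd by simp
  have "(LINT x|\<rho>. F x) = (LINT x|\<rho>. indicator D x *\<^sub>R F x)"
    by (intro Bochner_Integration.integral_cong) (auto simp: D_def F0 indicator_def)
  also have "\<dots> = (LINT x|\<rho>'. F x)"
    unfolding \<rho>'_def by (rule integral_density[symmetric]) measurable
  also have "\<dots> = (LINT x|\<rho>'. F (norm x *\<^sub>R sgn x))"
  proof -
    have "norm x *\<^sub>R sgn x = x" for x :: 'a by (cases "x = 0") (simp_all add: sgn_div_norm)
    then show ?thesis by simp
  qed
  also have "\<dots> = (LINT z|(distr \<rho>' (borel \<Otimes>\<^sub>M borel) (\<lambda>x. (norm x, sgn x))). F (fst z *\<^sub>R snd z))"
    using G by (subst integral_distr) (auto simp: m')
  also have "\<dots> = (LINT z|(N \<Otimes>\<^sub>M U). F (fst z *\<^sub>R snd z))" by (simp add: PM)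
  also have "\<dots> = (LINT x|N. LINT y|U. F (x *\<^sub>R y))"
  proof -
    interpret PF: finite_measure "N \<Otimes>\<^sub>M U" by (rule finite_measure_pair_measure) fact+
    have "integrable (N \<Otimes>\<^sub>M U) (\<lambda>z. F (fst z *\<^sub>R snd z))"
      by (rule PF.integrable_const_bound[of _ K]) (use K G in \<open>auto simp: PM\<close>)
    from P.integral_fst'[OF this] show ?thesis by simp
  qed
  also have "\<dots> = (LINT x|\<rho>'. LINT y|U. F (norm x *\<^sub>R y))"
    unfolding N_def
  proof (rule integral_distr)
    have "(\<lambda>z. F (fst z *\<^sub>R snd z)) \<in> borel_measurable (borel \<Otimes>\<^sub>M U)"
      using G by (simp add: U_def cong: measurable_cong_sets)
    then show "(\<lambda>x. LINT y|U. F (x *\<^sub>R y)) \<in> borel_measurable borel"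
      using U.borel_measurable_lebesgue_integral[of "\<lambda>x y. F (x *\<^sub>R y)" borel] by (simp add: split_beta')
  qed (simp add: m')
  also have "\<dots> = (LINT x|\<rho>. indicator D x *\<^sub>R (LINT y|U. F (norm x *\<^sub>R y)))"
    unfolding \<rho>'_def
  proof (rule integral_density)
    have "(\<lambda>z. F (norm (fst z) *\<^sub>R snd z)) \<in> borel_measurable (borel \<Otimes>\<^sub>M borel)" by measurable
    moreover have sq: "sets (\<rho> \<Otimes>\<^sub>M U) = sets (borel \<Otimes>\<^sub>M borel)"
      by (intro sets_pair_measure_cong) (simp_all add: sets U_def)
    ultimately have "(\<lambda>z. F (norm (fst z) *\<^sub>R snd z)) \<in> borel_measurable (\<rho> \<Otimes>\<^sub>M U)"
      using measurable_cong_sets[OF sq refl, of borel] by blast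
    then show "(\<lambda>x. LINT y|U. F (norm x *\<^sub>R y)) \<in> borel_measurable \<rho>"
      using U.borel_measurable_lebesgue_integral[of "\<lambda>x y. F (norm x *\<^sub>R y)" \<rho>] by (simp add: split_beta')
  qed auto
  also have "\<dots> = (LINT x|\<rho>. (LINT y|U. F (norm x *\<^sub>R y)))"
    by (intro Bochner_Integration.integral_cong) (auto simp: D_def F0 indicator_def)
  also have "\<dots> = (LINT x|\<rho>. (LINT \<theta>|sphere_measure. F (norm x *\<^sub>R \<theta>)) / c)"
    unfolding U_def using c by (subst integral_density) auto
  finally show ?thesis by (simp add: c_def)
qed


section \<open>Radial integrals\<close>

lemma nn_integral_powr_from_0:
  fixes q c :: real
  assumes "0 < q" "0 \<le> c"
  shows "(\<integral>\<^sup>+r. indicator {0<..<c} r * ennreal (r powr (q - 1)) \<partial>lborel) = ennreal (c powr q / q)"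
proof -
  have "(\<integral>\<^sup>+r. ennreal (r powr (q - 1)) * indicator {0..c} r \<partial>lborel) = ennreal (c powr (q - 1 + 1) / (q - 1 + 1))"
    by (rule nn_integral_has_integral_lebesgue'[OF _ has_integral_powr_from_0]) (use assms in auto)
  moreover have "(\<integral>\<^sup>+r. indicator {0<..<c} r * ennreal (r powr (q - 1)) \<partial>lborel) =
    (\<integral>\<^sup>+r. ennreal (r powr (q - 1)) * indicator {0..c} r \<partial>lborel)"
  proof (rule nn_integral_cong_AE)
    have "AE r in lborel. r \<noteq> (0::real)" "AE r in lborel. r \<noteq> (c::real)" by (rule AE_lborel_singleton)+
    then show "AE r in lborel. indicator {0<..<c} r * ennreal (r powr (q - 1)) = ennreal (r powr (q - 1)) * indicator {0..c} r"
      by eventually_elim (auto simp: indicator_def)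
  qed
  ultimately show ?thesis by simp
qed

lemma nn_integral_powr_to_inf:
  fixes b c :: real
  assumes "0 < b" "0 < c"
  shows "(\<integral>\<^sup>+v. indicator {c..} v * ennreal (v powr (- b - 1)) \<partial>lborel) = ennreal (c powr (- b) / b)"
proof -
  have "(\<integral>\<^sup>+v. ennreal (v powr (- b - 1)) * indicator {c..} v \<partial>lborel) =
      ennreal (- (c powr (- b - 1 + 1)) / (- b - 1 + 1))"
    by (rule nn_integral_has_integral_lebesgue'[OF _ has_integral_powr_to_inf]) (use assms in auto)
  then show ?thesis by (simp add: mult.commute)
qed

lemma nn_integral_exp_neg_Ici:
  "(\<integral>\<^sup>+u. ennreal (exp (- u)) * indicator {a..} u \<partial>lborel) = ennreal (exp (- a))"
proof -
  have "(\<integral>\<^sup>+u. ennreal (exp (- u)) * indicator {a..} u \<partial>lborel) = ennreal (0 - (- exp (- a)))"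
  proof (rule nn_integral_FTC_atLeast)
    show "((\<lambda>u::real. - exp (- u)) \<longlongrightarrow> 0) at_top"
      using tendsto_minus[OF filterlim_compose[OF exp_at_bot filterlim_uminus_at_bot_at_top]] by simp
  qed (auto intro!: derivative_eq_intros)
  then show ?thesis by simp
qed

lemma nn_integral_exp_neg_0:
  assumes "0 \<le> a"
  shows "(\<integral>\<^sup>+u. ennreal (exp (- u)) * indicator {0..a} u \<partial>lborel) = ennreal (1 - exp (- a))"
proof -
  have "(\<integral>\<^sup>+u. ennreal (exp (- u)) * indicator {0..a} u \<partial>lborel) = ennreal (- exp (- a) - (- exp (- 0)))"
    by (rule nn_integral_FTC_Icc) (auto intro!: derivative_eq_intros assms)
  then show ?thesis by simp
qed

lemma nn_integral_Gamma:
  fixes s :: real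
  assumes "0 < s"
  shows "(\<integral>\<^sup>+u. indicator {0<..} u * ennreal (exp (- u) * u powr (s - 1)) \<partial>lborel) = ennreal (Gamma s)"
proof -
  have "(\<integral>\<^sup>+u. indicator {0<..} u * ennreal (exp (- u) * u powr (s - 1)) \<partial>lborel) =
    (\<integral>\<^sup>+u. ennreal (u powr (s - 1) / exp u) * indicator {0..} u \<partial>lborel)"
    by (rule nn_integral_cong) (auto simp: indicator_def exp_minus field_simps)
  also have "\<dots> = ennreal (Gamma s)"
    by (rule nn_integral_has_integral_lebesgue'[OF _ Gamma_integral_real[OF assms]]) simp
  finally show ?thesis .
qed

text \<open>
  Writing \<open>1 - exp (- a)\<close> as the integral of \<open>exp (- u)\<close> over \<open>u\<close> in \<open>{0..a}\<close> and exchanging the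
  integrals leaves a pure power in \<open>v\<close> over a half-line and then a Gamma integral in \<open>u\<close>.
\<close>

lemma nn_integral_powr_one_minus_exp:
  fixes A b p :: real
  assumes A: "0 < A" and b: "0 < b" "b < p"
  shows "(\<integral>\<^sup>+v. indicator {0<..} v * ennreal (v powr (- b - 1) * (1 - exp (- (A * v powr p)))) \<partial>lborel)
    = ennreal (A powr (b / p) * Gamma (1 - b / p) / b)"
proof -
  have p: "0 < p" using b by simp
  have inner: "(\<integral>\<^sup>+v. indicator {0<..} v * ennreal (v powr (- b - 1)) * (ennreal (exp (- u)) * indicator {0..A * v powr p} u) \<partial>lborel)
     = ennreal (A powr (b / p) / b) * (indicator {0<..} u * ennreal (exp (- u) * u powr ((1 - b / p) - 1)))"
    if "u \<noteq> 0" for u :: real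
  proof (cases "u > 0")
    case True
    define c where "c = (u / A) powr (1 / p)"
    have c: "c > 0" using True A by (simp add: c_def)
    have le: "u \<le> A * v powr p \<longleftrightarrow> c \<le> v" if "v > 0" for v
    proof -
      have cp: "c powr p = u / A" using True A p by (simp add: c_def powr_powr)
      have "u \<le> A * v powr p \<longleftrightarrow> c powr p \<le> v powr p"
        unfolding cp using A by (simp add: field_simps)
      also have "\<dots> \<longleftrightarrow> c \<le> v"
        using p c that by (metis less_imp_le not_le powr_less_mono2 powr_mono2)
      finally show ?thesis .
    qed
    have "(\<integral>\<^sup>+v. indicator {0<..} v * ennreal (v powr (- b - 1)) * (ennreal (exp (- u)) * indicator {0..A * v powr p} u) \<partial>lborel)
      = (\<integral>\<^sup>+v. ennreal (exp (- u)) * (indicator {c..} v * ennreal (v powr (- b - 1))) \<partial>lborel)"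
      using True le c by (intro nn_integral_cong) (auto simp: indicator_def mult_ac)
    also have "\<dots> = ennreal (exp (- u)) * ennreal (c powr (- b) / b)"
      using b c by (subst nn_integral_cmult) (auto simp: nn_integral_powr_to_inf)
    also have "c powr (- b) = A powr (b / p) * u powr (- b / p)"
      using True A by (simp add: c_def powr_powr powr_divide powr_minus field_simps)
    finally show ?thesis
      using True A b by (simp add: ennreal_mult'[symmetric] mult_ac)
  next
    case False
    then show ?thesis using that by (simp add: indicator_def)
  qed
  have "(\<integral>\<^sup>+v. indicator {0<..} v * ennreal (v powr (- b - 1) * (1 - exp (- (A * v powr p)))) \<partial>lborel)
    = (\<integral>\<^sup>+v. (\<integral>\<^sup>+u. indicator {0<..} v * ennreal (v powr (- b - 1)) * (ennreal (exp (- u)) * indicator {0..A * v powr p} u) \<partial>lborel) \<partial>lborel)"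
    using A by (intro nn_integral_cong, subst nn_integral_cmult) (auto simp: nn_integral_exp_neg_0 ennreal_mult' mult.assoc)
  also have "\<dots> = (\<integral>\<^sup>+u. (\<integral>\<^sup>+v. indicator {0<..} v * ennreal (v powr (- b - 1)) * (ennreal (exp (- u)) * indicator {0..A * v powr p} u) \<partial>lborel) \<partial>lborel)"
  proof (rule lborel_pair.Fubini'[symmetric])
    show "(\<lambda>(v, u). indicator {0<..} v * ennreal (v powr (- b - 1)) * (ennreal (exp (- u)) * indicator {0..A * v powr p} u))
      \<in> borel_measurable (lborel \<Otimes>\<^sub>M lborel)"
      unfolding indicator_def by (simp add: split_beta') measurable
  qed
  also have "\<dots> = (\<integral>\<^sup>+u. ennreal (A powr (b / p) / b) * (indicator {0<..} u * ennreal (exp (- u) * u powr ((1 - b / p) - 1))) \<partial>lborel)"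
  proof (rule nn_integral_cong_AE)
    show "AE u in lborel. (\<integral>\<^sup>+v. indicator {0<..} v * ennreal (v powr (- b - 1)) * (ennreal (exp (- u)) * indicator {0..A * v powr p} u) \<partial>lborel)
     = ennreal (A powr (b / p) / b) * (indicator {0<..} u * ennreal (exp (- u) * u powr ((1 - b / p) - 1)))"
      using AE_lborel_singleton[of "0::real"] by eventually_elim (rule inner)
  qed
  also have "\<dots> = ennreal (A powr (b / p) / b) * ennreal (Gamma (1 - b / p))"
    using b p nn_integral_Gamma[of "1 - b / p"] by (subst nn_integral_cmult) simp_all
  finally show ?thesis using b by (simp add: ennreal_mult'[symmetric])
qed

text \<open>
  The same exchange of integrals, now with \<open>exp (- r\<^sup>2 / 2)\<close> as the integral of \<open>exp (- u)\<close> over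
  \<open>u \<ge> r\<^sup>2 / 2\<close>; it replaces the substitution \<open>u = r\<^sup>2 / 2\<close>.
\<close>

lemma nn_integral_powr_gaussian:
  fixes q :: real
  assumes q: "0 < q"
  shows "(\<integral>\<^sup>+r. indicator {0<..} r * ennreal (r powr (q - 1) * exp (- r\<^sup>2 / 2)) \<partial>lborel)
    = ennreal (2 powr (q / 2 - 1) * Gamma (q / 2))"
proof -
  have "(\<integral>\<^sup>+r. indicator {0<..} r * ennreal (r powr (q - 1) * exp (- r\<^sup>2 / 2)) \<partial>lborel)
    = (\<integral>\<^sup>+r. (\<integral>\<^sup>+u. indicator {0<..} r * ennreal (r powr (q - 1)) * (ennreal (exp (- u)) * indicator {r\<^sup>2 / 2..} u) \<partial>lborel) \<partial>lborel)"
    by (intro nn_integral_cong, subst nn_integral_cmult) (auto simp: nn_integral_exp_neg_Ici ennreal_mult' mult.assoc)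
  also have "\<dots> = (\<integral>\<^sup>+u. (\<integral>\<^sup>+r. indicator {0<..} r * ennreal (r powr (q - 1)) * (ennreal (exp (- u)) * indicator {r\<^sup>2 / 2..} u) \<partial>lborel) \<partial>lborel)"
  proof (rule lborel_pair.Fubini'[symmetric])
    show "(\<lambda>(r, u). indicator {0<..} r * ennreal (r powr (q - 1)) * (ennreal (exp (- u)) * indicator {r\<^sup>2 / 2..} u))
      \<in> borel_measurable (lborel \<Otimes>\<^sub>M lborel)"
      unfolding indicator_def by (simp add: split_beta') measurable
  qed
  also have "\<dots> = (\<integral>\<^sup>+u. ennreal (2 powr (q / 2) / q) * (indicator {0<..} u * ennreal (exp (- u) * u powr ((q / 2 + 1) - 1))) \<partial>lborel)"
  proof (rule nn_integral_cong)
    fix u :: real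
    have "(\<integral>\<^sup>+r. indicator {0<..} r * ennreal (r powr (q - 1)) * (ennreal (exp (- u)) * indicator {r\<^sup>2 / 2..} u) \<partial>lborel)
      = (\<integral>\<^sup>+r. ennreal (exp (- u)) * (indicator {0<..<sqrt (2 * u)} r * ennreal (r powr (q - 1))) \<partial>lborel)"
    proof (rule nn_integral_cong_AE)
      show "AE r in lborel. indicator {0<..} r * ennreal (r powr (q - 1)) * (ennreal (exp (- u)) * indicator {r\<^sup>2 / 2..} u)
         = ennreal (exp (- u)) * (indicator {0<..<sqrt (2 * u)} r * ennreal (r powr (q - 1)))"
        using AE_lborel_singleton[of "sqrt (2 * u)"]
      proof eventually_elim
        case (elim r)
        have "r\<^sup>2 / 2 \<le> u \<longleftrightarrow> r < sqrt (2 * u)" if "r > 0"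
        proof -
          have "sqrt (r\<^sup>2) = r" using that by simp
          then have "r \<le> sqrt (2 * u) \<longleftrightarrow> r\<^sup>2 \<le> 2 * u"
            using real_sqrt_le_iff[of "r\<^sup>2" "2 * u"] by simp
          then show ?thesis using elim by linarith
        qed
        then show ?case by (auto simp: indicator_def mult_ac)
      qed
    qed
    also have "\<dots> = ennreal (2 powr (q / 2) / q) * (indicator {0<..} u * ennreal (exp (- u) * u powr ((q / 2 + 1) - 1)))"
    proof (cases "u > 0")
      case True
      have sq: "sqrt (2 * u) powr q = 2 powr (q / 2) * u powr (q / 2)"
        using True by (simp add: powr_half_sqrt[symmetric] powr_powr powr_mult)
      have "0 \<le> sqrt (2 * u)" using True by simp
      have "(\<integral>\<^sup>+r. ennreal (exp (- u)) * (indicator {0<..<sqrt (2 * u)} r * ennreal (r powr (q - 1))) \<partial>lborel) =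
        ennreal (exp (- u)) * (\<integral>\<^sup>+r. indicator {0<..<sqrt (2 * u)} r * ennreal (r powr (q - 1)) \<partial>lborel)"
        by (rule nn_integral_cmult) measurable
      also have "\<dots> = ennreal (exp (- u)) * ennreal (sqrt (2 * u) powr q / q)"
        by (simp only: nn_integral_powr_from_0[OF q \<open>0 \<le> sqrt (2 * u)\<close>])
      also have "\<dots> = ennreal (2 powr (q / 2) / q) * (indicator {0<..} u * ennreal (exp (- u) * u powr ((q / 2 + 1) - 1)))"
        unfolding sq using True q by (simp add: ennreal_mult'[symmetric] mult_ac)
      finally show ?thesis .
    next
      case False
      then have "{0<..<sqrt (2 * u)} = {}" by (auto simp: not_less)
      then show ?thesis using False by simp
    qed
    finally show "(\<integral>\<^sup>+r. indicator {0<..} r * ennreal (r powr (q - 1)) * (ennreal (exp (- u)) * indicator {r\<^sup>2 / 2..} u) \<partial>lborel) = 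
      ennreal (2 powr (q / 2) / q) * (indicator {0<..} u * ennreal (exp (- u) * u powr ((q / 2 + 1) - 1)))" .
  qed
  also have "\<dots> = ennreal (2 powr (q / 2) / q) * ennreal (Gamma (q / 2 + 1))"
    using q nn_integral_Gamma[of "q / 2 + 1"] by (subst nn_integral_cmult) simp_all
  also have "\<dots> = ennreal (2 powr (q / 2 - 1) * Gamma (q / 2))"
  proof -
    have "q / 2 \<notin> \<int>\<^sub>\<le>\<^sub>0" using q nonpos_Ints_nonpos[of "q / 2"] by force
    then have "Gamma (q / 2 + 1) = q / 2 * Gamma (q / 2)" by (rule Gamma_plus1)
    then show ?thesis unfolding \<open>Gamma (q / 2 + 1) = q / 2 * Gamma (q / 2)\<close>
      using q by (simp add: ennreal_mult'[symmetric] powr_diff)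
  qed
  finally show ?thesis .
qed

text \<open>
  Polar coordinates for radial functions: both measures give \<open>{..a}\<close> the volume of the ball of
  radius \<open>a\<close>.
\<close>

lemma distr_lborel_norm:
  "distr lborel borel (norm :: 'a::euclidean_space \<Rightarrow> real) =
    density lborel (\<lambda>r. indicator {0<..} r * ennreal (DIM('a) * unit_ball_vol DIM('a) * r powr (real DIM('a) - 1)))"
  (is "?D = ?E")
proof (rule measure_eqI_generator_eq[where \<Omega>=UNIV and E="range atMost" and A="\<lambda>n. {..real n}"])
  let ?V = "unit_ball_vol DIM('a)"
  have D: "emeasure ?D {..a} = (if a \<ge> 0 then ennreal (?V * a ^ DIM('a)) else 0)" for a :: real
  proof -
    have "emeasure ?D {..a} = emeasure lborel (norm -` {..a} :: 'a set)"
      by (subst emeasure_distr) auto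
    also have "norm -` {..a} = (if a \<ge> 0 then cball (0::'a) a else {})"
      by (auto simp: dist_norm) (smt (verit) norm_ge_zero)
    finally show ?thesis by (simp add: emeasure_cball)
  qed
  show eq: "emeasure ?D X = emeasure ?E X" if "X \<in> range atMost" for X
  proof -
    obtain a where X: "X = {..a}" using \<open>X \<in> range atMost\<close> by auto
    have "emeasure ?E {..a} = (\<integral>\<^sup>+r. indicator {0<..} r * ennreal (DIM('a) * ?V * r powr (real DIM('a) - 1)) * indicator {..a} r \<partial>lborel)"
      by (rule emeasure_density) auto
    also have "\<dots> = (\<integral>\<^sup>+r. ennreal (DIM('a) * ?V) * (indicator {0<..<max 0 a} r * ennreal (r powr (real DIM('a) - 1))) \<partial>lborel)"
    proof (rule nn_integral_cong_AE)
      show "AE r in lborel. indicator {0<..} r * ennreal (DIM('a) * ?V * r powr (real DIM('a) - 1)) * indicator {..a} r =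
        ennreal (DIM('a) * ?V) * (indicator {0<..<max 0 a} r * ennreal (r powr (real DIM('a) - 1)))"
        using AE_lborel_singleton[of a]
        by eventually_elim (auto simp: indicator_def ennreal_mult')
    qed
    also have "\<dots> = ennreal (DIM('a) * ?V) * ennreal (max 0 a powr DIM('a) / DIM('a))"
      by (subst nn_integral_cmult) (auto simp: nn_integral_powr_from_0)
    also have "\<dots> = ennreal (?V * max 0 a powr DIM('a))"
      by (subst ennreal_mult'[symmetric]) auto
    also have "\<dots> = emeasure ?D {..a}"
      by (auto simp: D max_def powr_realpow')
    finally show ?thesis by (simp add: X)
  qed
  show "sets ?D = sigma_sets UNIV (range atMost)" "sets ?E = sigma_sets UNIV (range atMost)"
    by (simp_all add: borel_eq_atMost)
  show "Int_stable (range (atMost :: real \<Rightarrow> _))" by (auto simp: Int_stable_def)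
  show "(\<Union>n. {..real n}) = UNIV" by (auto simp: real_arch_simple)
  show "emeasure ?D {..real n} \<noteq> \<infinity>" for n by (simp add: D)
qed auto

section \<open>The standard Gaussian law\<close>

definition std_gaussian :: "'a::euclidean_space measure" where
  "std_gaussian = density lborel (\<lambda>x. ennreal (\<Prod>b\<in>Basis. std_normal_density (x \<bullet> b)))"

lemma space_std_gaussian [simp]: "space std_gaussian = UNIV"
  and sets_std_gaussian [simp, measurable_cong]: "sets std_gaussian = sets borel"
  by (simp_all add: std_gaussian_def)

lemma prob_space_std_gaussian: "prob_space std_gaussian"
proof (rule prob_spaceI)
  have "emeasure std_gaussian (UNIV :: 'a set) = (\<integral>\<^sup>+x. ennreal (\<Prod>b\<in>Basis. std_normal_density (x \<bullet> b)) \<partial>(lborel :: 'a measure))"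
    unfolding std_gaussian_def by (subst emeasure_density) auto
  also have "\<dots> = (\<integral>\<^sup>+x. (\<Prod>b\<in>Basis. ennreal (std_normal_density (x \<bullet> b))) \<partial>(lborel :: 'a measure))"
    by (simp add: prod_ennreal)
  also have "\<dots> = (\<Prod>b\<in>(Basis :: 'a set). \<integral>\<^sup>+y. ennreal (std_normal_density y) \<partial>lborel)"
    by (rule nn_integral_lborel_prod) auto
  also have "(\<integral>\<^sup>+y. ennreal (std_normal_density y) \<partial>lborel) = 1"
    using prob_space.emeasure_space_1[OF prob_space_normal_density[of 1 0]]
    by (simp add: emeasure_density)
  finally show "emeasure std_gaussian (space (std_gaussian :: 'a measure)) = 1" by simp
qed

lemma neg_half_norm_square_eq_sum:
  fixes x :: "'a::euclidean_space"
  shows "- (norm x)\<^sup>2 / 2 = (\<Sum>b\<in>Basis. - (x \<bullet> b)\<^sup>2 / 2)"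
proof -
  have "(norm x)\<^sup>2 = (\<Sum>b\<in>Basis. (x \<bullet> b)\<^sup>2)"
    unfolding power2_norm_eq_inner by (subst euclidean_inner) (simp add: power2_eq_square)
  then show ?thesis by (simp add: sum_negf sum_divide_distrib)
qed

lemma std_gaussian_density:
  "(\<Prod>b\<in>Basis. std_normal_density ((x::'a::euclidean_space) \<bullet> b)) =
    (2 * pi) powr (- real DIM('a) / 2) * exp (- (norm x)\<^sup>2 / 2)"
proof -
  have "(\<Prod>b\<in>Basis. std_normal_density (x \<bullet> b)) =
      (1 / sqrt (2 * pi)) ^ DIM('a) * (\<Prod>b\<in>Basis. exp (- (x \<bullet> b)\<^sup>2 / 2))"
    by (simp add: std_normal_density_def prod_dividef power_one_over)
  also have "(\<Prod>b\<in>Basis. exp (- (x \<bullet> b)\<^sup>2 / 2)) = exp (- (norm x)\<^sup>2 / 2)"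
    by (simp only: exp_sum[OF finite_Basis] neg_half_norm_square_eq_sum[of x])
  also have "(1 / sqrt (2 * pi)) ^ DIM('a) = (2 * pi) powr (- real DIM('a) / 2)"
  proof -
    have "1 / sqrt (2 * pi) = (2 * pi) powr (- (1 / 2))"
      by (simp add: powr_minus_divide powr_half_sqrt)
    then show ?thesis by (simp add: powr_power)
  qed
  finally show ?thesis .
qed

text \<open>
  The density is a product over the coordinates, so the characteristic function is the product
  of the one-dimensional ones.
\<close>

lemma std_gaussian_iexp:
  fixes \<xi> :: "'a::euclidean_space"
  shows "(LINT x|std_gaussian. iexp (\<xi> \<bullet> x)) = complex_of_real (exp (- (norm \<xi>)\<^sup>2 / 2))"
proof -
  interpret B: product_sigma_finite "\<lambda>_::'a. lborel :: real measure" ..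
  let ?f = "\<lambda>b y. std_normal_density y *\<^sub>R iexp ((\<xi> \<bullet> b) * y)"
  have int: "integrable lborel (?f b)" for b
  proof -
    have "integrable std_normal_distribution (\<lambda>y. iexp ((\<xi> \<bullet> b) * y))"
      by (rule finite_measure.integrable_const_bound[where B=1])
        (auto intro!: prob_space.finite_measure prob_space_normal_density)
    then show ?thesis by (subst (asm) integrable_density) auto
  qed
  have val: "(LINT y|lborel. ?f b y) = complex_of_real (exp (- (\<xi> \<bullet> b)\<^sup>2 / 2))" for b
    using fun_cong[OF char_std_normal_distribution, of "\<xi> \<bullet> b"]
    unfolding char_def by (subst (asm) integral_density) auto
  have "(LINT x|std_gaussian. iexp (\<xi> \<bullet> x)) = (LINT x|lborel. (\<Prod>b\<in>Basis. std_normal_density (x \<bullet> b)) *\<^sub>R iexp (\<xi> \<bullet> x))"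
    unfolding std_gaussian_def by (rule integral_density) (auto intro!: prod_nonneg)
  also have "\<dots> = (LINT x|lborel. (\<Prod>b\<in>Basis. ?f b (x \<bullet> b)))"
  proof (rule Bochner_Integration.integral_cong)
    fix x :: 'a
    have "iexp (\<xi> \<bullet> x) = (\<Prod>b\<in>Basis. iexp ((\<xi> \<bullet> b) * (x \<bullet> b)))"
      by (simp add: exp_sum[symmetric] euclidean_inner[of \<xi> x] sum_distrib_left)
    then show "(\<Prod>b\<in>Basis. std_normal_density (x \<bullet> b)) *\<^sub>R iexp (\<xi> \<bullet> x) = (\<Prod>b\<in>Basis. ?f b (x \<bullet> b))"
      by (simp add: scaleR_conv_of_real prod.distrib)
  qed simp
  also have "\<dots> = (LINT y|(\<Pi>\<^sub>M b\<in>Basis. lborel). (\<Prod>b\<in>Basis. ?f b (y b)))"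
    by (subst lborel_eq, subst integral_distr) (auto intro!: Bochner_Integration.integral_cong prod.cong)
  also have "\<dots> = (\<Prod>b\<in>Basis. LINT y|lborel. ?f b y)"
    by (rule B.product_integral_prod) (use int in auto)
  also have "\<dots> = complex_of_real (exp (- (norm \<xi>)\<^sup>2 / 2))"
    by (simp only: val of_real_prod[symmetric] exp_sum[OF finite_Basis] neg_half_norm_square_eq_sum[of \<xi>])
  finally show ?thesis .
qed

lemma sphere_area_eq:
  "real DIM('a::euclidean_space) * unit_ball_vol (real DIM('a)) =
    2 * pi powr (real DIM('a) / 2) / Gamma (real DIM('a) / 2)"
proof -
  have "real DIM('a) / 2 \<notin> \<int>\<^sub>\<le>\<^sub>0" using nonpos_Ints_nonpos[of "real DIM('a) / 2"] by force
  then have "Gamma (real DIM('a) / 2 + 1) = real DIM('a) / 2 * Gamma (real DIM('a) / 2)" by (rule Gamma_plus1)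
  then show ?thesis unfolding unit_ball_vol_def \<open>Gamma (real DIM('a) / 2 + 1) = real DIM('a) / 2 * Gamma (real DIM('a) / 2)\<close> by simp
qed

text \<open>
  Polar coordinates reduce the moment to a one-dimensional Gaussian integral.
\<close>

lemma std_gaussian_norm_powr:
  fixes p :: real
  assumes "0 \<le> p"
  shows "(\<integral>\<^sup>+x. ennreal (norm x powr p) \<partial>(std_gaussian :: 'a::euclidean_space measure)) =
    ennreal (2 powr (p / 2) * Gamma ((real DIM('a) + p) / 2) / Gamma (real DIM('a) / 2))"
proof -
  let ?d = "real DIM('a)" and ?V = "unit_ball_vol DIM('a)"
  let ?c = "(2 * pi) powr (- ?d / 2)"
  have q: "?d + p > 0" using assms by (simp add: add_pos_nonneg)
  have "(\<integral>\<^sup>+x. ennreal (norm x powr p) \<partial>(std_gaussian :: 'a measure)) =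
    (\<integral>\<^sup>+x. ennreal (?c * exp (- (norm x)\<^sup>2 / 2)) * ennreal (norm x powr p) \<partial>(lborel :: 'a measure))"
    unfolding std_gaussian_def std_gaussian_density by (rule nn_integral_density) auto
  also have "\<dots> = (\<integral>\<^sup>+r. ennreal (?c * exp (- r\<^sup>2 / 2)) * ennreal (r powr p) \<partial>distr lborel borel (norm :: 'a \<Rightarrow> real))"
    by (subst nn_integral_distr) auto
  also have "\<dots> = (\<integral>\<^sup>+r. indicator {0<..} r * ennreal (?d * ?V * r powr (?d - 1)) * (ennreal (?c * exp (- r\<^sup>2 / 2)) * ennreal (r powr p)) \<partial>lborel)"
    unfolding distr_lborel_norm by (subst nn_integral_density) auto
  also have "\<dots> = (\<integral>\<^sup>+r. ennreal (?c * ?d * ?V) * (indicator {0<..} r * ennreal (r powr ((?d + p) - 1) * exp (- r\<^sup>2 / 2))) \<partial>lborel)"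
    by (intro nn_integral_cong)
      (auto simp: indicator_def ennreal_mult'[symmetric] mult_ac powr_add[symmetric] algebra_simps)
  also have "\<dots> = ennreal (?c * ?d * ?V) * ennreal (2 powr ((?d + p) / 2 - 1) * Gamma ((?d + p) / 2))"
    using nn_integral_powr_gaussian[OF q] by (subst nn_integral_cmult) simp_all
  also have "\<dots> = ennreal (?c * (?d * ?V) * (2 powr ((?d + p) / 2 - 1) * Gamma ((?d + p) / 2)))"
    by (simp add: ennreal_mult' mult.assoc)
  also have "?d * ?V = 2 * pi powr (?d / 2) / Gamma (?d / 2)" by (rule sphere_area_eq)
  also have "?c * (2 * pi powr (?d / 2) / Gamma (?d / 2)) * (2 powr ((?d + p) / 2 - 1) * Gamma ((?d + p) / 2)) =
     2 powr (p / 2) * Gamma ((?d + p) / 2) / Gamma (?d / 2)"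
  proof -
    have "?c * pi powr (?d / 2) = 2 powr (- ?d / 2)"
      by (simp add: powr_mult powr_add[symmetric])
    moreover have "2 * 2 powr ((?d + p) / 2 - 1) * 2 powr (- ?d / 2) = 2 powr (p / 2)"
      by (simp add: powr_diff add_divide_distrib powr_add[symmetric])
    moreover have "?c * (2 * pi powr (?d / 2) / Gamma (?d / 2)) * (2 powr ((?d + p) / 2 - 1) * Gamma ((?d + p) / 2)) =
        (2 * 2 powr ((?d + p) / 2 - 1) * (?c * pi powr (?d / 2))) * Gamma ((?d + p) / 2) / Gamma (?d / 2)"
      by (simp only: mult_ac times_divide_eq_right)
    ultimately show ?thesis by simp
  qed
  finally show ?thesis .
qed


section \<open>Regular variation\<close>

lemma Sup_image_Icc:
  fixes f :: "real \<Rightarrow> real"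
  assumes cont: "continuous_on {0..} f" and x: "0 \<le> x"
  shows Sup_image_Icc_upper: "\<And>r. 0 \<le> r \<Longrightarrow> r \<le> x \<Longrightarrow> f r \<le> Sup (f ` {0..x})"
    and Sup_image_Icc_attained: "\<exists>r. 0 \<le> r \<and> r \<le> x \<and> Sup (f ` {0..x}) = f r"
proof -
  have c: "continuous_on {0..x} f" using cont by (rule continuous_on_subset) auto
  obtain m where m: "m \<in> {0..x}" "\<And>r. r \<in> {0..x} \<Longrightarrow> f r \<le> f m"
    using continuous_attains_sup[OF compact_Icc _ c] x by auto
  have "Sup (f ` {0..x}) = f m"
    using m by (intro cSup_eq_maximum) auto
  then show "\<And>r. 0 \<le> r \<Longrightarrow> r \<le> x \<Longrightarrow> f r \<le> Sup (f ` {0..x})"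
    and "\<exists>r. 0 \<le> r \<and> r \<le> x \<and> Sup (f ` {0..x}) = f r"
    using m by auto
qed

lemma Sup_image_Icc_mono:
  fixes f :: "real \<Rightarrow> real"
  assumes cont: "continuous_on {0..} f" and x: "0 \<le> x" "x \<le> y"
  shows "Sup (f ` {0..x}) \<le> Sup (f ` {0..y})"
  using Sup_image_Icc_attained[OF cont x(1)] Sup_image_Icc_upper[OF cont, of y] x
  by force

text \<open>
  By continuity the generalized inverse of the running supremum is the first point where \<open>f\<close>
  itself reaches the level \<open>w\<close>. Therefore \<open>f\<close> and its running supremum both equal \<open>w\<close> exactly at
  that point.
\<close>

lemma generalized_inverse_of_Sup:
  fixes f :: "real \<Rightarrow> real"
  assumes cont: "continuous_on {0..} f" and f0: "f 0 = 0" and w: "0 < w"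
    and unbounded: "\<exists>r\<ge>0. w \<le> f r"
  defines "\<phi> \<equiv> Inf {x. 0 \<le> x \<and> w \<le> Sup (f ` {0..x})}"
  shows "0 < \<phi>" "f \<phi> = w" "Sup (f ` {0..\<phi>}) = w"
proof -
  define S where "S = {r. 0 \<le> r \<and> w \<le> f r}"
  have "S = {0..} \<inter> f -` {w..}" by (auto simp: S_def)
  also have "closed \<dots>" using cont by (rule continuous_closed_preimage) auto
  finally have clS: "closed S" .
  have bS: "bdd_below S" by (rule bdd_belowI[of _ 0]) (auto simp: S_def)
  define p where "p = Inf S"
  have "p \<in> S"
    unfolding p_def using unbounded clS bS by (intro closed_contains_Inf) (auto simp: S_def)
  then have p: "0 \<le> p" "w \<le> f p" by (auto simp: S_def)
  have least: "p \<le> r" if "0 \<le> r" "w \<le> f r" for r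
    unfolding p_def by (rule cInf_lower[OF _ bS]) (use that in \<open>simp add: S_def\<close>)
  have "{x. 0 \<le> x \<and> w \<le> Sup (f ` {0..x})} = {p..}"
  proof (intro set_eqI iffI)
    fix x assume x: "x \<in> {x. 0 \<le> x \<and> w \<le> Sup (f ` {0..x})}"
    then obtain r where "0 \<le> r" "r \<le> x" "w \<le> f r"
      using Sup_image_Icc_attained[OF cont, of x] by auto
    with least show "x \<in> {p..}" by force
  next
    fix x assume "x \<in> {p..}"
    then show "x \<in> {x. 0 \<le> x \<and> w \<le> Sup (f ` {0..x})}"
      using p Sup_image_Icc_upper[OF cont, of x p] by force
  qed
  then have \<phi>: "\<phi> = p" by (simp add: \<phi>_def)
  have "continuous_on {0..p} f" using cont by (rule continuous_on_subset) auto
  with p f0 w obtain r where r: "0 \<le> r" "r \<le> p" "f r = w"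
    using IVT'[of f 0 w p] by auto
  with least[of r] have "r = p" by simp
  with r show fp: "f \<phi> = w" by (simp add: \<phi>)
  show "0 < \<phi>" using fp f0 w p by (cases "p = 0") (auto simp: \<phi>)
  have "f r \<le> w" if "0 \<le> r" "r \<le> p" for r
    using least[of r] that fp by (cases "r = p"; cases "w \<le> f r") (auto simp: \<phi>)
  then show "Sup (f ` {0..\<phi>}) = w"
    using fp p by (intro cSup_eq_maximum) (auto simp: \<phi>)
qed

text \<open>
  A Potter-type bound that compares \<open>f\<close> with its running supremum \<open>P\<close>. Regular variation enters
  only through the factor 2: it gives \<open>2 powr \<gamma> * f s \<le> f (2 * s)\<close> for large \<open>s\<close>, which makes \<open>f\<close>
  unbounded and passes to \<open>P\<close> for large arguments. As \<open>P\<close> is monotone, iterating along powers of 2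
  bounds \<open>P r\<close> by a multiple of \<open>(r / s) powr \<gamma> * P s\<close>. The summand \<open>s powr - \<gamma>\<close> in the final bound
  covers the arguments \<open>s * u\<close> that are too small for the iteration.
\<close>

lemma regularly_varying_bounds:
  fixes f :: "real \<Rightarrow> real"
  assumes cont: "continuous_on {0..} f" and nonneg: "\<And>r. 0 \<le> r \<Longrightarrow> 0 \<le> f r"
    and rv: "regularly_varying_at_infinity f \<alpha>" and \<gamma>: "0 < \<gamma>" "\<gamma> < \<alpha>"
  shows regularly_varying_unbounded: "\<exists>r\<ge>0. w \<le> f r"
    and regularly_varying_potter_bound: "\<exists>s1 C. 0 < s1 \<and> 1 \<le> C \<and> (\<forall>s\<ge>s1. \<forall>u. 0 \<le> u \<longrightarrow> u \<le> 1 \<longrightarrow>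
        f (s * u) \<le> C * (u powr \<gamma> + s powr - \<gamma>) * Sup (f ` {0..s}))"
proof -
  define P where "P s = Sup (f ` {0..s})" for s
  have up: "f r \<le> P s" if "0 \<le> r" "r \<le> s" for r s
    unfolding P_def using Sup_image_Icc_upper[OF cont, of s r] that by simp
  have att: "\<exists>r. 0 \<le> r \<and> r \<le> s \<and> P s = f r" if "0 \<le> s" for s
    unfolding P_def using Sup_image_Icc_attained[OF cont that] .
  have mono: "P r \<le> P s" if "0 \<le> r" "r \<le> s" for r s
    unfolding P_def using Sup_image_Icc_mono[OF cont that] .
  define \<kappa> :: real where "\<kappa> = 2 powr \<gamma>"
  have \<kappa>: "1 < \<kappa>" unfolding \<kappa>_def using \<gamma> by simp
  have "((\<lambda>s. f (2 * s) / f s) \<longlongrightarrow> 2 powr \<alpha>) at_top"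
    using rv unfolding regularly_varying_at_infinity_def by simp
  moreover have "\<kappa> < 2 powr \<alpha>" using \<gamma> by (simp add: \<kappa>_def)
  ultimately have "eventually (\<lambda>s. \<kappa> < f (2 * s) / f s) at_top" by (rule order_tendstoD)
  then obtain s' where s': "\<And>s. s \<ge> s' \<Longrightarrow> \<kappa> < f (2 * s) / f s"
    by (auto simp: eventually_at_top_linorder)
  define s0 where "s0 = max 1 s'"
  have s0: "1 \<le> s0" by (simp add: s0_def)
  have pos: "0 < f s" and dbl: "\<kappa> * f s \<le> f (2 * s)" if "s0 \<le> s" for s
  proof -
    have *: "\<kappa> < f (2 * s) / f s" using s' that by (simp add: s0_def)
    have "f s \<noteq> 0" using * \<kappa> by auto
    then show "0 < f s" using nonneg[of s] that s0 by simp
    with * show "\<kappa> * f s \<le> f (2 * s)" by (simp add: field_simps)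
  qed
  have grow: "\<kappa> ^ k * f s0 \<le> f (2 ^ k * s0)" for k
  proof (induction k)
    case (Suc k)
    have "s0 \<le> 2 ^ k * s0" using s0 mult_right_mono[of 1 "2 ^ k" s0] by simp
    note dbl[OF this]
    moreover have "\<kappa> * (\<kappa> ^ k * f s0) \<le> \<kappa> * f (2 ^ k * s0)"
      using Suc \<kappa> by (intro mult_left_mono) auto
    ultimately show ?case by (simp add: mult.assoc)
  qed simp
  show unb: "\<exists>r\<ge>0. w \<le> f r" for w
  proof -
    obtain k where "w / f s0 < \<kappa> ^ k" using real_arch_pow[OF \<kappa>] by blast
    then have "w \<le> f (2 ^ k * s0)"
      using grow[of k] pos[of s0] by (simp add: field_simps)
    then show ?thesis using s0 by (intro exI[of _ "2 ^ k * s0"]) auto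
  qed
  obtain r0 where r0: "0 \<le> r0" "\<kappa> * P s0 \<le> f r0" using unb by blast
  \<comment> \<open>Beyond \<open>s1\<close> the supremum on \<open>{0..2 * s}\<close> already exceeds \<open>\<kappa> * P s0\<close>, so maximizers below \<open>s0\<close> do no harm.\<close>
  define s1 where "s1 = max s0 r0"
  have s1: "s0 \<le> s1" "1 \<le> s1" using s0 by (auto simp: s1_def)
  have Pdbl: "\<kappa> * P s \<le> P (2 * s)" if s: "s1 \<le> s" for s
  proof -
    obtain r where r: "0 \<le> r" "r \<le> s" "P s = f r" using att[of s] s s1 by auto
    show ?thesis
    proof (cases "s0 \<le> r")
      case True
      then show ?thesis using dbl[OF True] up[of "2 * r" "2 * s"] r by simp
    next
      case False
      then have "f r \<le> P s0" using r by (intro up) auto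
      then have "\<kappa> * f r \<le> \<kappa> * P s0" using \<kappa> by (intro mult_left_mono) auto
      also note r0(2)
      also have "f r0 \<le> P (2 * s)" using r0(1) s s1(2) by (intro up) (auto simp: s1_def)
      finally show ?thesis by (simp add: r)
    qed
  qed
  have Ppow: "\<kappa> ^ k * P s \<le> P (2 ^ k * s)" if s: "s1 \<le> s" for k s
  proof (induction k)
    case (Suc k)
    have "1 * s \<le> 2 ^ k * s" using s s1 by (intro mult_right_mono) auto
    with s have "s1 \<le> 2 ^ k * s" by simp
    note Pdbl[OF this]
    moreover have "\<kappa> * (\<kappa> ^ k * P s) \<le> \<kappa> * P (2 ^ k * s)"
      using Suc \<kappa> by (intro mult_left_mono) auto
    ultimately show ?case by (simp add: mult.assoc)
  qed simp
  have Ppos: "0 \<le> P s" if "0 \<le> s" for s using up[of 0 s] nonneg[of 0] that by simp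
  have potter: "P r \<le> (2 * r / s) powr \<gamma> * P s" if r: "s1 \<le> r" "r \<le> s" for r s
  proof -
    have rp: "r > 0" "s > 0" "s / r \<ge> 1" using r s1 by auto
    \<comment> \<open>The number of doublings that lead from r to a point just below s.\<close>
    define k where "k = nat \<lfloor>log 2 (s / r)\<rfloor>"
    have l: "0 \<le> log 2 (s / r)" using rp by simp
    have k: "real k \<le> log 2 (s / r)" "log 2 (s / r) < real k + 1"
      using l by (auto simp: k_def)
    have "2 ^ k = 2 powr real k" by (simp add: powr_realpow)
    also have "\<dots> \<le> 2 powr log 2 (s / r)" using k by simp
    finally have k1: "2 ^ k * r \<le> s" using rp by (simp add: field_simps)
    have "s / r = 2 powr log 2 (s / r)" using rp by simp
    also have "\<dots> \<le> 2 powr (real k + 1)" using k by simp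
    also have "\<dots> = 2 ^ k * 2" by (simp add: powr_add powr_realpow)
    finally have k2: "1 \<le> 2 ^ k * (2 * r / s)" using rp by (simp add: field_simps)
    have "1 \<le> (2 ^ k * (2 * r / s)) powr \<gamma>" using k2 \<gamma> by (simp add: ge_one_powr_ge_zero)
    also have "\<dots> = \<kappa> ^ k * (2 * r / s) powr \<gamma>"
    proof -
      have "(2 ^ k) powr \<gamma> = \<kappa> ^ k"
        by (simp add: \<kappa>_def powr_power powr_powr powr_realpow[symmetric] mult.commute)
      then show ?thesis using rp by (simp only: powr_mult)
    qed
    finally have "1 * P r \<le> (\<kappa> ^ k * (2 * r / s) powr \<gamma>) * P r"
      using Ppos[of r] rp by (intro mult_right_mono) auto
    also have "\<dots> = (2 * r / s) powr \<gamma> * (\<kappa> ^ k * P r)" by simp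
    also have "\<dots> \<le> (2 * r / s) powr \<gamma> * P s"
      using Ppow[OF r(1), of k] mono[OF _ k1] rp by (intro mult_left_mono) auto
    finally show ?thesis by simp
  qed
  show "\<exists>s1 C. 0 < s1 \<and> 1 \<le> C \<and> (\<forall>s\<ge>s1. \<forall>u. 0 \<le> u \<longrightarrow> u \<le> 1 \<longrightarrow>
        f (s * u) \<le> C * (u powr \<gamma> + s powr - \<gamma>) * Sup (f ` {0..s}))"
  proof (rule exI[of _ s1], rule exI[of _ "(2 * s1) powr \<gamma>"], intro conjI allI impI)
    show "0 < s1" using s1 by simp
    show "1 \<le> (2 * s1) powr \<gamma>" using s1 \<gamma> by (simp add: ge_one_powr_ge_zero)
    fix s u :: real assume s: "s1 \<le> s" and u: "0 \<le> u" "u \<le> 1"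
    have P0: "0 \<le> P s" using Ppos s s1 by simp
    have su: "0 \<le> s * u" "s * u \<le> s" using s s1 u by (auto simp: mult_left_le)
    have "f (s * u) \<le> (2 * s1) powr \<gamma> * (u powr \<gamma> + s powr - \<gamma>) * P s"
    proof (cases "s1 \<le> s * u")
      case True
      have "f (s * u) \<le> P (s * u)" using su by (intro up) auto
      also have "\<dots> \<le> (2 * (s * u) / s) powr \<gamma> * P s" using potter[OF True su(2)] .
      also have "2 * (s * u) / s = 2 * u" using s s1 by simp
      also have "(2 * u) powr \<gamma> \<le> (2 * s1 * u) powr \<gamma>"
        using s1 u \<gamma> by (intro powr_mono2) (auto simp: mult_right_mono)
      also have "\<dots> = (2 * s1) powr \<gamma> * u powr \<gamma>" using s1 u by (simp add: powr_mult)
      also have "\<dots> \<le> (2 * s1) powr \<gamma> * (u powr \<gamma> + s powr - \<gamma>)" by (intro mult_left_mono) auto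
      finally show ?thesis using P0 by (simp add: mult_right_mono)
    next
      case False
      have "f (s * u) \<le> P s1" using su False by (intro up) auto
      also have "\<dots> \<le> (2 * s1 / s) powr \<gamma> * P s" using potter[OF order_refl s] .
      also have "(2 * s1 / s) powr \<gamma> = (2 * s1) powr \<gamma> * s powr - \<gamma>"
        using s s1 by (simp add: powr_divide powr_minus_divide)
      also have "\<dots> \<le> (2 * s1) powr \<gamma> * (u powr \<gamma> + s powr - \<gamma>)" by (intro mult_left_mono) auto
      finally show ?thesis using P0 by (simp add: mult_right_mono)
    qed
    then show "f (s * u) \<le> (2 * s1) powr \<gamma> * (u powr \<gamma> + s powr - \<gamma>) * Sup (f ` {0..s})"
      by (simp add: P_def)
  qed
qed


section \<open>Truncated Laplace kernels\<close>

text \<open>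
  Without the truncation at \<open>c\<close> the integral is a constant multiple of \<open>w powr (2 * b)\<close>. The truncated
  version is bounded in \<open>w\<close>, so it has finite expectation even for laws without a moment of order
  \<open>2 * b\<close>, and that expectation is computable because the kernel is a mixture of Gaussians.
\<close>

definition trunc_power :: "real \<Rightarrow> real \<Rightarrow> real \<Rightarrow> ennreal" where
  "trunc_power b c w =
    (\<integral>\<^sup>+v. indicator {c<..} v * ennreal (v powr (- b - 1) * (1 - exp (- (v * w\<^sup>2)))) \<partial>lborel)"

text \<open>
  The upper bounds come from enlarging the domain to the positive half-line and from bounding the
  factor \<open>1 - exp (- (v * w\<^sup>2))\<close> by 1; the lower bound comes from bounding this factor by \<open>v * w\<^sup>2\<close>
  on the missing part of the domain.
\<close>

lemma trunc_power_bounds: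
  fixes b c w :: real
  assumes b: "0 < b" "b < 1" and c: "0 < c" and w: "0 \<le> w"
  defines "k \<equiv> Gamma (1 - b) / b"
  shows trunc_power_finite: "trunc_power b c w < \<top>"
    and trunc_power_le_const: "enn2real (trunc_power b c w) \<le> c powr (- b) / b"
    and trunc_power_le: "enn2real (trunc_power b c w) \<le> k * w powr (2 * b)"
    and trunc_power_ge: "k * w powr (2 * b) - w\<^sup>2 * c powr (1 - b) / (1 - b) \<le> enn2real (trunc_power b c w)"
proof -
  let ?h = "\<lambda>v. ennreal (v powr (- b - 1) * (1 - exp (- (v * w\<^sup>2))))"
  have k: "k > 0" using b by (simp add: k_def)
  have full: "(\<integral>\<^sup>+v. indicator {0<..} v * ?h v \<partial>lborel) = ennreal (k * w powr (2 * b))"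
  proof (cases "w = 0")
    case False
    with w have w: "w > 0" by simp
    have "(\<integral>\<^sup>+v. indicator {0<..} v * ?h v \<partial>lborel) =
      (\<integral>\<^sup>+v. indicator {0<..} v * ennreal (v powr (- b - 1) * (1 - exp (- (w\<^sup>2 * v powr 1)))) \<partial>lborel)"
      by (intro nn_integral_cong) (auto simp: indicator_def mult.commute)
    also have "\<dots> = ennreal ((w\<^sup>2) powr (b / 1) * Gamma (1 - b / 1) / b)"
      by (rule nn_integral_powr_one_minus_exp) (use b w in auto)
    also have "(w\<^sup>2) powr (b / 1) = w powr (2 * b)"
      using w by (simp add: powr_powr flip: powr_numeral)
    finally show ?thesis by (simp add: k_def mult_ac)
  qed simp
  have le: "trunc_power b c w \<le> ennreal (k * w powr (2 * b))"
    unfolding full[symmetric] trunc_power_def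
    using c by (intro nn_integral_mono) (auto simp: indicator_def)
  then show fin: "trunc_power b c w < \<top>" by (simp add: le_less_trans)
  show "enn2real (trunc_power b c w) \<le> k * w powr (2 * b)"
    using enn2real_mono[OF le] k by simp
  have "trunc_power b c w \<le> (\<integral>\<^sup>+v. indicator {c..} v * ennreal (v powr (- b - 1)) \<partial>lborel)"
    unfolding trunc_power_def
    by (intro nn_integral_mono) (auto simp: indicator_def mult_left_le intro!: ennreal_leI)
  also have "\<dots> = ennreal (c powr (- b) / b)" by (rule nn_integral_powr_to_inf[OF b(1) c])
  finally show "enn2real (trunc_power b c w) \<le> c powr (- b) / b"
    using b by (intro enn2real_leI) auto
  have "ennreal (k * w powr (2 * b)) = (\<integral>\<^sup>+v. indicator {c<..} v * ?h v + indicator {0<..c} v * ?h v \<partial>lborel)"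
    unfolding full[symmetric] using c by (intro nn_integral_cong) (auto simp: indicator_def)
  also have "\<dots> = trunc_power b c w + (\<integral>\<^sup>+v. indicator {0<..c} v * ?h v \<partial>lborel)"
    unfolding trunc_power_def by (rule nn_integral_add) auto
  also have "(\<integral>\<^sup>+v. indicator {0<..c} v * ?h v \<partial>lborel) \<le>
      (\<integral>\<^sup>+v. ennreal (w\<^sup>2) * (indicator {0<..<c} v * ennreal (v powr ((1 - b) - 1))) \<partial>lborel)"
  proof (rule nn_integral_mono_AE)
    show "AE v in lborel. indicator {0<..c} v * ?h v \<le> ennreal (w\<^sup>2) * (indicator {0<..<c} v * ennreal (v powr ((1 - b) - 1)))"
      using AE_lborel_singleton[of c]
    proof eventually_elim
      case (elim v)
      show ?case
      proof (cases "0 < v \<and> v < c")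
        case True
        have "1 - exp (- (v * w\<^sup>2)) \<le> v * w\<^sup>2" using exp_ge_add_one_self[of "- (v * w\<^sup>2)"] by linarith
        then have "v powr (- b - 1) * (1 - exp (- (v * w\<^sup>2))) \<le> v powr (- b - 1) * (v * w\<^sup>2)"
          by (rule mult_left_mono) simp
        also have "v powr (- b - 1) * (v * w\<^sup>2) = w\<^sup>2 * v powr ((1 - b) - 1)"
          using True by (simp add: powr_mult_base[symmetric] mult_ac powr_diff powr_minus divide_simps)
        finally show ?thesis using True by (simp add: ennreal_mult'[symmetric] ennreal_leI)
      qed (use elim in \<open>auto simp: indicator_def\<close>)
    qed
  qed
  also have "\<dots> = ennreal (w\<^sup>2) * ennreal (c powr (1 - b) / (1 - b))"
    using nn_integral_powr_from_0[of "1 - b" c] b c by (subst nn_integral_cmult) simp_all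
  also have "\<dots> = ennreal (w\<^sup>2 * c powr (1 - b) / (1 - b))"
    using b by (simp add: ennreal_mult'[symmetric])
  also have "trunc_power b c w = ennreal (enn2real (trunc_power b c w))" using fin by simp
  finally have "ennreal (k * w powr (2 * b)) \<le> ennreal (enn2real (trunc_power b c w) + w\<^sup>2 * c powr (1 - b) / (1 - b))"
    using b by (simp add: ennreal_plus add_left_mono)
  then have "k * w powr (2 * b) \<le> enn2real (trunc_power b c w) + w\<^sup>2 * c powr (1 - b) / (1 - b)"
    using b by (subst (asm) ennreal_le_iff) (auto intro!: add_nonneg_nonneg)
  then show "k * w powr (2 * b) - w\<^sup>2 * c powr (1 - b) / (1 - b) \<le> enn2real (trunc_power b c w)"
    by simp
qed

lemma borel_measurable_trunc_power [measurable]: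
  "(\<lambda>w. trunc_power b c w) \<in> borel_measurable borel"
proof -
  have "(\<lambda>(w, v). indicator {c<..} v * ennreal (v powr (- b - 1) * (1 - exp (- (v * w\<^sup>2)))))
      \<in> borel_measurable (borel \<Otimes>\<^sub>M lborel)"
    unfolding split_beta' by measurable
  then show ?thesis
    unfolding trunc_power_def by (rule lborel.borel_measurable_nn_integral)
qed

text \<open>
  Since \<open>exp (- (s * (norm x)\<^sup>2))\<close> is the characteristic function of a Gaussian vector, Fubini turns
  its expectation under \<open>\<rho>\<close> into the Gaussian expectation of the characteristic function of \<open>\<rho>\<close>.
\<close>

lemma radial_laplace_transform:
  fixes \<rho> :: "'a::euclidean_space measure" and Q :: "real \<Rightarrow> real"
  assumes \<rho>: "prob_space \<rho>" and sets: "sets \<rho> = sets borel"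
    and char: "\<And>x. (LINT y|\<rho>. iexp (x \<bullet> y)) = complex_of_real (exp (- Q (norm x)))"
    and s: "0 \<le> s"
  shows "(LINT x|\<rho>. 1 - exp (- (s * (norm x)\<^sup>2))) = (LINT y|(std_gaussian :: 'a measure). 1 - exp (- Q (sqrt (2 * s) * norm y)))"
proof -
  interpret \<rho>: prob_space \<rho> by fact
  interpret G: prob_space "std_gaussian :: 'a measure" by (rule prob_space_std_gaussian)
  interpret P: pair_prob_space \<rho> "std_gaussian :: 'a measure" ..
  define \<sigma> where "\<sigma> = sqrt (2 * s)"
  have \<sigma>: "0 \<le> \<sigma>" "\<sigma>\<^sup>2 = 2 * s" using s by (auto simp: \<sigma>_def)
  have sp: "space \<rho> = UNIV" using sets_eq_imp_space_eq[OF sets] by simp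
  have "(\<lambda>z. iexp (\<sigma> * (fst z \<bullet> snd z))) \<in> borel_measurable (borel \<Otimes>\<^sub>M borel :: ('a \<times> 'a) measure)"
    by measurable
  then have "(\<lambda>z. iexp (\<sigma> * (fst z \<bullet> snd z))) \<in> borel_measurable (\<rho> \<Otimes>\<^sub>M (std_gaussian :: 'a measure))"
    using measurable_cong_sets[OF sets_pair_measure_cong[OF sets sets_std_gaussian] refl, of "borel :: complex measure"] by blast
  then have int: "integrable (\<rho> \<Otimes>\<^sub>M (std_gaussian :: 'a measure)) (\<lambda>(x, y). iexp (\<sigma> * (x \<bullet> y)))"
    by (intro P.integrable_const_bound[of _ 1]) (auto simp: split_beta')
  have "complex_of_real (LINT x|\<rho>. exp (- (s * (norm x)\<^sup>2))) =
      (LINT x|\<rho>. complex_of_real (exp (- (s * (norm x)\<^sup>2))))"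
    by simp
  also have "\<dots> = (LINT x|\<rho>. LINT y|(std_gaussian :: 'a measure). iexp (\<sigma> * (x \<bullet> y)))"
  proof (rule Bochner_Integration.integral_cong)
    fix x :: 'a
    have "(LINT y|(std_gaussian :: 'a measure). iexp ((\<sigma> *\<^sub>R x) \<bullet> y)) = complex_of_real (exp (- (s * (norm x)\<^sup>2)))"
      unfolding std_gaussian_iexp using \<sigma> by (simp add: power_mult_distrib)
    then show "complex_of_real (exp (- (s * (norm x)\<^sup>2))) = (LINT y|(std_gaussian :: 'a measure). iexp (\<sigma> * (x \<bullet> y)))"
      by simp
  qed simp
  also have "\<dots> = (LINT y|(std_gaussian :: 'a measure). LINT x|\<rho>. iexp (\<sigma> * (x \<bullet> y)))"
    by (rule P.Fubini_integral[OF int, symmetric])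
  also have "\<dots> = (LINT y|(std_gaussian :: 'a measure). complex_of_real (exp (- Q (\<sigma> * norm y))))"
  proof (rule Bochner_Integration.integral_cong)
    fix y :: 'a
    show "(LINT x|\<rho>. iexp (\<sigma> * (x \<bullet> y))) = complex_of_real (exp (- Q (\<sigma> * norm y)))"
      using char[of "\<sigma> *\<^sub>R y"] \<sigma> by (simp add: inner_commute)
  qed simp
  also have "\<dots> = complex_of_real (LINT y|(std_gaussian :: 'a measure). exp (- Q (\<sigma> * norm y)))"
    by simp
  finally have eq: "(LINT x|\<rho>. exp (- (s * (norm x)\<^sup>2))) = (LINT y|(std_gaussian :: 'a measure). exp (- Q (\<sigma> * norm y)))"
    by (simp only: of_real_eq_iff)
  have cm: "(\<lambda>y. LINT x|\<rho>. iexp (\<sigma> * (x \<bullet> y))) \<in> borel_measurable (std_gaussian :: 'a measure)"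
    using P.integrable_snd[OF int] by (rule borel_measurable_integrable)
  have "exp (- Q (\<sigma> * norm y)) = Re (LINT x|\<rho>. iexp (\<sigma> * (x \<bullet> y)))" for y
      using char[of "\<sigma> *\<^sub>R y"] \<sigma> by (simp add: inner_commute)
  then have em: "(\<lambda>y. exp (- Q (\<sigma> * norm y))) \<in> borel_measurable (std_gaussian :: 'a measure)"
    using measurable_compose[OF cm borel_measurable_Re] by (simp only:)
  have eb: "norm (exp (- Q (norm x))) \<le> 1" for x :: 'a
  proof -
    have "norm (LINT y|\<rho>. iexp (x \<bullet> y)) \<le> (LINT y|\<rho>. norm (iexp (x \<bullet> y)))" by (rule integral_norm_bound)
    also have "\<dots> = 1" using \<rho>.prob_space by simp
    finally show ?thesis unfolding char by simp
  qed
  have i1: "integrable (std_gaussian :: 'a measure) (\<lambda>y. exp (- Q (\<sigma> * norm y)))"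
    using eb[of "\<sigma> *\<^sub>R _"] \<sigma> em by (intro G.integrable_const_bound[of _ 1]) auto
  have "(\<lambda>x::'a. exp (- (s * (norm x)\<^sup>2))) \<in> borel_measurable borel" by measurable
  then have "(\<lambda>x::'a. exp (- (s * (norm x)\<^sup>2))) \<in> borel_measurable \<rho>"
    using measurable_cong_sets[OF sets refl, of "borel :: real measure"] by blast
  then have i2: "integrable \<rho> (\<lambda>x. exp (- (s * (norm x)\<^sup>2)))"
    using s by (intro \<rho>.integrable_const_bound[of _ 1]) auto
  show ?thesis
    using i1 i2 eq by (simp add: \<sigma>_def[symmetric] \<rho>.prob_space G.prob_space[simplified])
qed

lemma nn_integral_radial_laplace_transform:
  fixes \<rho> :: "'a::euclidean_space measure" and Q :: "real \<Rightarrow> real"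
  assumes \<rho>: "prob_space \<rho>" and sets: "sets \<rho> = sets borel"
    and char: "\<And>x. (LINT y|\<rho>. iexp (x \<bullet> y)) = complex_of_real (exp (- Q (norm x)))"
    and Q: "continuous_on {0..} Q" "\<And>r. 0 \<le> r \<Longrightarrow> 0 \<le> Q r"
    and s: "0 \<le> s"
  shows "(\<integral>\<^sup>+x. ennreal (1 - exp (- (s * (norm x)\<^sup>2))) \<partial>\<rho>) =
    (\<integral>\<^sup>+y. ennreal (1 - exp (- Q (sqrt (2 * s) * norm y))) \<partial>(std_gaussian :: 'a measure))"
    and "(LINT x|\<rho>. 1 - exp (- (s * (norm x)\<^sup>2))) =
    enn2real (\<integral>\<^sup>+y. ennreal (1 - exp (- Q (sqrt (2 * s) * norm y))) \<partial>(std_gaussian :: 'a measure))"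
proof -
  interpret \<rho>: prob_space \<rho> by fact
  interpret G: prob_space "std_gaussian :: 'a measure" by (rule prob_space_std_gaussian)
  have "continuous_on UNIV (\<lambda>y::'a. 1 - exp (- Q (sqrt (2 * s) * norm y)))"
    using s by (intro continuous_intros continuous_on_compose2[OF Q(1)]) auto
  then have "(\<lambda>y::'a. 1 - exp (- Q (sqrt (2 * s) * norm y))) \<in> borel_measurable borel"
    by (rule borel_measurable_continuous_onI)
  then have m1: "(\<lambda>y::'a. 1 - exp (- Q (sqrt (2 * s) * norm y))) \<in> borel_measurable std_gaussian"
    using measurable_cong_sets[OF sets_std_gaussian refl, of "borel :: real measure"] by blast
  have "(\<lambda>x::'a. 1 - exp (- (s * (norm x)\<^sup>2))) \<in> borel_measurable borel" by measurable
  then have m2: "(\<lambda>x::'a. 1 - exp (- (s * (norm x)\<^sup>2))) \<in> borel_measurable \<rho>"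
    using measurable_cong_sets[OF sets refl, of "borel :: real measure"] by blast
  have i1: "integrable std_gaussian (\<lambda>y::'a. 1 - exp (- Q (sqrt (2 * s) * norm y)))"
    using m1 Q s by (intro G.integrable_const_bound[of _ 1]) auto
  have i2: "integrable \<rho> (\<lambda>x::'a. 1 - exp (- (s * (norm x)\<^sup>2)))"
    using m2 s by (intro \<rho>.integrable_const_bound[of _ 1]) auto
  have 1: "(\<integral>\<^sup>+y. ennreal (1 - exp (- Q (sqrt (2 * s) * norm y))) \<partial>(std_gaussian :: 'a measure)) =
      ennreal (LINT y|(std_gaussian :: 'a measure). 1 - exp (- Q (sqrt (2 * s) * norm y)))"
    using i1 Q s by (intro nn_integral_eq_integral) auto
  have 2: "(\<integral>\<^sup>+x. ennreal (1 - exp (- (s * (norm x)\<^sup>2))) \<partial>\<rho>) = ennreal (LINT x|\<rho>. 1 - exp (- (s * (norm x)\<^sup>2)))"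
    using i2 s by (intro nn_integral_eq_integral) auto
  show "(\<integral>\<^sup>+x. ennreal (1 - exp (- (s * (norm x)\<^sup>2))) \<partial>\<rho>) =
    (\<integral>\<^sup>+y. ennreal (1 - exp (- Q (sqrt (2 * s) * norm y))) \<partial>(std_gaussian :: 'a measure))"
    unfolding 1 2 radial_laplace_transform[OF \<rho> sets char s] ..
  show "(LINT x|\<rho>. 1 - exp (- (s * (norm x)\<^sup>2))) =
    enn2real (\<integral>\<^sup>+y. ennreal (1 - exp (- Q (sqrt (2 * s) * norm y))) \<partial>(std_gaussian :: 'a measure))"
    unfolding 1 radial_laplace_transform[OF \<rho> sets char s, symmetric]
    using s by (subst enn2real_ennreal) auto
qed


lemma borel_measurable_on_std_gaussian:
  "f \<in> borel_measurable (std_gaussian :: 'a::euclidean_space measure) \<longleftrightarrow> f \<in> borel_measurable borel"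
  using measurable_cong_sets[OF sets_std_gaussian refl] by blast

lemma borel_measurable_on_lborel_std_gaussian:
  "f \<in> borel_measurable (lborel \<Otimes>\<^sub>M (std_gaussian :: 'a::euclidean_space measure)) \<longleftrightarrow>
    f \<in> borel_measurable ((borel :: real measure) \<Otimes>\<^sub>M (borel :: 'a measure))"
  using measurable_cong_sets[OF sets_pair_measure_cong[OF sets_lborel sets_std_gaussian] refl] by blast

lemma ennreal_plus_1: "0 \<le> a \<Longrightarrow> ennreal a + 1 = ennreal (a + 1)"
  using ennreal_plus[of a 1] by simp

lemma ennreal_mult_plus_1:
  assumes "0 \<le> a" "0 \<le> x"
  shows "ennreal a * (ennreal x + 1) = ennreal (a * (x + 1))"
  unfolding ennreal_plus_1[OF assms(2)] by (rule ennreal_mult'[OF assms(1), symmetric])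

lemma std_gaussian_scaled_powr:
  fixes p a :: real
  assumes "0 \<le> p" "0 \<le> a"
  shows "(\<integral>\<^sup>+y. ennreal ((a * norm y) powr p) \<partial>(std_gaussian :: 'a::euclidean_space measure)) =
    ennreal (a powr p * (2 powr (p / 2) * Gamma ((real DIM('a) + p) / 2) / Gamma (real DIM('a) / 2)))"
proof -
  have "(\<integral>\<^sup>+y. ennreal ((a * norm y) powr p) \<partial>(std_gaussian :: 'a measure)) =
      (\<integral>\<^sup>+y. ennreal (a powr p) * ennreal (norm y powr p) \<partial>(std_gaussian :: 'a measure))"
    using assms by (simp add: powr_mult ennreal_mult')
  also have "\<dots> = ennreal (a powr p) * (\<integral>\<^sup>+y. ennreal (norm y powr p) \<partial>(std_gaussian :: 'a measure))"
    by (rule nn_integral_cmult) (simp add: borel_measurable_on_std_gaussian)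
  finally show ?thesis
    using assms by (simp only: std_gaussian_norm_powr ennreal_mult'[OF powr_ge_zero])
qed

section \<open>Scaling limits of truncated moments\<close>

text \<open>
  The setting for both scaling limits: laws with radial exponents \<open>q n\<close>, and scales \<open>\<phi> n\<close> tending
  to infinity at which the exponents obey a uniform bound of order \<open>\<gamma>\<close>.
\<close>

context
  fixes \<rho> :: "nat \<Rightarrow> 'a::euclidean_space measure" and q :: "nat \<Rightarrow> real \<Rightarrow> real"
    and \<phi> :: "nat \<Rightarrow> real" and \<alpha> \<gamma> C :: real
  assumes prob: "\<And>n. prob_space (\<rho> n)" and sets: "\<And>n. sets (\<rho> n) = sets borel"
    and char: "\<And>n x. (LINT y|\<rho> n. iexp (x \<bullet> y)) = complex_of_real (exp (- q n (norm x)))"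
    and q: "\<And>n. continuous_on {0..} (q n)" "\<And>n r. 0 \<le> r \<Longrightarrow> 0 \<le> q n r"
    and bound: "\<And>n u. 0 \<le> u \<Longrightarrow> 1 - exp (- q n (\<phi> n * u)) \<le> C * (u powr \<gamma> + \<phi> n powr - \<gamma>)"
    and \<phi>: "\<And>n. 0 < \<phi> n" "filterlim \<phi> at_top sequentially"
    and C: "0 \<le> C" and \<gamma>: "0 < \<gamma>"
begin

text \<open>
  The expectation is a Gaussian mean of \<open>1 - exp (- q n (sqrt 2 * norm y))\<close>. At argument
  \<open>u = sqrt 2 * norm y / \<phi> n\<close> both terms of the assumed bound are of order \<open>\<phi> n powr - \<gamma>\<close>, which
  beats \<open>\<phi> n powr \<beta>\<close>.
\<close>

lemma scaled_tail_tendsto_0: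
  assumes \<beta>: "0 < \<beta>" "\<beta> < \<gamma>"
  shows "(\<lambda>n. \<phi> n powr \<beta> * (LINT x|\<rho> n. 1 - exp (- (norm x)\<^sup>2))) \<longlonglongrightarrow> 0"
proof -
  interpret G: prob_space "std_gaussian :: 'a measure" by (rule prob_space_std_gaussian)
  define m where "m = sqrt 2 powr \<gamma> * (2 powr (\<gamma> / 2) * Gamma ((real DIM('a) + \<gamma>) / 2) / Gamma (real DIM('a) / 2))"
  have m: "0 \<le> m" using \<gamma> by (auto simp: m_def intro!: mult_nonneg_nonneg divide_nonneg_nonneg Gamma_real_nonneg)
  have le: "(LINT x|\<rho> n. 1 - exp (- (norm x)\<^sup>2)) \<le> C * (m + 1) * \<phi> n powr - \<gamma>" for n
  proof -
    have "(\<integral>\<^sup>+y. ennreal (1 - exp (- q n (sqrt (2 * 1) * norm y))) \<partial>(std_gaussian :: 'a measure)) \<le>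
      (\<integral>\<^sup>+y. ennreal (C * \<phi> n powr - \<gamma>) * (ennreal ((sqrt 2 * norm y) powr \<gamma>) + 1) \<partial>(std_gaussian :: 'a measure))"
    proof (rule nn_integral_mono)
      fix y :: 'a
      have "1 - exp (- q n (\<phi> n * (sqrt 2 * norm y / \<phi> n))) \<le> C * ((sqrt 2 * norm y / \<phi> n) powr \<gamma> + \<phi> n powr - \<gamma>)"
        using \<phi>(1)[of n] by (intro bound) auto
      also have "(sqrt 2 * norm y / \<phi> n) powr \<gamma> = (sqrt 2 * norm y) powr \<gamma> * \<phi> n powr - \<gamma>"
        using \<phi>(1)[of n] by (simp add: powr_divide powr_minus_divide)
      finally have "1 - exp (- q n (sqrt (2 * 1) * norm y)) \<le> (C * \<phi> n powr - \<gamma>) * ((sqrt 2 * norm y) powr \<gamma> + 1)"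
        using \<phi>(1)[of n] by (simp add: algebra_simps)
      then show "ennreal (1 - exp (- q n (sqrt (2 * 1) * norm y))) \<le>
          ennreal (C * \<phi> n powr - \<gamma>) * (ennreal ((sqrt 2 * norm y) powr \<gamma>) + 1)"
        using C by (subst ennreal_mult_plus_1) (auto intro: ennreal_leI)
    qed
    also have "\<dots> = ennreal (C * \<phi> n powr - \<gamma>) * (ennreal m + 1)"
    proof -
      have "(\<integral>\<^sup>+y. ennreal ((sqrt 2 * norm y) powr \<gamma>) + 1 \<partial>(std_gaussian :: 'a measure)) = ennreal m + 1"
        using \<gamma> G.emeasure_space_1
        by (subst nn_integral_add) (simp_all add: borel_measurable_on_std_gaussian std_gaussian_scaled_powr m_def)
      then show ?thesis
        by (subst nn_integral_cmult) (simp_all add: borel_measurable_on_std_gaussian)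
    qed
    also have "\<dots> = ennreal (C * (m + 1) * \<phi> n powr - \<gamma>)"
      using C m by (subst ennreal_mult_plus_1) (auto simp: mult_ac)
    finally have "(\<integral>\<^sup>+y. ennreal (1 - exp (- q n (sqrt (2 * 1) * norm y))) \<partial>(std_gaussian :: 'a measure))
      \<le> ennreal (C * (m + 1) * \<phi> n powr - \<gamma>)" .
    then have "enn2real (\<integral>\<^sup>+y. ennreal (1 - exp (- q n (sqrt (2 * 1) * norm y))) \<partial>(std_gaussian :: 'a measure))
      \<le> C * (m + 1) * \<phi> n powr - \<gamma>"
      using C m by (intro enn2real_leI) auto
    then show ?thesis
      using nn_integral_radial_laplace_transform(2)[OF prob sets char q, of 1 n] by simp
  qed
  have "(\<lambda>n. C * (m + 1) * \<phi> n powr (\<beta> - \<gamma>)) \<longlonglongrightarrow> C * (m + 1) * 0"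
    using \<beta> by (intro tendsto_mult tendsto_const tendsto_neg_powr \<phi>) auto
  then have lim: "(\<lambda>n. C * (m + 1) * \<phi> n powr (\<beta> - \<gamma>)) \<longlonglongrightarrow> 0" by simp
  show ?thesis
  proof (rule tendsto_sandwich[OF _ _ tendsto_const lim])
    show "eventually (\<lambda>n. 0 \<le> \<phi> n powr \<beta> * (LINT x|\<rho> n. 1 - exp (- (norm x)\<^sup>2))) sequentially"
      by (intro always_eventually allI mult_nonneg_nonneg Bochner_Integration.integral_nonneg) auto
    have "\<phi> n powr \<beta> * (LINT x|\<rho> n. 1 - exp (- (norm x)\<^sup>2)) \<le> C * (m + 1) * \<phi> n powr (\<beta> - \<gamma>)" for n
    proof -
      have "\<phi> n powr \<beta> * (LINT x|\<rho> n. 1 - exp (- (norm x)\<^sup>2)) \<le> \<phi> n powr \<beta> * (C * (m + 1) * \<phi> n powr - \<gamma>)"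
        using le by (intro mult_left_mono) auto
      then show ?thesis by (simp add: powr_diff powr_minus_divide mult_ac)
    qed
    then show "eventually (\<lambda>n. \<phi> n powr \<beta> * (LINT x|\<rho> n. 1 - exp (- (norm x)\<^sup>2)) \<le> C * (m + 1) * \<phi> n powr (\<beta> - \<gamma>)) sequentially"
      by simp
  qed
qed

text \<open>
  After exchanging integrals and passing to the Gaussian side, the integrand contains the exponent
  only through \<open>q n (\<phi> n * u)\<close> with \<open>u = sqrt (2 * v) * norm y\<close>, which tends to \<open>u powr \<alpha>\<close>. The truncation
  level \<open>\<phi> n powr - 2\<close> matches the assumed bound: on the domain of integration \<open>\<phi> n powr - \<gamma>\<close> is at
  most \<open>v powr (\<gamma> / 2)\<close>, and \<open>v powr (\<gamma> / 2 - b - 1)\<close> is integrable at 0 because \<open>2 * b < \<gamma>\<close>. The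
  limit integral in \<open>v\<close> is a Gamma value times \<open>(sqrt 2 * norm y) powr (2 * b)\<close>, so a Gaussian moment
  remains.
\<close>

lemma scaled_trunc_power_tendsto:
  assumes lim: "\<And>u. 0 \<le> u \<Longrightarrow> (\<lambda>n. q n (\<phi> n * u)) \<longlonglongrightarrow> u powr \<alpha>"
    and b: "0 < b" "2 * b < \<gamma>" "\<gamma> < \<alpha>"
  shows "(\<lambda>n. \<integral>\<^sup>+x. trunc_power b (\<phi> n powr - 2) (\<phi> n * norm x) \<partial>\<rho> n) \<longlonglongrightarrow>
    ennreal (4 powr b * Gamma (real DIM('a) / 2 + b) / Gamma (real DIM('a) / 2) * Gamma (1 - 2 * b / \<alpha>) / b)"
proof -
  interpret G: prob_space "std_gaussian :: 'a measure" by (rule prob_space_std_gaussian)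
  interpret P: pair_sigma_finite "lborel :: real measure" "std_gaussian :: 'a measure" ..
  let ?G = "std_gaussian :: 'a measure"
  define h :: "nat \<Rightarrow> real \<times> 'a \<Rightarrow> ennreal" where
    "h n z = indicator {\<phi> n powr - 2<..} (fst z) * ennreal (fst z powr (- b - 1)
        * (1 - exp (- q n (\<phi> n * (sqrt (2 * fst z) * norm (snd z))))))" for n z
  define hl :: "real \<times> 'a \<Rightarrow> ennreal" where
    "hl z = indicator {0<..} (fst z) * ennreal (fst z powr (- b - 1)
        * (1 - exp (- ((sqrt (2 * fst z) * norm (snd z)) powr \<alpha>))))" for z
  \<comment> \<open>The integrable majorant of all \<open>h n\<close>.\<close>
  define W :: "real \<times> 'a \<Rightarrow> ennreal" where
    "W z = ennreal C * ((indicator {0<..<1} (fst z) * ennreal (fst z powr ((\<gamma> / 2 - b) - 1)))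
        * (ennreal ((sqrt 2 * norm (snd z)) powr \<gamma>) + 1)) + indicator {1..} (fst z) * ennreal (fst z powr (- b - 1))" for z
  have \<phi>2: "0 < \<phi> n powr - 2" for n using \<phi>(1)[of n] by simp
  have hm: "h n \<in> borel_measurable (lborel \<Otimes>\<^sub>M ?G)" for n
  proof -
    have qm: "(\<lambda>z. q n (\<phi> n * (sqrt (2 * max 0 (fst z)) * norm (snd z)))) \<in> borel_measurable ((borel :: real measure) \<Otimes>\<^sub>M (borel :: 'a measure))"
      unfolding borel_prod using \<phi>(1)[of n]
      by (intro borel_measurable_continuous_onI continuous_on_compose2[OF q(1)] continuous_intros) auto
    \<comment> \<open>Continuity of \<open>q n\<close> is known on \<open>{0..}\<close> only; the indicator allows replacing \<open>fst z\<close> by \<open>max 0 (fst z)\<close>.\<close>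
    have "h n = (\<lambda>z. indicator {\<phi> n powr - 2<..} (fst z) * ennreal (fst z powr (- b - 1)
        * (1 - exp (- q n (\<phi> n * (sqrt (2 * max 0 (fst z)) * norm (snd z)))))))"
    proof
      fix z :: "real \<times> 'a"
      show "h n z = indicator {\<phi> n powr - 2<..} (fst z) * ennreal (fst z powr (- b - 1)
        * (1 - exp (- q n (\<phi> n * (sqrt (2 * max 0 (fst z)) * norm (snd z))))))"
      proof (cases "\<phi> n powr - 2 < fst z")
        case True
        then have "max 0 (fst z) = fst z" using \<phi>2[of n] by linarith
        then show ?thesis by (simp add: h_def)
      qed (simp add: h_def)
    qed
    moreover have "\<dots> \<in> borel_measurable ((borel :: real measure) \<Otimes>\<^sub>M (borel :: 'a measure))"
      using qm by measurable
    ultimately show ?thesis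
      unfolding borel_measurable_on_lborel_std_gaussian by simp
  qed
  have swap: "(\<integral>\<^sup>+x. trunc_power b (\<phi> n powr - 2) (\<phi> n * norm x) \<partial>\<rho> n) = (\<integral>\<^sup>+z. h n z \<partial>(lborel \<Otimes>\<^sub>M ?G))" for n
  proof -
    interpret R: prob_space "\<rho> n" by (rule prob)
    interpret RP: pair_sigma_finite "\<rho> n" "lborel :: real measure" ..
    have "(\<lambda>z. indicator {\<phi> n powr - 2<..} (snd z) * ennreal (snd z powr (- b - 1) * (1 - exp (- (snd z * (\<phi> n * norm (fst z))\<^sup>2)))))
      \<in> borel_measurable ((borel :: 'a measure) \<Otimes>\<^sub>M (borel :: real measure))"
      by measurable
    then have m: "(\<lambda>(x, v). indicator {\<phi> n powr - 2<..} v * ennreal (v powr (- b - 1) * (1 - exp (- (v * (\<phi> n * norm x)\<^sup>2)))))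
      \<in> borel_measurable (\<rho> n \<Otimes>\<^sub>M lborel)"
      unfolding split_beta' using measurable_cong_sets[OF sets_pair_measure_cong[OF sets[of n] sets_lborel] refl, of "borel :: ennreal measure"] by blast
    have "(\<integral>\<^sup>+x. trunc_power b (\<phi> n powr - 2) (\<phi> n * norm x) \<partial>\<rho> n) =
      (\<integral>\<^sup>+v. (\<integral>\<^sup>+x. indicator {\<phi> n powr - 2<..} v * ennreal (v powr (- b - 1) * (1 - exp (- (v * (\<phi> n * norm x)\<^sup>2)))) \<partial>\<rho> n) \<partial>lborel)"
      unfolding trunc_power_def by (rule RP.Fubini'[OF m, symmetric])
    also have "\<dots> = (\<integral>\<^sup>+v. (\<integral>\<^sup>+y. h n (v, y) \<partial>?G) \<partial>lborel)"
    proof (rule nn_integral_cong)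
      fix v :: real
      show "(\<integral>\<^sup>+x. indicator {\<phi> n powr - 2<..} v * ennreal (v powr (- b - 1) * (1 - exp (- (v * (\<phi> n * norm x)\<^sup>2)))) \<partial>\<rho> n)
        = (\<integral>\<^sup>+y. h n (v, y) \<partial>?G)"
      proof (cases "\<phi> n powr - 2 < v")
        case True
        then have v: "0 < v" using \<phi>2[of n] by linarith
        have m1: "(\<lambda>x. ennreal (1 - exp (- (v * (\<phi> n)\<^sup>2 * (norm x)\<^sup>2)))) \<in> borel_measurable (\<rho> n)"
        proof -
          have "(\<lambda>x::'a. ennreal (1 - exp (- (v * (\<phi> n)\<^sup>2 * (norm x)\<^sup>2)))) \<in> borel_measurable borel" by measurable
          then show ?thesis using measurable_cong_sets[OF sets[of n] refl, of "borel :: ennreal measure"] by blast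
        qed
        have m2: "(\<lambda>y. ennreal (1 - exp (- q n (sqrt (2 * (v * (\<phi> n)\<^sup>2)) * norm y)))) \<in> borel_measurable ?G"
        proof -
          have "continuous_on UNIV (\<lambda>y::'a. q n (sqrt (2 * (v * (\<phi> n)\<^sup>2)) * norm y))"
            using v by (intro continuous_on_compose2[OF q(1)] continuous_intros) auto
          from borel_measurable_continuous_onI[OF this] show ?thesis
            unfolding borel_measurable_on_std_gaussian by measurable
        qed
        have "(\<integral>\<^sup>+x. indicator {\<phi> n powr - 2<..} v * ennreal (v powr (- b - 1) * (1 - exp (- (v * (\<phi> n * norm x)\<^sup>2)))) \<partial>\<rho> n)
          = (\<integral>\<^sup>+x. ennreal (v powr (- b - 1)) * ennreal (1 - exp (- (v * (\<phi> n)\<^sup>2 * (norm x)\<^sup>2))) \<partial>\<rho> n)"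
          using True by (intro nn_integral_cong) (simp add: ennreal_mult' power_mult_distrib mult_ac)
        also have "\<dots> = ennreal (v powr (- b - 1)) * (\<integral>\<^sup>+x. ennreal (1 - exp (- (v * (\<phi> n)\<^sup>2 * (norm x)\<^sup>2))) \<partial>\<rho> n)"
          by (rule nn_integral_cmult[OF m1])
        also have "(\<integral>\<^sup>+x. ennreal (1 - exp (- (v * (\<phi> n)\<^sup>2 * (norm x)\<^sup>2))) \<partial>\<rho> n) =
            (\<integral>\<^sup>+y. ennreal (1 - exp (- q n (sqrt (2 * (v * (\<phi> n)\<^sup>2)) * norm y))) \<partial>?G)"
          using v by (intro nn_integral_radial_laplace_transform(1)[OF prob sets char q]) auto
        also have "ennreal (v powr (- b - 1)) * \<dots> =
            (\<integral>\<^sup>+y. ennreal (v powr (- b - 1)) * ennreal (1 - exp (- q n (sqrt (2 * (v * (\<phi> n)\<^sup>2)) * norm y))) \<partial>?G)"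
          by (rule nn_integral_cmult[OF m2, symmetric])
        also have "\<dots> = (\<integral>\<^sup>+y. h n (v, y) \<partial>?G)"
        proof (rule nn_integral_cong)
          fix y :: 'a
          have eq: "sqrt (2 * (v * (\<phi> n)\<^sup>2)) * norm y = \<phi> n * (sqrt (2 * v) * norm y)"
            using \<phi>(1)[of n] by (simp add: real_sqrt_mult)
          show "ennreal (v powr (- b - 1)) * ennreal (1 - exp (- q n (sqrt (2 * (v * (\<phi> n)\<^sup>2)) * norm y))) = h n (v, y)"
            unfolding eq using True by (simp add: h_def ennreal_mult')
        qed
        finally show ?thesis .
      qed (simp add: h_def)
    qed
    also have "\<dots> = (\<integral>\<^sup>+z. h n z \<partial>(lborel \<Otimes>\<^sub>M ?G))"
      by (rule G.nn_integral_fst[OF hm])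
    finally show ?thesis .
  qed
  define m where "m = sqrt 2 powr \<gamma> * (2 powr (\<gamma> / 2) * Gamma ((real DIM('a) + \<gamma>) / 2) / Gamma (real DIM('a) / 2))"
  have Wm: "W \<in> borel_measurable (lborel \<Otimes>\<^sub>M ?G)"
    unfolding W_def borel_measurable_on_lborel_std_gaussian by measurable
  have hlm: "hl \<in> borel_measurable (lborel \<Otimes>\<^sub>M ?G)"
    unfolding hl_def borel_measurable_on_lborel_std_gaussian by measurable
  have Wfin: "(\<integral>\<^sup>+z. W z \<partial>(lborel \<Otimes>\<^sub>M ?G)) < \<infinity>"
  proof -
    have "(\<integral>\<^sup>+z. W z \<partial>(lborel \<Otimes>\<^sub>M ?G)) = (\<integral>\<^sup>+v. (\<integral>\<^sup>+y. W (v, y) \<partial>?G) \<partial>lborel)"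
      by (rule G.nn_integral_fst[OF Wm, symmetric])
    also have "\<dots> = (\<integral>\<^sup>+v. ennreal C * (ennreal m + 1) * (indicator {0<..<1} v * ennreal (v powr ((\<gamma> / 2 - b) - 1)))
        + indicator {1..} v * ennreal (v powr (- b - 1)) \<partial>lborel)"
    proof (rule nn_integral_cong)
      fix v :: real
      have "(\<integral>\<^sup>+y. ennreal ((sqrt 2 * norm y) powr \<gamma>) + 1 \<partial>?G) = ennreal m + 1"
        using \<gamma> G.emeasure_space_1
        by (subst nn_integral_add) (simp_all add: borel_measurable_on_std_gaussian std_gaussian_scaled_powr m_def)
      then show "(\<integral>\<^sup>+y. W (v, y) \<partial>?G) = ennreal C * (ennreal m + 1) * (indicator {0<..<1} v * ennreal (v powr ((\<gamma> / 2 - b) - 1)))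
        + indicator {1..} v * ennreal (v powr (- b - 1))"
        unfolding W_def using G.emeasure_space_1
        by (simp add: nn_integral_add nn_integral_cmult borel_measurable_on_std_gaussian mult_ac)
    qed
    also have "\<dots> = ennreal C * (ennreal m + 1) * ennreal (1 powr (\<gamma> / 2 - b) / (\<gamma> / 2 - b)) + ennreal (1 powr (- b) / b)"
      using b nn_integral_powr_from_0[of "\<gamma> / 2 - b" 1] nn_integral_powr_to_inf[of b 1]
      by (simp add: nn_integral_add nn_integral_cmult)
    also have "\<dots> < \<infinity>"
      by (simp add: ennreal_mult_less_top)
    finally show ?thesis .
  qed
  have hW: "h n z \<le> W z" for n z
  proof (cases "\<phi> n powr - 2 < fst z")
    case True
    obtain v y where z: "z = (v, y)" by (cases z)
    have v1: "\<phi> n powr - 2 < v" using True by (simp add: z)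
    then have "0 < v" using \<phi>2[of n] by linarith
    with v1 have v: "\<phi> n powr - 2 < v" "0 < v" by auto
    let ?e = "1 - exp (- q n (\<phi> n * (sqrt (2 * v) * norm y)))"
    show ?thesis
    proof (cases "v < 1")
      case True
      have "?e \<le> C * ((sqrt (2 * v) * norm y) powr \<gamma> + \<phi> n powr - \<gamma>)"
        using v by (intro bound) auto
      also have "(sqrt (2 * v) * norm y) powr \<gamma> = v powr (\<gamma> / 2) * (sqrt 2 * norm y) powr \<gamma>"
        using v by (simp add: real_sqrt_mult powr_mult powr_half_sqrt[symmetric] powr_powr mult_ac)
      also have "C * (v powr (\<gamma> / 2) * (sqrt 2 * norm y) powr \<gamma> + \<phi> n powr - \<gamma>) \<le>
          C * (v powr (\<gamma> / 2) * (sqrt 2 * norm y) powr \<gamma> + v powr (\<gamma> / 2))"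
      proof -
        have "\<phi> n powr - \<gamma> = (\<phi> n powr - 2) powr (\<gamma> / 2)" by (simp add: powr_powr)
        also have "\<dots> \<le> v powr (\<gamma> / 2)" using v \<gamma> by (intro powr_mono2) auto
        finally show ?thesis using C by (intro mult_left_mono add_left_mono)
      qed
      finally have "?e \<le> C * (v powr (\<gamma> / 2) * ((sqrt 2 * norm y) powr \<gamma> + 1))"
        by (simp add: distrib_left)
      then have "v powr (- b - 1) * ?e \<le> v powr (- b - 1) * (C * (v powr (\<gamma> / 2) * ((sqrt 2 * norm y) powr \<gamma> + 1)))"
        by (rule mult_left_mono) simp
      also have "\<dots> = C * (v powr ((\<gamma> / 2 - b) - 1) * ((sqrt 2 * norm y) powr \<gamma> + 1))"
      proof -
        have "v powr ((\<gamma> / 2 - b) - 1) = v powr (- b - 1) * v powr (\<gamma> / 2)"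
          by (subst powr_add[symmetric]) (simp add: algebra_simps)
        then show ?thesis by (simp only: mult_ac)
      qed
      finally have le: "v powr (- b - 1) * ?e \<le> C * (v powr ((\<gamma> / 2 - b) - 1) * ((sqrt 2 * norm y) powr \<gamma> + 1))" .
      show ?thesis
      proof -
        have "ennreal C * (ennreal (v powr ((\<gamma> / 2 - b) - 1)) * (ennreal ((sqrt 2 * norm y) powr \<gamma>) + 1)) =
            ennreal (C * (v powr ((\<gamma> / 2 - b) - 1) * ((sqrt 2 * norm y) powr \<gamma> + 1)))"
          using C by (subst ennreal_mult_plus_1) (auto intro: ennreal_mult'[symmetric])
        moreover have "h n z = ennreal (v powr (- b - 1) * ?e)" using v by (simp add: z h_def)
        moreover have "W z = ennreal C * (ennreal (v powr ((\<gamma> / 2 - b) - 1)) * (ennreal ((sqrt 2 * norm y) powr \<gamma>) + 1))"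
          using v True by (simp add: z W_def)
        ultimately show ?thesis using le by (simp only: ennreal_leI)
      qed
    next
      case False
      have "v powr (- b - 1) * ?e \<le> v powr (- b - 1)" by (simp add: mult_left_le)
      then show ?thesis using v False by (simp add: z h_def W_def ennreal_leI)
    qed
  qed (simp add: h_def)
  have hlim: "(\<lambda>n. h n z) \<longlonglongrightarrow> hl z" for z
  proof -
    obtain v y where z: "z = (v, y)" by (cases z)
    show ?thesis
    proof (cases "0 < v")
      case True
      have "(\<lambda>n. \<phi> n powr - 2) \<longlonglongrightarrow> 0" by (rule tendsto_neg_powr[OF _ \<phi>(2)]) simp
      then have "eventually (\<lambda>n. \<phi> n powr - 2 < v) sequentially" using True by (rule order_tendstoD)
      then have ev: "eventually (\<lambda>n. ennreal (v powr (- b - 1) * (1 - exp (- q n (\<phi> n * (sqrt (2 * v) * norm y))))) = h n z) sequentially"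
        by eventually_elim (simp add: h_def z)
      have "(\<lambda>n. ennreal (v powr (- b - 1) * (1 - exp (- q n (\<phi> n * (sqrt (2 * v) * norm y)))))) \<longlonglongrightarrow>
          ennreal (v powr (- b - 1) * (1 - exp (- ((sqrt (2 * v) * norm y) powr \<alpha>))))"
        using True by (intro tendsto_intros lim tendsto_ennrealI) auto
      from Lim_transform_eventually[OF this ev] show ?thesis using True by (simp add: hl_def z)
    next
      case False
      have "h n z = 0" for n
      proof -
        have "\<not> \<phi> n powr - 2 < v" using False \<phi>2[of n] by linarith
        then show ?thesis by (simp add: h_def z)
      qed
      then show ?thesis using False by (simp add: hl_def z)
    qed
  qed
  have "(\<lambda>n. \<integral>\<^sup>+z. h n z \<partial>(lborel \<Otimes>\<^sub>M ?G)) \<longlonglongrightarrow> (\<integral>\<^sup>+z. hl z \<partial>(lborel \<Otimes>\<^sub>M ?G))"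
    by (rule nn_integral_dominated_convergence[OF hm hlm Wm]) (use hW hlim Wfin in auto)
  moreover have "(\<integral>\<^sup>+z. hl z \<partial>(lborel \<Otimes>\<^sub>M ?G)) =
    ennreal (4 powr b * Gamma (real DIM('a) / 2 + b) / Gamma (real DIM('a) / 2) * Gamma (1 - 2 * b / \<alpha>) / b)"
  proof -
    have \<alpha>: "0 < \<alpha>" "2 * b / \<alpha> < 1" using b by auto
    have "(\<integral>\<^sup>+z. hl z \<partial>(lborel \<Otimes>\<^sub>M ?G)) = (\<integral>\<^sup>+y. (\<integral>\<^sup>+v. hl (v, y) \<partial>lborel) \<partial>?G)"
      by (rule P.nn_integral_snd[OF hlm, symmetric])
    also have "\<dots> = (\<integral>\<^sup>+y. ennreal (Gamma (1 - 2 * b / \<alpha>) / b) * ennreal ((sqrt 2 * norm y) powr (2 * b)) \<partial>?G)"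
    proof (rule nn_integral_cong)
      fix y :: 'a
      show "(\<integral>\<^sup>+v. hl (v, y) \<partial>lborel) = ennreal (Gamma (1 - 2 * b / \<alpha>) / b) * ennreal ((sqrt 2 * norm y) powr (2 * b))"
      proof (cases "y = 0")
        case True
        then show ?thesis by (simp add: hl_def)
      next
        case False
        define A where "A = (sqrt 2 * norm y) powr \<alpha>"
        have A: "0 < A" using False by (simp add: A_def)
        have "(\<integral>\<^sup>+v. hl (v, y) \<partial>lborel) =
          (\<integral>\<^sup>+v. indicator {0<..} v * ennreal (v powr (- b - 1) * (1 - exp (- (A * v powr (\<alpha> / 2))))) \<partial>lborel)"
        proof (rule nn_integral_cong)
          fix v :: real
          have "(sqrt (2 * v) * norm y) powr \<alpha> = A * v powr (\<alpha> / 2)" if "0 < v"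
            using that by (simp add: A_def real_sqrt_mult powr_mult powr_half_sqrt[symmetric] powr_powr mult_ac)
          then show "hl (v, y) = indicator {0<..} v * ennreal (v powr (- b - 1) * (1 - exp (- (A * v powr (\<alpha> / 2)))))"
            by (simp add: hl_def indicator_def)
        qed
        also have "\<dots> = ennreal (A powr (b / (\<alpha> / 2)) * Gamma (1 - b / (\<alpha> / 2)) / b)"
          using A b by (intro nn_integral_powr_one_minus_exp) auto
        also have "A powr (b / (\<alpha> / 2)) = (sqrt 2 * norm y) powr (2 * b)"
          using \<alpha> by (simp add: A_def powr_powr mult.commute)
        finally show ?thesis
          using b by (simp add: ennreal_mult''[symmetric] mult_ac)
      qed
    qed
    also have "\<dots> = ennreal (Gamma (1 - 2 * b / \<alpha>) / b) * (\<integral>\<^sup>+y. ennreal ((sqrt 2 * norm y) powr (2 * b)) \<partial>?G)"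
      by (rule nn_integral_cmult) (simp add: borel_measurable_on_std_gaussian)
    also have "\<dots> = ennreal (Gamma (1 - 2 * b / \<alpha>) / b) * ennreal (sqrt 2 powr (2 * b) *
        (2 powr (2 * b / 2) * Gamma ((real DIM('a) + 2 * b) / 2) / Gamma (real DIM('a) / 2)))"
      using b by (subst std_gaussian_scaled_powr) auto
    also have "sqrt 2 powr (2 * b) = 2 powr b" by (simp add: powr_half_sqrt[symmetric] powr_powr)
    also have "ennreal (Gamma (1 - 2 * b / \<alpha>) / b) * ennreal (2 powr b *
        (2 powr (2 * b / 2) * Gamma ((real DIM('a) + 2 * b) / 2) / Gamma (real DIM('a) / 2))) =
      ennreal (Gamma (1 - 2 * b / \<alpha>) / b * (2 powr b *
        (2 powr (2 * b / 2) * Gamma ((real DIM('a) + 2 * b) / 2) / Gamma (real DIM('a) / 2))))"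
      using b \<alpha> by (intro ennreal_mult'[symmetric] divide_nonneg_pos Gamma_real_nonneg) auto
    also have "Gamma (1 - 2 * b / \<alpha>) / b * (2 powr b *
        (2 powr (2 * b / 2) * Gamma ((real DIM('a) + 2 * b) / 2) / Gamma (real DIM('a) / 2))) =
      4 powr b * Gamma (real DIM('a) / 2 + b) / Gamma (real DIM('a) / 2) * Gamma (1 - 2 * b / \<alpha>) / b"
      using powr_mult[of 2 2 b] by (simp add: add_divide_distrib mult_ac)
    finally show ?thesis .
  qed
  ultimately show ?thesis unfolding swap by simp
qed

end


section \<open>Comparison of a radial profile with the kernel\<close>

text \<open>
  Here \<open>\<kappa>\<close> stands for the value at \<open>z\<close> of any kernel that satisfies the bounds of the truncated
  kernel after rescaling. Near 0, both \<open>Fb z\<close> and \<open>Rb / k * \<kappa>\<close> are close to \<open>Rb * z powr (2 * b)\<close> relative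
  to \<open>z powr (2 * b)\<close>, which is itself at most a multiple of \<open>\<kappa>\<close>. Away from 0, boundedness is enough,
  as \<open>1 - exp (- z\<^sup>2)\<close> is bounded below there. The constant depends on \<open>\<epsilon>\<close> only and not on the
  kernel.
\<close>

lemma radial_profile_approx:
  fixes Fb :: "real \<Rightarrow> real" and b L B Rb \<epsilon> :: real
  assumes b: "0 < b" "b < 1" and \<epsilon>: "0 < \<epsilon>"
    and FL: "\<And>z. 0 \<le> z \<Longrightarrow> \<bar>Fb z\<bar> \<le> L * z powr (2 * b)" and FB: "\<And>z. 0 \<le> z \<Longrightarrow> \<bar>Fb z\<bar> \<le> B"
    and lim: "((\<lambda>z. Fb z / z powr (2 * b)) \<longlongrightarrow> Rb) (at_right 0)"
  defines "k \<equiv> Gamma (1 - b) / b"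
  shows "\<exists>Ce\<ge>0. \<forall>z \<kappa>. 0 \<le> z \<longrightarrow> 0 \<le> \<kappa> \<longrightarrow> \<kappa> \<le> 1 / b \<longrightarrow> \<kappa> \<le> k * z powr (2 * b) \<longrightarrow>
    k * z powr (2 * b) - z\<^sup>2 / (1 - b) \<le> \<kappa> \<longrightarrow> \<bar>Fb z - Rb / k * \<kappa>\<bar> \<le> \<epsilon> * \<kappa> + Ce * (1 - exp (- z\<^sup>2))"
proof -
  have k: "0 < k" using b by (simp add: k_def)
  define \<epsilon>1 where "\<epsilon>1 = \<epsilon> * k / 4"
  have \<epsilon>1: "0 < \<epsilon>1" using \<epsilon> k by (simp add: \<epsilon>1_def)
  \<comment> \<open>The first entry makes \<open>\<kappa>\<close> at least half of its leading term, the second bounds the error scaled by \<open>\<bar>Rb\<bar> / k\<close>.\<close>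
  define \<eta>0 where "\<eta>0 = min (k / 2) (\<epsilon>1 * k / (\<bar>Rb\<bar> + 1))"
  have \<eta>0: "0 < \<eta>0" using k \<epsilon>1 by (simp add: \<eta>0_def)
  have "eventually (\<lambda>z. \<bar>Fb z / z powr (2 * b) - Rb\<bar> < \<epsilon>1) (at_right 0)"
    using tendstoD[OF lim \<epsilon>1] by (simp add: dist_real_def)
  moreover have "eventually (\<lambda>z. z powr (2 - 2 * b) / (1 - b) < \<eta>0) (at_right 0)"
  proof -
    have "((\<lambda>z::real. z powr (2 - 2 * b) / (1 - b)) \<longlongrightarrow> 0 powr (2 - 2 * b) / (1 - b)) (at_right 0)"
      using b by (intro tendsto_intros tendsto_powr') (auto simp: eventually_at_right_less intro: eventually_mono[OF eventually_at_right_less])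
    then show ?thesis using \<eta>0 by (intro order_tendstoD(2)) auto
  qed
  ultimately have "eventually (\<lambda>z. \<bar>Fb z / z powr (2 * b) - Rb\<bar> < \<epsilon>1 \<and> z powr (2 - 2 * b) / (1 - b) < \<eta>0) (at_right 0)"
    by (rule eventually_conj)
  then obtain \<delta> where \<delta>: "0 < \<delta>" and near: "\<And>z. 0 < z \<Longrightarrow> z < \<delta> \<Longrightarrow> \<bar>Fb z / z powr (2 * b) - Rb\<bar> < \<epsilon>1"
    "\<And>z. 0 < z \<Longrightarrow> z < \<delta> \<Longrightarrow> z powr (2 - 2 * b) / (1 - b) < \<eta>0"
    unfolding eventually_at_right_field by blast
  have B: "0 \<le> B" using FB[of 0] by simp
  have ed: "0 < 1 - exp (- \<delta>\<^sup>2)" using \<delta> by simp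
  define Ce where "Ce = (B + \<bar>Rb\<bar> / k * (1 / b)) / (1 - exp (- \<delta>\<^sup>2))"
  have Ce: "0 \<le> Ce" unfolding Ce_def using B k b ed by (intro divide_nonneg_pos add_nonneg_nonneg mult_nonneg_nonneg) auto
  have main: "\<bar>Fb z - Rb / k * \<kappa>\<bar> \<le> \<epsilon> * \<kappa> + Ce * (1 - exp (- z\<^sup>2))"
    if z: "0 \<le> z" and \<kappa>: "0 \<le> \<kappa>" "\<kappa> \<le> 1 / b" "\<kappa> \<le> k * z powr (2 * b)" "k * z powr (2 * b) - z\<^sup>2 / (1 - b) \<le> \<kappa>" for z \<kappa>
  proof -
    have nn: "0 \<le> Ce * (1 - exp (- z\<^sup>2))" using Ce by simp
    consider "z = 0" | "0 < z" "z < \<delta>" | "\<delta> \<le> z" using z by linarith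
    then show ?thesis
    proof cases
      case 1
      then show ?thesis using FL[of 0] \<kappa> by simp
    next
      case 2
      define s where "s = z powr (2 * b)"
      define \<eta> where "\<eta> = z powr (2 - 2 * b) / (1 - b)"
      have s: "0 < s" using 2 by (simp add: s_def)
      have \<eta>: "\<eta> \<le> k / 2" "\<eta> \<le> \<epsilon>1 * k / (\<bar>Rb\<bar> + 1)" "0 \<le> \<eta>"
        using near(2)[OF 2] b by (auto simp: \<eta>_def \<eta>0_def)
      have "z powr (2 - 2 * b) * z powr (2 * b) = z\<^sup>2"
        using 2 by (simp add: powr_add[symmetric] powr_numeral)
      then have \<eta>s: "z\<^sup>2 / (1 - b) = \<eta> * s" by (simp add: \<eta>_def s_def)
      have "Fb z - Rb * s = (Fb z / s - Rb) * s" using s by (simp add: field_simps)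
      then have 1: "\<bar>Fb z - Rb * s\<bar> \<le> \<epsilon>1 * s"
        using near(1)[OF 2] s by (simp add: abs_mult s_def mult_right_mono)
      have "Rb * s - Rb / k * \<kappa> = Rb / k * (k * s - \<kappa>)" using k by (simp add: field_simps)
      then have "\<bar>Rb * s - Rb / k * \<kappa>\<bar> = \<bar>Rb\<bar> / k * (k * s - \<kappa>)"
        using k \<kappa>(3) by (simp add: abs_mult s_def)
      also have "\<dots> \<le> \<bar>Rb\<bar> / k * (\<eta> * s)"
        using \<kappa>(4) k by (intro mult_left_mono) (auto simp: \<eta>s s_def[symmetric])
      also have "\<dots> = (\<bar>Rb\<bar> / k * \<eta>) * s" by simp
      also have "\<dots> \<le> \<epsilon>1 * s"
      proof (rule mult_right_mono)
        have "\<bar>Rb\<bar> / k * \<eta> \<le> (\<bar>Rb\<bar> + 1) / k * (\<epsilon>1 * k / (\<bar>Rb\<bar> + 1))"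
          using \<eta> k by (intro mult_mono divide_right_mono) auto
        also have "\<dots> = \<epsilon>1" using k by (simp add: field_simps add_nonneg_eq_0_iff)
        finally show "\<bar>Rb\<bar> / k * \<eta> \<le> \<epsilon>1" .
      qed (use s in simp)
      finally have 2: "\<bar>Rb * s - Rb / k * \<kappa>\<bar> \<le> \<epsilon>1 * s" .
      have "k * s - k / 2 * s \<le> k * s - \<eta> * s" using \<eta> s by (intro diff_left_mono mult_right_mono) auto
      also have "\<dots> \<le> \<kappa>" using \<kappa>(4) by (simp add: \<eta>s s_def[symmetric])
      finally have "k * s \<le> 2 * \<kappa>" by simp
      then have "2 * \<epsilon>1 * s \<le> \<epsilon> * \<kappa>"
        using \<epsilon> mult_left_mono[of "k * s" "2 * \<kappa>" "\<epsilon> / 2"] by (simp add: \<epsilon>1_def mult_ac)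
      then show ?thesis using 1 2 nn by linarith
    next
      case 3
      have "\<bar>Rb / k * \<kappa>\<bar> \<le> \<bar>Rb\<bar> / k * (1 / b)"
        using \<kappa> k b by (simp only: abs_mult abs_divide) (intro mult_mono, auto)
      then have "\<bar>Fb z - Rb / k * \<kappa>\<bar> \<le> B + \<bar>Rb\<bar> / k * (1 / b)"
        using FB[OF z] by linarith
      also have "\<dots> = Ce * (1 - exp (- \<delta>\<^sup>2))" using ed by (simp add: Ce_def)
      also have "\<dots> \<le> Ce * (1 - exp (- z\<^sup>2))" using 3 \<delta> Ce by (intro mult_left_mono) (auto simp: power_mono)
      finally show ?thesis using \<epsilon> \<kappa>(1) by (simp add: add_increasing)
    qed
  qed
  show ?thesis using Ce main by blast
qed

text \<open>
  The pointwise comparison, multiplied by \<open>\<phi> n powr (2 * b)\<close> and integrated, leaves an error of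
  \<open>\<epsilon>\<close> times a convergent sequence plus a multiple of a sequence tending to 0.
\<close>

lemma radial_average_tendsto:
  fixes \<rho> :: "nat \<Rightarrow> 'a::euclidean_space measure" and \<phi> :: "nat \<Rightarrow> real" and Fb :: "real \<Rightarrow> real" and b L B Rb l :: real
  assumes prob: "\<And>n. prob_space (\<rho> n)" and sets: "\<And>n. sets (\<rho> n) = sets borel"
    and \<phi>: "\<And>n. 0 < \<phi> n" and b: "0 < b" "b < 1"
    and Fm: "Fb \<in> borel_measurable borel"
    and FL: "\<And>z. 0 \<le> z \<Longrightarrow> \<bar>Fb z\<bar> \<le> L * z powr (2 * b)" and FB: "\<And>z. 0 \<le> z \<Longrightarrow> \<bar>Fb z\<bar> \<le> B"
    and lim: "((\<lambda>z. Fb z / z powr (2 * b)) \<longlongrightarrow> Rb) (at_right 0)"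
    and l: "0 \<le> l"
    and E: "(\<lambda>n. \<integral>\<^sup>+x. trunc_power b (\<phi> n powr - 2) (\<phi> n * norm x) \<partial>\<rho> n) \<longlonglongrightarrow> ennreal l"
    and D: "(\<lambda>n. \<phi> n powr (2 * b) * (LINT x|\<rho> n. 1 - exp (- (norm x)\<^sup>2))) \<longlonglongrightarrow> 0"
  shows "(\<lambda>n. \<phi> n powr (2 * b) * (LINT x|\<rho> n. Fb (norm x))) \<longlonglongrightarrow> Rb / (Gamma (1 - b) / b) * l"
proof -
  define k where "k = Gamma (1 - b) / b"
  define K where "K n x = enn2real (trunc_power b (\<phi> n powr - 2) (\<phi> n * norm x))" for n and x :: 'a
  define EK where "EK n = (LINT x|\<rho> n. K n x)" for n
  define T where "T n = (LINT x|\<rho> n. 1 - exp (- (norm x)\<^sup>2))" for n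
  have m: "f \<in> borel_measurable (\<rho> n)" if "f \<in> borel_measurable borel" for f :: "'a \<Rightarrow> real" and n
    using that measurable_cong_sets[OF sets[of n] refl, of "borel :: real measure"] by blast
  have \<phi>2: "0 < \<phi> n powr - 2" for n using \<phi>[of n] by simp
  have tp: "trunc_power b (\<phi> n powr - 2) (\<phi> n * norm x) < \<top>" for n and x :: 'a
    using \<phi>[of n] by (intro trunc_power_finite[OF b \<phi>2]) auto
  have K0: "0 \<le> K n x" for n x by (simp add: K_def)
  have K1: "K n x \<le> \<phi> n powr (2 * b) * (1 / b)" for n x
  proof -
    have "K n x \<le> (\<phi> n powr - 2) powr (- b) / b"
      unfolding K_def using \<phi>[of n] by (intro trunc_power_le_const[OF b \<phi>2]) auto
    then show ?thesis by (simp add: powr_powr)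
  qed
  have K2: "K n x \<le> \<phi> n powr (2 * b) * (k * norm x powr (2 * b))" for n x
  proof -
    have "K n x \<le> k * (\<phi> n * norm x) powr (2 * b)"
      unfolding K_def k_def using \<phi>[of n] by (intro trunc_power_le[OF b \<phi>2]) auto
    then show ?thesis using \<phi>[of n] by (simp add: powr_mult mult_ac)
  qed
  have K3: "\<phi> n powr (2 * b) * (k * norm x powr (2 * b) - (norm x)\<^sup>2 / (1 - b)) \<le> K n x" for n x
  proof -
    have "k * (\<phi> n * norm x) powr (2 * b) - (\<phi> n * norm x)\<^sup>2 * (\<phi> n powr - 2) powr (1 - b) / (1 - b) \<le> K n x"
      unfolding K_def k_def using \<phi>[of n] by (intro trunc_power_ge[OF b \<phi>2]) auto
    moreover have "(\<phi> n)\<^sup>2 * (\<phi> n powr - 2) powr (1 - b) = \<phi> n powr (2 * b)"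
    proof -
      have "(\<phi> n)\<^sup>2 * (\<phi> n powr - 2) powr (1 - b) = \<phi> n powr 2 * \<phi> n powr (- 2 * (1 - b))"
        using \<phi>[of n] by (simp add: powr_powr)
      also have "\<dots> = \<phi> n powr (2 + - 2 * (1 - b))" by (rule powr_add[symmetric])
      finally show ?thesis by (simp add: algebra_simps)
    qed
    then have "(\<phi> n * norm x)\<^sup>2 * (\<phi> n powr - 2) powr (1 - b) = \<phi> n powr (2 * b) * (norm x)\<^sup>2"
      by (simp add: power_mult_distrib mult_ac)
    ultimately show ?thesis using \<phi>[of n] by (simp add: powr_mult right_diff_distrib mult_ac)
  qed
  have Km: "K n \<in> borel_measurable borel" for n
    unfolding K_def by measurable
  have Kint: "integrable (\<rho> n) (K n)" for n
  proof -
    interpret prob_space "\<rho> n" by (rule prob)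
    show ?thesis using K0 K1 m[OF Km] by (intro integrable_const_bound[of _ "\<phi> n powr (2 * b) * (1 / b)"]) auto
  qed
  have Fint: "integrable (\<rho> n) (\<lambda>x. Fb (norm x))" for n
  proof -
    interpret prob_space "\<rho> n" by (rule prob)
    have "(\<lambda>x::'a. Fb (norm x)) \<in> borel_measurable borel" using Fm by measurable
    then show ?thesis using FB by (intro integrable_const_bound[of _ B] m) auto
  qed
  have Tint: "integrable (\<rho> n) (\<lambda>x. 1 - exp (- (norm x)\<^sup>2))" for n
  proof -
    interpret prob_space "\<rho> n" by (rule prob)
    show ?thesis by (intro integrable_const_bound[of _ 1] m) auto
  qed
  have EK: "EK \<longlonglongrightarrow> l"
  proof -
    have "(\<integral>\<^sup>+x. trunc_power b (\<phi> n powr - 2) (\<phi> n * norm x) \<partial>\<rho> n) = ennreal (EK n)" for n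
    proof -
      have "(\<integral>\<^sup>+x. ennreal (K n x) \<partial>\<rho> n) = ennreal (EK n)"
        unfolding EK_def using K0 by (intro nn_integral_eq_integral Kint) auto
      then show ?thesis using tp by (simp add: K_def)
    qed
    moreover have "0 \<le> EK n" for n unfolding EK_def using K0 by (intro Bochner_Integration.integral_nonneg)
    ultimately show ?thesis using E l by (simp add: tendsto_ennreal_iff)
  qed
  have "(\<lambda>n. \<phi> n powr (2 * b) * (LINT x|\<rho> n. Fb (norm x)) - Rb / k * EK n) \<longlonglongrightarrow> 0"
  proof (rule LIMSEQ_I)
    fix e :: real assume e: "0 < e"
    \<comment> \<open>Eventually the kernel means are below \<open>l + 1\<close>, so the first error term is at most \<open>e / 2\<close>.\<close>
    define \<epsilon> where "\<epsilon> = e / (2 * (l + 1))"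
    have \<epsilon>: "0 < \<epsilon>" using e l by (simp add: \<epsilon>_def)
    obtain Ce where Ce: "0 \<le> Ce" and app: "\<And>z \<kappa>. \<lbrakk>0 \<le> z; 0 \<le> \<kappa>; \<kappa> \<le> 1 / b; \<kappa> \<le> k * z powr (2 * b);
        k * z powr (2 * b) - z\<^sup>2 / (1 - b) \<le> \<kappa>\<rbrakk> \<Longrightarrow> \<bar>Fb z - Rb / k * \<kappa>\<bar> \<le> \<epsilon> * \<kappa> + Ce * (1 - exp (- z\<^sup>2))"
      using radial_profile_approx[OF b \<epsilon> FL FB lim] unfolding k_def by blast
    have bd: "\<bar>\<phi> n powr (2 * b) * (LINT x|\<rho> n. Fb (norm x)) - Rb / k * EK n\<bar> \<le> \<epsilon> * EK n + Ce * (\<phi> n powr (2 * b) * T n)" for n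
    proof -
      let ?p = "\<phi> n powr (2 * b)"
      have p: "0 < ?p" using \<phi>[of n] by simp
      have pt: "\<bar>?p * Fb (norm x) - Rb / k * K n x\<bar> \<le> \<epsilon> * K n x + Ce * (?p * (1 - exp (- (norm x)\<^sup>2)))" for x
      proof -
        have "\<bar>Fb (norm x) - Rb / k * (K n x / ?p)\<bar> \<le> \<epsilon> * (K n x / ?p) + Ce * (1 - exp (- (norm x)\<^sup>2))"
          using p K0[of n x] K1[of n x] K2[of n x] K3[of n x]
          by (intro app) (auto simp: divide_le_eq le_divide_eq mult_ac)
        from mult_left_mono[OF this, of ?p]
        have "?p * \<bar>Fb (norm x) - Rb / k * (K n x / ?p)\<bar> \<le> ?p * (\<epsilon> * (K n x / ?p) + Ce * (1 - exp (- (norm x)\<^sup>2)))"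
          using p by simp
        moreover have "?p * \<bar>Fb (norm x) - Rb / k * (K n x / ?p)\<bar> = \<bar>?p * (Fb (norm x) - Rb / k * (K n x / ?p))\<bar>"
          using p by (simp add: abs_mult)
        moreover have "?p * (Fb (norm x) - Rb / k * (K n x / ?p)) = ?p * Fb (norm x) - Rb / k * K n x"
          using p by (simp add: right_diff_distrib)
        moreover have "?p * (\<epsilon> * (K n x / ?p) + Ce * (1 - exp (- (norm x)\<^sup>2))) = \<epsilon> * K n x + Ce * (?p * (1 - exp (- (norm x)\<^sup>2)))"
          using p by (simp add: distrib_left)
        ultimately show ?thesis by simp
      qed
      have "?p * (LINT x|\<rho> n. Fb (norm x)) - Rb / k * EK n = (LINT x|\<rho> n. ?p * Fb (norm x) - Rb / k * K n x)"
        unfolding EK_def using Fint Kint by simp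
      also have "\<bar>\<dots>\<bar> \<le> (LINT x|\<rho> n. \<bar>?p * Fb (norm x) - Rb / k * K n x\<bar>)" by (rule integral_abs_bound)
      also have "\<dots> \<le> (LINT x|\<rho> n. \<epsilon> * K n x + Ce * (?p * (1 - exp (- (norm x)\<^sup>2))))"
        by (rule integral_mono)
          (intro integrable_abs Bochner_Integration.integrable_diff Bochner_Integration.integrable_add
            integrable_mult_right Fint Kint Tint pt)+
      also have "\<dots> = \<epsilon> * (LINT x|\<rho> n. K n x) + Ce * (?p * (LINT x|\<rho> n. 1 - exp (- (norm x)\<^sup>2)))"
        by (subst Bochner_Integration.integral_add) (simp_all only: integrable_mult_right Kint Tint integral_mult_right_zero)
      finally show ?thesis by (simp only: EK_def T_def)
    qed
    have "eventually (\<lambda>n. EK n < l + 1) sequentially" using EK by (rule order_tendstoD) simp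
    moreover have "(\<lambda>n. Ce * (\<phi> n powr (2 * b) * T n)) \<longlonglongrightarrow> Ce * 0"
      unfolding T_def by (intro tendsto_mult tendsto_const D)
    then have "eventually (\<lambda>n. Ce * (\<phi> n powr (2 * b) * T n) < e / 2) sequentially"
      by (rule order_tendstoD) (use e in simp)
    ultimately have "eventually (\<lambda>n. \<bar>\<phi> n powr (2 * b) * (LINT x|\<rho> n. Fb (norm x)) - Rb / k * EK n\<bar> < e) sequentially"
    proof eventually_elim
      case (elim n)
      have "\<epsilon> * EK n \<le> \<epsilon> * (l + 1)" using elim(1) \<epsilon> by (intro mult_left_mono) auto
      also have "\<dots> = e / 2" using l by (simp add: \<epsilon>_def divide_simps)
      finally show ?case using bd[of n] elim(2) by linarith
    qed
    then show "\<exists>no. \<forall>n\<ge>no. norm (\<phi> n powr (2 * b) * (LINT x|\<rho> n. Fb (norm x)) - Rb / k * EK n - 0) < e"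
      by (simp add: eventually_sequentially)
  qed
  from tendsto_add[OF this tendsto_mult[OF tendsto_const EK, of "Rb / k"]]
  show ?thesis by (simp add: k_def)
qed


section \<open>Small-time behaviour of the heat functional\<close>

text \<open>
  All three facts are read off from \<open>exp (- \<psi> x)\<close>, the characteristic function of the process at
  time 1: it is bounded by 1, equals 1 at the origin, and is continuous.
\<close>

lemma levy_exponent_properties:
  fixes \<psi> :: "'a::euclidean_space \<Rightarrow> real" and \<psi>\<^sub>0 :: "real \<Rightarrow> real"
  assumes levy: "levy_process M X" and exponent: "levy_khintchine_exponent M X \<psi>"
    and radial: "\<And>x. \<psi> x = \<psi>\<^sub>0 (norm x)"
  shows radial_exponent_nonneg: "\<And>r. 0 \<le> r \<Longrightarrow> 0 \<le> \<psi>\<^sub>0 r"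
    and radial_exponent_0: "\<psi>\<^sub>0 0 = 0"
    and radial_exponent_continuous: "continuous_on {0..} \<psi>\<^sub>0"
proof -
  interpret levy_process M X by fact
  have X1[measurable]: "X 1 \<in> borel_measurable M" using random_variable_at[of 1] by simp
  have char: "(LINT \<omega>|M. iexp (x \<bullet> X 1 \<omega>)) = complex_of_real (exp (- \<psi> x))" for x
    using exponent unfolding levy_khintchine_exponent_def by (metis mult_minus1 zero_le_one)
  obtain e :: 'a where e: "norm e = 1" using vector_choose_size[of 1] by auto
  have r: "\<psi>\<^sub>0 r = \<psi> (r *\<^sub>R e)" if "0 \<le> r" for r using that e by (simp add: radial)
  have "0 \<le> \<psi> x" for x
  proof -
    have "norm (LINT \<omega>|M. iexp (x \<bullet> X 1 \<omega>)) \<le> (LINT \<omega>|M. norm (iexp (x \<bullet> X 1 \<omega>)))"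
      by (rule integral_norm_bound)
    also have "\<dots> = 1" by (simp add: prob_space)
    finally show ?thesis unfolding char by simp
  qed
  then show "\<And>r. 0 \<le> r \<Longrightarrow> 0 \<le> \<psi>\<^sub>0 r" using r by simp
  have "complex_of_real (exp (- \<psi> 0)) = 1" using char[of 0] by (simp add: prob_space)
  then have "\<psi> 0 = 0" by (metis exp_eq_one_iff neg_equal_0_iff_equal of_real_eq_1_iff)
  then show "\<psi>\<^sub>0 0 = 0" using radial[of 0] by simp
  have cont: "continuous_on UNIV (\<lambda>x. LINT \<omega>|M. iexp (x \<bullet> X 1 \<omega>))"
    unfolding continuous_on_sequentially
  proof (intro allI ballI impI, unfold o_def)
    fix u :: "nat \<Rightarrow> 'a" and a assume "(\<forall>n. u n \<in> UNIV) \<and> u \<longlonglongrightarrow> a"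
    then have u: "u \<longlonglongrightarrow> a" by simp
    show "(\<lambda>n. LINT \<omega>|M. iexp (u n \<bullet> X 1 \<omega>)) \<longlonglongrightarrow> (LINT \<omega>|M. iexp (a \<bullet> X 1 \<omega>))"
    proof (rule integral_dominated_convergence[where w="\<lambda>_. 1"])
      show "AE \<omega> in M. (\<lambda>n. iexp (u n \<bullet> X 1 \<omega>)) \<longlonglongrightarrow> iexp (a \<bullet> X 1 \<omega>)"
        by (intro AE_I2 tendsto_intros u)
    qed auto
  qed
  have "\<psi> x = - ln (Re (LINT \<omega>|M. iexp (x \<bullet> X 1 \<omega>)))" for x unfolding char by simp
  moreover have "continuous_on UNIV (\<lambda>x. - ln (Re (LINT \<omega>|M. iexp (x \<bullet> X 1 \<omega>))))"
    by (intro continuous_intros cont) (simp add: char)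
  ultimately have "continuous_on UNIV \<psi>" by simp
  then have "continuous_on {0..} (\<lambda>r. \<psi> (r *\<^sub>R e))"
    by (rule continuous_on_compose2) (auto intro!: continuous_intros)
  then show "continuous_on {0..} \<psi>\<^sub>0" by (rule continuous_on_eq) (simp add: r)
qed

lemma sup_exponent_radial:
  fixes \<psi> :: "'a::euclidean_space \<Rightarrow> real"
  assumes "\<And>x. \<psi> x = \<psi>\<^sub>0 (norm x)" and "0 \<le> u"
  shows "sup_exponent \<psi> u = Sup (\<psi>\<^sub>0 ` {0..u})"
proof -
  obtain e :: 'a where e: "norm e = 1" using vector_choose_size[of 1] by auto
  have "r \<in> norm ` cball (0::'a) u" if "r \<in> {0..u}" for r
    using that e by (intro image_eqI[of _ _ "r *\<^sub>R e"]) auto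
  then have "norm ` cball (0::'a) u = {0..u}" by auto
  moreover have "\<psi> ` cball 0 u = \<psi>\<^sub>0 ` norm ` cball (0::'a) u"
    unfolding image_image by (simp add: assms(1))
  ultimately show ?thesis by (simp add: sup_exponent_def)
qed

lemma inverse_exponent_radial:
  fixes \<psi> :: "'a::euclidean_space \<Rightarrow> real"
  assumes "\<And>x. \<psi> x = \<psi>\<^sub>0 (norm x)"
  shows "inverse_exponent \<psi> w = Inf {x. 0 \<le> x \<and> w \<le> Sup (\<psi>\<^sub>0 ` {0..x})}"
  unfolding inverse_exponent_def using sup_exponent_radial[of \<psi> \<psi>\<^sub>0, OF assms]
  by (intro arg_cong[of _ _ Inf]) auto

lemma one_minus_exp_le: "1 - exp (- (a::real)) \<le> a"
  using exp_ge_add_one_self[of "- a"] by linarith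

text \<open>
  With \<open>\<phi> n\<close> the generalized inverse at \<open>1 / T n\<close> one has \<open>T n = 1 / \<psi>\<^sub>0 (\<phi> n)\<close> exactly. The scaling limit is
  then the definition of regular variation along \<open>\<phi> n\<close>, and the Potter-type bound gives the
  domination; for the finitely many \<open>n\<close> with \<open>\<phi> n\<close> small, and for \<open>u > 1\<close>, the trivial bound
  \<open>1 - exp (- a) \<le> 1\<close> suffices.
\<close>

lemma inverse_exponent_scaling:
  fixes \<psi>\<^sub>0 :: "real \<Rightarrow> real" and T \<phi> :: "nat \<Rightarrow> real"
  assumes cont: "continuous_on {0..} \<psi>\<^sub>0" and nonneg: "\<And>r. 0 \<le> r \<Longrightarrow> 0 \<le> \<psi>\<^sub>0 r" and zero: "\<psi>\<^sub>0 0 = 0"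
    and rv: "regularly_varying_at_infinity \<psi>\<^sub>0 \<alpha>" and \<gamma>: "0 < \<gamma>" "\<gamma> < \<alpha>"
    and T: "\<And>n. 0 < T n" "T \<longlonglongrightarrow> 0"
    and \<phi>_def: "\<And>n. \<phi> n = Inf {x. 0 \<le> x \<and> 1 / T n \<le> Sup (\<psi>\<^sub>0 ` {0..x})}"
  shows "\<And>n. 0 < \<phi> n" "filterlim \<phi> at_top sequentially"
    "\<And>u. 0 \<le> u \<Longrightarrow> (\<lambda>n. T n * \<psi>\<^sub>0 (\<phi> n * u)) \<longlonglongrightarrow> u powr \<alpha>"
    "\<exists>C\<ge>0. \<forall>n u. 0 \<le> u \<longrightarrow> 1 - exp (- (T n * \<psi>\<^sub>0 (\<phi> n * u))) \<le> C * (u powr \<gamma> + \<phi> n powr - \<gamma>)"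
proof -
  have unb: "\<exists>r\<ge>0. w \<le> \<psi>\<^sub>0 r" for w
    by (rule regularly_varying_unbounded[OF cont nonneg rv \<gamma>])
  have inv: "0 < \<phi> n" "\<psi>\<^sub>0 (\<phi> n) = 1 / T n" "Sup (\<psi>\<^sub>0 ` {0..\<phi> n}) = 1 / T n" for n
    unfolding \<phi>_def using T(1)[of n]
    by (intro generalized_inverse_of_Sup[OF cont zero _ unb]; simp)+
  show "\<And>n. 0 < \<phi> n" by (rule inv(1))
  show top: "filterlim \<phi> at_top sequentially"
    unfolding filterlim_at_top_gt[where c=0]
  proof (intro allI impI)
    fix Z :: real assume Z: "0 < Z"
    have "filterlim (\<lambda>n. inverse (T n)) at_top sequentially"
      by (intro filterlim_inverse_at_top T always_eventually allI)
    then have "eventually (\<lambda>n. Sup (\<psi>\<^sub>0 ` {0..Z}) < inverse (T n)) sequentially"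
      by (simp add: filterlim_at_top_dense)
    then show "eventually (\<lambda>n. Z \<le> \<phi> n) sequentially"
    proof eventually_elim
      case (elim n)
      show ?case
      proof (rule ccontr)
        assume "\<not> Z \<le> \<phi> n"
        then have "Sup (\<psi>\<^sub>0 ` {0..\<phi> n}) \<le> Sup (\<psi>\<^sub>0 ` {0..Z})"
          using inv(1)[of n] by (intro Sup_image_Icc_mono[OF cont]) auto
        then show False using elim inv(3)[of n] by (simp add: inverse_eq_divide)
      qed
    qed
  qed
  have Tq: "T n * \<psi>\<^sub>0 x = \<psi>\<^sub>0 x / \<psi>\<^sub>0 (\<phi> n)" for n x
    unfolding inv(2) using T(1)[of n] by simp
  show "(\<lambda>n. T n * \<psi>\<^sub>0 (\<phi> n * u)) \<longlonglongrightarrow> u powr \<alpha>" if "0 \<le> u" for u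
  proof (cases "u = 0")
    case False
    with that have "((\<lambda>s. \<psi>\<^sub>0 (u * s) / \<psi>\<^sub>0 s) \<longlongrightarrow> u powr \<alpha>) at_top"
      using rv by (simp add: regularly_varying_at_infinity_def)
    from filterlim_compose[OF this top] show ?thesis by (simp add: Tq mult.commute)
  qed (simp add: zero)
  obtain s1 C where s1: "0 < s1" and C: "1 \<le> C" and
    potter: "\<And>s u. s1 \<le> s \<Longrightarrow> 0 \<le> u \<Longrightarrow> u \<le> 1 \<Longrightarrow> \<psi>\<^sub>0 (s * u) \<le> C * (u powr \<gamma> + s powr - \<gamma>) * Sup (\<psi>\<^sub>0 ` {0..s})"
    using regularly_varying_potter_bound[OF cont nonneg rv \<gamma>] by blast
  show "\<exists>C\<ge>0. \<forall>n u. 0 \<le> u \<longrightarrow> 1 - exp (- (T n * \<psi>\<^sub>0 (\<phi> n * u))) \<le> C * (u powr \<gamma> + \<phi> n powr - \<gamma>)"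
  proof (intro exI[of _ "C + s1 powr \<gamma>"] conjI allI impI)
    show "0 \<le> C + s1 powr \<gamma>" using C by (simp add: add_nonneg_nonneg)
    fix n and u :: real assume u: "0 \<le> u"
    let ?e = "1 - exp (- (T n * \<psi>\<^sub>0 (\<phi> n * u)))"
    let ?S = "u powr \<gamma> + \<phi> n powr - \<gamma>"
    have S: "0 \<le> ?S" by simp
    have e1: "?e \<le> 1" by simp
    show "?e \<le> (C + s1 powr \<gamma>) * ?S"
    proof (cases "s1 \<le> \<phi> n")
      case False
      have "1 \<le> s1 powr \<gamma> * \<phi> n powr - \<gamma>"
      proof -
        have "\<phi> n powr \<gamma> \<le> s1 powr \<gamma>" using False inv(1)[of n] \<gamma> by (intro powr_mono2) auto
        then show ?thesis using inv(1)[of n] by (simp add: powr_minus_divide)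
      qed
      also have "\<dots> \<le> (C + s1 powr \<gamma>) * ?S" using C by (intro mult_mono) auto
      finally show ?thesis using e1 by linarith
    next
      case True
      show ?thesis
      proof (cases "u \<le> 1")
        case False
        have "1 \<le> ?S"
          using ge_one_powr_ge_zero[of u \<gamma>] False \<gamma> powr_ge_zero[of "\<phi> n" "- \<gamma>"] by linarith
        then have "1 * 1 \<le> (C + s1 powr \<gamma>) * ?S"
          using C by (intro mult_mono) (auto intro: add_increasing2)
        then show ?thesis using e1 by linarith
      next
        case u1: True
        have "?e \<le> T n * \<psi>\<^sub>0 (\<phi> n * u)" by (rule one_minus_exp_le)
        also have "\<dots> \<le> T n * (C * ?S * Sup (\<psi>\<^sub>0 ` {0..\<phi> n}))"
          using T(1)[of n] by (intro mult_left_mono potter True u u1) auto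
        also have "\<dots> = C * ?S" unfolding inv(3) using T(1)[of n] by simp
        also have "\<dots> \<le> (C + s1 powr \<gamma>) * ?S" using S by (intro mult_right_mono) auto
        finally show ?thesis .
      qed
    qed
  qed
qed

text \<open>
  The bounds and, by dominated convergence with the constant \<open>L\<close> as majorant, the limit pass from
  \<open>F\<close> to its spherical means. Only the values of \<open>R\<close> on the unit sphere enter; there \<open>R\<close> is measurable
  as a pointwise limit.
\<close>

lemma spherical_mean_properties:
  fixes F :: "'a::euclidean_space \<Rightarrow> real" and R :: "'a \<Rightarrow> real" and L B \<beta> :: real
  assumes F[measurable]: "F \<in> borel_measurable borel"
    and FL: "\<And>x. \<bar>F x\<bar> \<le> L * norm x powr \<beta>" and FB: "\<And>x. \<bar>F x\<bar> \<le> B"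
    and lim: "\<And>\<theta>. \<theta> \<in> sphere 0 1 \<Longrightarrow> ((\<lambda>t. t powr - \<beta> * F (t *\<^sub>R \<theta>)) \<longlongrightarrow> R \<theta>) (at_right 0)"
  defines "c \<equiv> DIM('a) * unit_ball_vol DIM('a)"
  defines "Fb \<equiv> \<lambda>z. (LINT \<theta>|sphere_measure. F (z *\<^sub>R \<theta>)) / c"
  shows "Fb \<in> borel_measurable borel"
    "\<And>z. 0 \<le> z \<Longrightarrow> \<bar>Fb z\<bar> \<le> L * z powr \<beta>" "\<And>z. \<bar>Fb z\<bar> \<le> B"
    "((\<lambda>z. Fb z / z powr \<beta>) \<longlongrightarrow> (LINT \<theta>:sphere 0 1|sphere_measure. R \<theta>) / c) (at_right 0)"
proof -
  let ?\<sigma> = "sphere_measure :: 'a measure"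
  interpret S: finite_measure ?\<sigma> by (rule finite_measure_sphere_measure)
  have c: "0 < c" by (simp add: c_def)
  have tot: "measure ?\<sigma> UNIV = c"
    by (simp add: measure_def emeasure_sphere_measure_UNIV c_def)
  have mF: "(\<lambda>\<theta>. F (z *\<^sub>R \<theta>)) \<in> borel_measurable ?\<sigma>" for z by simp
  have intF: "integrable ?\<sigma> (\<lambda>\<theta>. F (z *\<^sub>R \<theta>))" for z
    using FB by (intro S.integrable_const_bound[of _ B] mF) auto
  have bnd: "\<bar>Fb z\<bar> \<le> K" if "AE \<theta> in ?\<sigma>. \<bar>F (z *\<^sub>R \<theta>)\<bar> \<le> K" for z K
  proof -
    have "\<bar>LINT \<theta>|?\<sigma>. F (z *\<^sub>R \<theta>)\<bar> \<le> (LINT \<theta>|?\<sigma>. \<bar>F (z *\<^sub>R \<theta>)\<bar>)" by (rule integral_abs_bound)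
    also have "\<dots> \<le> (LINT \<theta>|?\<sigma>. K)" using that by (intro integral_mono_AE integrable_abs intF) auto
    also have "\<dots> = K * c" by (simp add: tot)
    finally show ?thesis using c by (simp add: Fb_def field_simps)
  qed
  show "Fb \<in> borel_measurable borel"
  proof -
    have "(\<lambda>z. F (fst z *\<^sub>R snd z)) \<in> borel_measurable (borel \<Otimes>\<^sub>M borel)" by measurable
    then have "(\<lambda>(z, \<theta>). F (z *\<^sub>R \<theta>)) \<in> borel_measurable (borel \<Otimes>\<^sub>M ?\<sigma>)"
      unfolding split_beta' using measurable_cong_sets[OF sets_pair_measure_cong[OF refl sets_sphere_measure] refl, of borel "borel :: real measure"] by blast
    from S.borel_measurable_lebesgue_integral[OF this] show ?thesis
      unfolding Fb_def by (rule borel_measurable_divide) simp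
  qed
  show "\<bar>Fb z\<bar> \<le> L * z powr \<beta>" if "0 \<le> z" for z
  proof (rule bnd)
    show "AE \<theta> in ?\<sigma>. \<bar>F (z *\<^sub>R \<theta>)\<bar> \<le> L * z powr \<beta>"
      using AE_sphere_measure
    proof eventually_elim
      case (elim \<theta>)
      then show ?case using FL[of "z *\<^sub>R \<theta>"] that by simp
    qed
  qed
  show "\<bar>Fb z\<bar> \<le> B" for z by (rule bnd) (simp add: FB)
  show "((\<lambda>z. Fb z / z powr \<beta>) \<longlongrightarrow> (LINT \<theta>:sphere 0 1|sphere_measure. R \<theta>) / c) (at_right 0)"
    unfolding tendsto_at_iff_sequentially
  proof (intro allI impI, unfold o_def)
    fix z :: "nat \<Rightarrow> real" assume z0: "\<forall>i. z i \<in> {0<..} - {0}" and z1: "z \<longlonglongrightarrow> 0"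
    have z: "0 < z n" for n using z0 by auto
    have fl: "filterlim z (at_right 0) sequentially"
      using z z1 by (intro tendsto_imp_filterlim_at_right always_eventually allI)
    define s where "s n \<theta> = z n powr - \<beta> * F (z n *\<^sub>R \<theta>)" for n \<theta>
    have sm[measurable]: "s n \<in> borel_measurable borel" for n unfolding s_def by measurable
    have sl: "(\<lambda>n. s n \<theta>) \<longlonglongrightarrow> R \<theta>" if "\<theta> \<in> sphere 0 1" for \<theta>
      unfolding s_def by (rule filterlim_compose[OF lim[OF that] fl])
    have "(\<lambda>n. indicator (sphere 0 1) \<theta> *\<^sub>R s n \<theta>) \<longlonglongrightarrow> indicator (sphere 0 1) \<theta> *\<^sub>R R \<theta>" for \<theta>
      using sl[of \<theta>] by (cases "\<theta> \<in> sphere 0 1") (auto simp: indicator_def)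
    moreover have "(\<lambda>\<theta>. indicator (sphere 0 1) \<theta> *\<^sub>R s n \<theta>) \<in> borel_measurable borel" for n
      by (intro borel_measurable_scaleR borel_measurable_indicator sm borel_closed closed_sphere)
    ultimately have Rm: "(\<lambda>\<theta>. indicator (sphere 0 1) \<theta> *\<^sub>R R \<theta>) \<in> borel_measurable borel"
      by (rule borel_measurable_LIMSEQ_metric[rotated])
    have "(\<lambda>n. LINT \<theta>|?\<sigma>. s n \<theta>) \<longlonglongrightarrow> (LINT \<theta>|?\<sigma>. indicator (sphere 0 1) \<theta> *\<^sub>R R \<theta>)"
    proof (rule integral_dominated_convergence[where w="\<lambda>_. L"])
      show "AE \<theta> in ?\<sigma>. (\<lambda>n. s n \<theta>) \<longlonglongrightarrow> indicator (sphere 0 1) \<theta> *\<^sub>R R \<theta>"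
        using AE_sphere_measure
      proof eventually_elim
        case (elim \<theta>)
        then show ?case using sl[OF elim] by simp
      qed
      show "AE \<theta> in ?\<sigma>. norm (s n \<theta>) \<le> L" for n
        using AE_sphere_measure
      proof eventually_elim
        case (elim \<theta>)
        have "\<bar>F (z n *\<^sub>R \<theta>)\<bar> \<le> L * z n powr \<beta>" using FL[of "z n *\<^sub>R \<theta>"] elim z[of n] by simp
        then have "z n powr - \<beta> * \<bar>F (z n *\<^sub>R \<theta>)\<bar> \<le> z n powr - \<beta> * (L * z n powr \<beta>)"
          by (rule mult_left_mono) simp
        also have "\<dots> = L" using z[of n] by (simp add: powr_minus_divide)
        finally show ?case by (simp add: s_def abs_mult)
      qed
    qed (use Rm sm in simp_all)
    then have "(\<lambda>n. (LINT \<theta>|?\<sigma>. s n \<theta>) / c) \<longlonglongrightarrow> (LINT \<theta>|?\<sigma>. indicator (sphere 0 1) \<theta> *\<^sub>R R \<theta>) / c"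
      using c by (intro tendsto_divide tendsto_const) auto
    moreover have "Fb (z n) / z n powr \<beta> = (LINT \<theta>|?\<sigma>. s n \<theta>) / c" for n
      by (simp add: Fb_def s_def powr_minus_divide)
    ultimately show "(\<lambda>n. Fb (z n) / z n powr \<beta>) \<longlonglongrightarrow> (LINT \<theta>:sphere 0 1|?\<sigma>. R \<theta>) / c"
      by (simp add: set_lebesgue_integral_def)
  qed
qed

text \<open>
  Fubini writes the heat functional at any time as the expectation of \<open>r\<close> at the position of
  the process; the law being symmetric, \<open>r x\<close> may be replaced by the mean of \<open>r x\<close> and \<open>r (- x)\<close>.
\<close>

lemma second_difference_expectation:
  fixes X :: "real \<Rightarrow> 'w \<Rightarrow> 'a::euclidean_space" and g :: "'a \<Rightarrow> real"
  assumes iso: "isotropic_levy_process M X" and \<mu>: "finite_measure \<mu>" "sets \<mu> = sets borel"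
    and g: "g \<in> borel_measurable borel" "\<And>x. \<bar>g x\<bar> \<le> G" and t: "0 < t"
  defines "r \<equiv> translation_average g \<mu>"
  shows "r \<in> borel_measurable borel" "\<And>x. \<bar>r x\<bar> \<le> G * measure \<mu> UNIV"
    "heat_functional M X g \<mu> t - heat_functional M X g \<mu> 0 =
      (LINT x|distr M borel (X t). r x + r (- x) - 2 * r 0) / 2"
proof -
  interpret isotropic_levy_process M X by fact
  interpret \<mu>: finite_measure \<mu> by fact
  interpret P: pair_sigma_finite M \<mu> ..
  interpret PF: finite_measure "M \<Otimes>\<^sub>M \<mu>" by (rule finite_measure_pair_measure) (unfold_locales)
  have sp: "space \<mu> = UNIV" using sets_eq_imp_space_eq[OF \<mu>(2)] by simp
  have gm: "(\<lambda>z. g (fst z + snd z)) \<in> borel_measurable (borel \<Otimes>\<^sub>M borel)" using g(1) by measurable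
  have rm: "(\<lambda>x. LINT y|\<mu>. g (x + y)) \<in> borel_measurable borel"
  proof -
    have "(\<lambda>(x, y). g (x + y)) \<in> borel_measurable (borel \<Otimes>\<^sub>M \<mu>)"
      unfolding split_beta' using gm measurable_cong_sets[OF sets_pair_measure_cong[OF refl \<mu>(2)] refl, of borel "borel :: real measure"] by blast
    then show ?thesis by (rule \<mu>.borel_measurable_lebesgue_integral)
  qed
  then show rm: "r \<in> borel_measurable borel" by (simp add: r_def translation_average_def[abs_def])
  have gint: "integrable \<mu> (\<lambda>y. g (x + y))" for x
  proof (rule \<mu>.integrable_const_bound[of _ G])
    have "(\<lambda>y. g (x + y)) \<in> borel_measurable borel" using g(1) by measurable
    then show "(\<lambda>y. g (x + y)) \<in> borel_measurable \<mu>"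
      using measurable_cong_sets[OF \<mu>(2) refl, of "borel :: real measure"] by blast
  qed (use g in auto)
  show rb: "\<bar>r x\<bar> \<le> G * measure \<mu> UNIV" for x
  proof -
    have "\<bar>r x\<bar> \<le> (LINT y|\<mu>. \<bar>g (x + y)\<bar>)" unfolding r_def translation_average_def by (rule integral_abs_bound)
    also have "\<dots> \<le> (LINT y|\<mu>. G)" using g(2) by (intro integral_mono integrable_abs gint) auto
    finally show ?thesis by (simp add: sp mult.commute)
  qed
  have H: "heat_functional M X g \<mu> u = (LINT \<omega>|M. r (X u \<omega>))" if u: "0 \<le> u" for u
  proof -
    have Xm: "X u \<in> borel_measurable M" by (rule random_variable_at[OF u])
    have "(\<lambda>z. (X u (fst z), snd z)) \<in> measurable (M \<Otimes>\<^sub>M \<mu>) (borel \<Otimes>\<^sub>M borel)"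
    proof (rule measurable_Pair)
      show "(\<lambda>z. X u (fst z)) \<in> borel_measurable (M \<Otimes>\<^sub>M \<mu>)" using Xm by measurable
      show "snd \<in> borel_measurable (M \<Otimes>\<^sub>M \<mu>)"
        using measurable_snd[of M \<mu>] measurable_cong_sets[OF refl \<mu>(2), of "M \<Otimes>\<^sub>M \<mu>"] by blast
    qed
    from measurable_compose[OF this gm]
    have "(\<lambda>(\<omega>, x). g (X u \<omega> + x)) \<in> borel_measurable (M \<Otimes>\<^sub>M \<mu>)" by (simp add: split_beta')
    then have int: "integrable (M \<Otimes>\<^sub>M \<mu>) (\<lambda>(\<omega>, x). g (X u \<omega> + x))"
      using g(2) by (intro PF.integrable_const_bound[of _ G]) (auto simp: split_beta')
    show ?thesis
      unfolding heat_functional_def r_def translation_average_def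
      using P.Fubini_integral[OF int] by (simp add: add.commute)
  qed
  have H0: "heat_functional M X g \<mu> 0 = r 0"
  proof -
    have "(LINT \<omega>|M. r (X 0 \<omega>)) = (LINT \<omega>|M. r 0)"
    proof (rule integral_cong_AE)
      show "(\<lambda>\<omega>. r (X 0 \<omega>)) \<in> borel_measurable M"
        using random_variable_at[of 0] rm by (intro measurable_compose[OF _ rm]) simp
      show "AE \<omega> in M. r (X 0 \<omega>) = r 0" using start_at_0 by eventually_elim simp
    qed simp
    then show ?thesis using H[of 0] by (simp add: prob_space)
  qed
  let ?\<rho> = "distr M borel (X t)"
  have Xm: "X t \<in> borel_measurable M" using random_variable_at t by simp
  interpret \<rho>: prob_space ?\<rho> by (rule prob_space_distr[OF Xm])
  have i1: "integrable ?\<rho> r"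
    using rb rm by (intro \<rho>.integrable_const_bound[of _ "G * measure \<mu> UNIV"]) auto
  have rm': "(\<lambda>x. r (- x)) \<in> borel_measurable borel" using rm by measurable
  have i2: "integrable ?\<rho> (\<lambda>x. r (- x))"
    using rb rm' by (intro \<rho>.integrable_const_bound[of _ "G * measure \<mu> UNIV"]) auto
  have Ht: "heat_functional M X g \<mu> t = (LINT x|?\<rho>. r x)"
    using H[of t] t by (simp add: integral_distr[OF Xm rm])
  have "orthogonal_transformation (\<lambda>x::'a. - x)"
    by (simp add: orthogonal_transformation_def linear_uminus)
  from isotropic[OF t this] have sym: "distr M borel (\<lambda>\<omega>. - X t \<omega>) = ?\<rho>" .
  have "(LINT x|?\<rho>. r (- x)) = (LINT \<omega>|M. r (- X t \<omega>))" by (rule integral_distr[OF Xm rm'])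
  also have "\<dots> = (LINT x|distr M borel (\<lambda>\<omega>. - X t \<omega>). r x)"
    using Xm by (intro integral_distr[symmetric] rm) measurable
  finally have "(LINT x|?\<rho>. r (- x)) = (LINT x|?\<rho>. r x)" unfolding sym .
  then show "heat_functional M X g \<mu> t - heat_functional M X g \<mu> 0 = (LINT x|?\<rho>. r x + r (- x) - 2 * r 0) / 2"
    using i1 i2 \<rho>.prob_space by (simp add: Ht H0)
qed


theorem corollary1:
  fixes M :: "'w measure"
    and X :: "real \<Rightarrow> 'w \<Rightarrow> 'a::euclidean_space"
    and \<psi> :: "'a \<Rightarrow> real"
    and \<psi>\<^sub>0 :: "real \<Rightarrow> real"
    and g :: "'a \<Rightarrow> real"
    and \<mu> :: "'a measure"
    and R :: "'a \<Rightarrow> real"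
    and \<alpha> \<beta> L :: real
  assumes "1 \<le> \<beta>" and "\<beta> < 2"
    and "isotropic_levy_process M X"
    and "levy_khintchine_exponent M X \<psi>"
    and "\<And>x. \<psi> x = \<psi>\<^sub>0 (norm x)"
    and "\<beta> < \<alpha>" and "\<alpha> \<le> 2"
    and "regularly_varying_at_infinity \<psi>\<^sub>0 \<alpha>"
    and "g \<in> borel_measurable borel" and "bounded (range g)"
    and "finite_measure \<mu>" and "sets \<mu> = sets borel"
    and "\<And>\<theta>. \<theta> \<in> sphere 0 1 \<Longrightarrow>
      ((\<lambda>t. t powr (- \<beta>) *
          (translation_average g \<mu> (t *\<^sub>R \<theta>) + translation_average g \<mu> (- (t *\<^sub>R \<theta>))
            - 2 * translation_average g \<mu> 0))
        \<longlongrightarrow> R \<theta>) (at_right 0)"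
    and "0 < L"
    and "\<And>x. \<bar>translation_average g \<mu> x + translation_average g \<mu> (- x)
        - 2 * translation_average g \<mu> 0\<bar> \<le> L * norm x powr \<beta>"
  shows "((\<lambda>t. inverse_exponent \<psi> (1 / t) powr \<beta> *
            (heat_functional M X g \<mu> t - heat_functional M X g \<mu> 0))
      \<longlongrightarrow> pi powr (- real DIM('a) / 2) * 4 powr (\<beta> / 2 - 1)
          * Gamma ((real DIM('a) + \<beta>) / 2)
          * (Gamma (1 - \<beta> / \<alpha>) / Gamma (1 - \<beta> / 2))
          * (LINT \<theta>:sphere 0 1|sphere_measure. R \<theta>)) (at_right 0)"
proof -
  interpret isotropic_levy_process M X by fact
  have levy: "levy_process M X" by unfold_locales
  define r where "r = translation_average g \<mu>"
  define F where "F x = r x + r (- x) - 2 * r 0" for x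
  define b where "b = \<beta> / 2"
  have b: "0 < b" "b < 1" "2 * b = \<beta>" using assms(1,2) by (auto simp: b_def)
  \<comment> \<open>Any order strictly between \<open>\<beta>\<close> and \<open>\<alpha>\<close> would do.\<close>
  define \<gamma> where "\<gamma> = (\<alpha> + \<beta>) / 2"
  have \<gamma>: "0 < \<gamma>" "\<gamma> < \<alpha>" "\<beta> < \<gamma>" using assms(1,6) by (auto simp: \<gamma>_def)
  define c where "c = DIM('a) * unit_ball_vol DIM('a)"
  define Fb where "Fb z = (LINT \<theta>|(sphere_measure :: 'a measure). F (z *\<^sub>R \<theta>)) / c" for z
  define I where "I = (LINT \<theta>:sphere 0 1|sphere_measure. R \<theta>)"
  define l where "l = 4 powr b * Gamma (real DIM('a) / 2 + b) / Gamma (real DIM('a) / 2) * Gamma (1 - 2 * b / \<alpha>) / b"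
  have "2 * b / \<alpha> < 1" using b \<gamma> by simp
  then have l: "0 \<le> l"
    unfolding l_def using b by (intro mult_nonneg_nonneg divide_nonneg_nonneg Gamma_real_nonneg) auto
  obtain G where G: "\<And>x. \<bar>g x\<bar> \<le> G"
    using assms(10) by (auto simp: bounded_iff)
  define B where "B = 4 * (G * measure \<mu> UNIV)"
  have rm: "r \<in> borel_measurable borel" and rb: "\<And>x. \<bar>r x\<bar> \<le> G * measure \<mu> UNIV"
    unfolding r_def using second_difference_expectation(1,2)[OF assms(3,11,12,9) G, of 1] by auto
  have Fm: "F \<in> borel_measurable borel" unfolding F_def using rm by measurable
  have FB: "\<bar>F x\<bar> \<le> B" for x
    using rb[of x] rb[of "- x"] rb[of 0] unfolding F_def B_def by linarith
  have FL: "\<bar>F x\<bar> \<le> L * norm x powr \<beta>" for x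
    using assms(15)[of x] by (simp add: F_def r_def)
  have Flim: "((\<lambda>t. t powr - \<beta> * F (t *\<^sub>R \<theta>)) \<longlongrightarrow> R \<theta>) (at_right 0)" if "\<theta> \<in> sphere 0 1" for \<theta>
    using assms(13)[OF that] by (simp add: F_def r_def)
  have Fbm: "Fb \<in> borel_measurable borel"
    unfolding Fb_def c_def I_def b(3)
    by (rule spherical_mean_properties(1)[of F L \<beta> B R]; fact)
  have FbL: "\<bar>Fb z\<bar> \<le> L * z powr (2 * b)" if "0 \<le> z" for z
    unfolding Fb_def c_def I_def b(3)
    by (rule spherical_mean_properties(2)[of F L \<beta> B R]; fact)
  have FbB: "\<bar>Fb z\<bar> \<le> B" for z
    unfolding Fb_def c_def I_def b(3)
    by (rule spherical_mean_properties(3)[of F L \<beta> B R]; fact)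
  have Fblim: "((\<lambda>z. Fb z / z powr (2 * b)) \<longlongrightarrow> I / c) (at_right 0)"
    unfolding Fb_def c_def I_def b(3)
    by (rule spherical_mean_properties(4)[of F L \<beta> B R]; fact)
  have nonneg: "0 \<le> \<psi>\<^sub>0 r" if "0 \<le> r" for r
    by (rule radial_exponent_nonneg[of M X \<psi>]; fact)
  have zero: "\<psi>\<^sub>0 0 = 0" by (rule radial_exponent_0[of M X \<psi>]; fact)
  have cont: "continuous_on {0..} \<psi>\<^sub>0" by (rule radial_exponent_continuous[of M X \<psi>]; fact)
  show ?thesis
    unfolding tendsto_at_iff_sequentially
  proof (intro allI impI, unfold o_def)
    fix T :: "nat \<Rightarrow> real" assume T': "\<forall>i. T i \<in> {0<..} - {0}" and T0: "T \<longlonglongrightarrow> 0"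
    have T: "0 < T n" for n using T' by auto
    define \<phi> where "\<phi> n = inverse_exponent \<psi> (1 / T n)" for n
    define \<rho> where "\<rho> n = distr M borel (X (T n))" for n
    have Xm: "X (T n) \<in> borel_measurable M" for n using random_variable_at T[of n] by simp
    have \<rho>: "prob_space (\<rho> n)" "sets (\<rho> n) = sets borel" for n
      unfolding \<rho>_def by (auto intro: prob_space_distr[OF Xm])
    have char: "(LINT y|\<rho> n. iexp (x \<bullet> y)) = complex_of_real (exp (- (T n * \<psi>\<^sub>0 (norm x))))" for n x
    proof -
      have "(LINT y|\<rho> n. iexp (x \<bullet> y)) = (LINT \<omega>|M. iexp (x \<bullet> X (T n) \<omega>))"
        unfolding \<rho>_def by (rule integral_distr[OF Xm]) measurable
      then show ?thesis
        using assms(4) T[of n] unfolding levy_khintchine_exponent_def assms(5) by simp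
    qed
    have \<phi>_eq: "\<phi> n = Inf {x. 0 \<le> x \<and> 1 / T n \<le> Sup (\<psi>\<^sub>0 ` {0..x})}" for n
      unfolding \<phi>_def inverse_exponent_radial[of \<psi> \<psi>\<^sub>0, OF assms(5)] ..
    have \<phi>_pos: "0 < \<phi> n" for n
      by (rule inverse_exponent_scaling(1)[of \<psi>\<^sub>0 \<alpha> \<gamma> T \<phi>]; fact)
    have \<phi>_top: "filterlim \<phi> at_top sequentially"
      by (rule inverse_exponent_scaling(2)[of \<psi>\<^sub>0 \<alpha> \<gamma> T \<phi>]; fact)
    have q_lim: "(\<lambda>n. T n * \<psi>\<^sub>0 (\<phi> n * u)) \<longlonglongrightarrow> u powr \<alpha>" if "0 \<le> u" for u
      by (rule inverse_exponent_scaling(3)[of \<psi>\<^sub>0 \<alpha> \<gamma> T \<phi>]; fact)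
    have "\<exists>C\<ge>0. \<forall>n u. 0 \<le> u \<longrightarrow> 1 - exp (- (T n * \<psi>\<^sub>0 (\<phi> n * u))) \<le> C * (u powr \<gamma> + \<phi> n powr - \<gamma>)"
      by (rule inverse_exponent_scaling(4)[of \<psi>\<^sub>0 \<alpha> \<gamma> T \<phi>]; fact)
    then obtain C where C: "0 \<le> C" and bound: "\<And>n u. 0 \<le> u \<Longrightarrow>
        1 - exp (- (T n * \<psi>\<^sub>0 (\<phi> n * u))) \<le> C * (u powr \<gamma> + \<phi> n powr - \<gamma>)"
      by blast
    have q_cont: "continuous_on {0..} (\<lambda>r. T n * \<psi>\<^sub>0 r)" for n
      using cont by (intro continuous_intros)
    have q_nonneg: "0 \<le> T n * \<psi>\<^sub>0 r" if "0 \<le> r" for n r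
      using nonneg[OF that] T[of n] by simp
    have "0 < \<beta>" "2 * b < \<gamma>" using b \<gamma> by auto
    have E: "(\<lambda>n. \<integral>\<^sup>+x. trunc_power b (\<phi> n powr - 2) (\<phi> n * norm x) \<partial>\<rho> n) \<longlonglongrightarrow> ennreal l"
      unfolding l_def
      by (rule scaled_trunc_power_tendsto[where q="\<lambda>n r. T n * \<psi>\<^sub>0 r" and C=C and \<gamma>=\<gamma>]; fact)
    have "(\<lambda>n. \<phi> n powr \<beta> * (LINT x|\<rho> n. 1 - exp (- (norm x)\<^sup>2))) \<longlonglongrightarrow> 0"
      by (rule scaled_tail_tendsto_0[where q="\<lambda>n r. T n * \<psi>\<^sub>0 r" and C=C and \<gamma>=\<gamma>]; fact)
    then have D: "(\<lambda>n. \<phi> n powr (2 * b) * (LINT x|\<rho> n. 1 - exp (- (norm x)\<^sup>2))) \<longlonglongrightarrow> 0"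
      by (simp only: b(3))
    have "(\<lambda>n. \<phi> n powr (2 * b) * (LINT x|\<rho> n. Fb (norm x))) \<longlonglongrightarrow> (I / c) / (Gamma (1 - b) / b) * l"
      by (rule radial_average_tendsto[where L=L and B=B]; (rule FbB | fact))
    then have "(\<lambda>n. \<phi> n powr (2 * b) * (LINT x|\<rho> n. Fb (norm x)) / 2) \<longlonglongrightarrow> (I / c) / (Gamma (1 - b) / b) * l / 2"
      by (intro tendsto_divide tendsto_const) auto
    moreover have "\<phi> n powr (2 * b) * (LINT x|\<rho> n. Fb (norm x)) / 2 =
        inverse_exponent \<psi> (1 / T n) powr \<beta> * (heat_functional M X g \<mu> (T n) - heat_functional M X g \<mu> 0)" for n
    proof -
      have inv: "distr (\<rho> n) borel S = \<rho> n" if S: "orthogonal_transformation S" for S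
        unfolding \<rho>_def using isotropic[OF T S] borel_measurable_orthogonal_transformation[OF S] Xm
        by (subst distr_distr) (auto simp: o_def)
      have F0: "F 0 = 0" by (simp add: F_def)
      have "heat_functional M X g \<mu> (T n) - heat_functional M X g \<mu> 0 = (LINT x|\<rho> n. F x) / 2"
        unfolding F_def r_def \<rho>_def by (rule second_difference_expectation(3)[OF assms(3,11,12,9) G T])
      also have "(LINT x|\<rho> n. F x) = (LINT x|\<rho> n. Fb (norm x))"
        unfolding Fb_def c_def
        by (rule isotropic_law_polar[OF prob_space.finite_measure[OF \<rho>(1)] \<rho>(2) inv Fm FB F0])
      finally show ?thesis by (simp add: \<phi>_def b(3))
    qed
    moreover have "(I / c) / (Gamma (1 - b) / b) * l / 2 =
        pi powr (- real DIM('a) / 2) * 4 powr (\<beta> / 2 - 1) * Gamma ((real DIM('a) + \<beta>) / 2)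
          * (Gamma (1 - \<beta> / \<alpha>) / Gamma (1 - \<beta> / 2)) * I"
    proof -
      have c: "c = 2 * pi powr (real DIM('a) / 2) / Gamma (real DIM('a) / 2)"
        unfolding c_def by (rule sphere_area_eq)
      \<comment> \<open>The factor \<open>Gamma (d / 2)\<close> of the Gaussian moment cancels against the surface area \<open>c\<close> of the sphere.\<close>
      have cancel: "(i / (2 * p / g)) / (h / b) * (f * u / g * v / b) / 2 = 1 / p * (f / 4) * u * (v / h) * i"
        if "0 < p" "0 < g" "0 < h" for i p g h f u v :: real
        using that b(1) by (simp add: field_simps)
      have "0 < pi powr (real DIM('a) / 2)" "0 < Gamma (real DIM('a) / 2)" "0 < Gamma (1 - b)" using b by auto
      note cancel[OF this, of I "4 powr b" "Gamma (real DIM('a) / 2 + b)" "Gamma (1 - 2 * b / \<alpha>)"]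
      moreover have "pi powr (- real DIM('a) / 2) = 1 / pi powr (real DIM('a) / 2)"
        by (simp add: powr_minus_divide)
      moreover have "4 powr (\<beta> / 2 - 1) = 4 powr b / 4" by (simp add: powr_diff b_def)
      moreover have "(real DIM('a) + \<beta>) / 2 = real DIM('a) / 2 + b" by (simp add: b_def add_divide_distrib)
      ultimately show ?thesis
        unfolding c l_def by (simp only: b(3) b_def[symmetric])
    qed
    ultimately show "(\<lambda>n. inverse_exponent \<psi> (1 / T n) powr \<beta> * (heat_functional M X g \<mu> (T n) - heat_functional M X g \<mu> 0))
      \<longlonglongrightarrow> pi powr (- real DIM('a) / 2) * 4 powr (\<beta> / 2 - 1) * Gamma ((real DIM('a) + \<beta>) / 2)
          * (Gamma (1 - \<beta> / \<alpha>) / Gamma (1 - \<beta> / 2)) * (LINT \<theta>:sphere 0 1|sphere_measure. R \<theta>)"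
      by (simp only: I_def)
  qed
qed

end
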